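(* Let $\mathcal M,\mathcal U>0$ and set $$X:=\Big\{(u,m)\in L^\infty((0,T);W^{1,\infty}(\mathbb T^d))\times L^\infty((0,T)\times\mathbb T^d)\ :\ \sup_{[0,T]\times\mathbb T^d} m\le \mathcal M,\ \ \sup_{[0,T]\times \mathbb T^d}|Du|\le \mathcal U\Big\}.$$ There exists $\gamma>0$, only depending on $\kappa,\mathcal M,\mathcal U$ (in particular through the constants $L_{\mathcal U},\alpha_{\mathcal U},\beta_{\mathcal U}$ associated with $H$), such that if $$F(x,m)+\gamma m\ \text{ and }\ G(x,m)+\gamma m\ \text{ are nondecreasing for } m\in[0,\mathcal M],\ x\in\mathbb T^d,$$ then the mean field game system $$\begin{cases}-u_t-\kappa\Delta u+H(x,Du)=F(x,m(t)), & t\in(0,T)\\ m_t-\kappa\Delta m-\mathrm{div}(m H_p(x,Du))=0, & t\in(0,T)\\ m(x,0)=m_0(x),\quad u(x,T)=G(x,m(T))\end{cases}$$ admits at most one (classical) solution $(u,m)$ in $X$.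
   Context: $\mathbb T^d=\mathbb R^d/\mathbb Z^d$ is the flat torus, $T>0$ is the time horizon, $\kappa>0$ is a constant; $m(t,\cdot)$ is the density of a probability distribution on $\mathbb T^d$ and $m_0$ is the initial density. $D$ denotes the gradient in $x$; $H_p,H_{pp}$ denote derivatives in $p$. Standing assumptions. $H:\mathbb T^d\times\mathbb R^d\to\mathbb R$ is measurable in $x$, $p\mapsto H(x,p)$ is $C^2$, and for a.e. $x$: for every $K>0$ there is $L_K>0$ with $|H_p(x,p)|\le L_K$ for all $|p|\le K$; and for every $K>0$ there are $\alpha_K,\beta_K>0$ with $\alpha_K I\le H_{pp}(x,p)\le\beta_K I$ for all $|p|\le K$. $F,G:\mathbb T^d\times[0,\infty)\to\mathbb R$ are measurable in $x$ and, for a.e. $x$: for every $K>0$ there are $c_K,\ell_K>0$ with $|F(x,m)|\le c_K$ and $|F(x,m)-F(x,m')|\le\ell_K|m-m'|$ whenever $m,m'\ge0$, $|m|,|m'|\le K$; and similarly for $G$ with constants $\hat c_K,\hat\ell_K$. *)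

theory Defs
  imports "HOL-Analysis.Analysis"
begin

(* A function on the torus R^n / Z^n is a function on R^n that is 1-periodic in every
   coordinate; the measure of the torus is Lebesgue measure on the unit cell. *)

definition periodic :: "(real^'n \<Rightarrow> 'b) \<Rightarrow> bool" where
  "periodic f \<longleftrightarrow> (\<forall>x i. f (x + axis i 1) = f x)"

abbreviation torus :: "(real^'n) measure" where
  "torus \<equiv> lebesgue_on (cbox 0 1)"

definition grad :: "(real^'n \<Rightarrow> real) \<Rightarrow> real^'n \<Rightarrow> real^'n" where
  "grad f x = (\<chi> i. frechet_derivative f (at x) (axis i 1))"

definition hessian :: "(real^'n \<Rightarrow> real) \<Rightarrow> real^'n \<Rightarrow> real^'n^'n" where
  "hessian f x = (\<chi> i j. grad (\<lambda>y. grad f y $ i) x $ j)"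

definition laplacian :: "(real^'n \<Rightarrow> real) \<Rightarrow> real^'n \<Rightarrow> real" where
  "laplacian f x = trace (hessian f x)"

definition divergence :: "(real^'n \<Rightarrow> real^'n) \<Rightarrow> real^'n \<Rightarrow> real" where
  "divergence V x = (\<Sum>i\<in>UNIV. grad (\<lambda>y. V y $ i) x $ i)"

definition C1 :: "(real^'n \<Rightarrow> real) \<Rightarrow> bool" where
  "C1 f \<longleftrightarrow> (\<forall>x. f differentiable (at x)) \<and> continuous_on UNIV (grad f)"

definition C2 :: "(real^'n \<Rightarrow> real) \<Rightarrow> bool" where
  "C2 f \<longleftrightarrow> C1 f \<and> (\<forall>i. C1 (\<lambda>x. grad f x $ i))"

definition prob_density :: "(real^'n \<Rightarrow> real) \<Rightarrow> bool" where
  "prob_density \<mu> \<longleftrightarrow> periodic \<mu> \<and> (\<forall>x. 0 \<le> \<mu> x) \<and>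
     integrable torus \<mu> \<and> integral\<^sup>L torus \<mu> = 1"

(* The standing assumptions on H.  The constants are functions of K alone, uniform in x. *)

definition hamiltonian ::
  "(real^'n \<Rightarrow> real^'n \<Rightarrow> real) \<Rightarrow> (real \<Rightarrow> real) \<Rightarrow> (real \<Rightarrow> real) \<Rightarrow> (real \<Rightarrow> real) \<Rightarrow> bool" where
  "hamiltonian H L \<alpha> \<beta> \<longleftrightarrow>
     (\<forall>p. periodic (\<lambda>x. H x p)) \<and>
     (\<forall>p. (\<lambda>x. H x p) \<in> borel_measurable torus) \<and>
     (\<forall>x. C2 (H x)) \<and>
     (\<forall>K>0. 0 < L K \<and> 0 < \<alpha> K \<and> 0 < \<beta> K) \<and>
     (AE x in torus. \<forall>K>0. \<forall>p. norm p \<le> K \<longrightarrow>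
        norm (grad (H x) p) \<le> L K \<and>
        (\<forall>\<xi>. \<alpha> K * (\<xi> \<bullet> \<xi>) \<le> \<xi> \<bullet> (hessian (H x) p *v \<xi>) \<and>
             \<xi> \<bullet> (hessian (H x) p *v \<xi>) \<le> \<beta> K * (\<xi> \<bullet> \<xi>)))"

(* The standing assumptions on F and G.  Only values at m >= 0 are constrained. *)

definition coupling :: "(real^'n \<Rightarrow> real \<Rightarrow> real) \<Rightarrow> bool" where
  "coupling F \<longleftrightarrow>
     (\<forall>m\<ge>0. periodic (\<lambda>x. F x m)) \<and>
     (\<forall>m\<ge>0. (\<lambda>x. F x m) \<in> borel_measurable torus) \<and>
     (\<exists>c l. (\<forall>K>0. 0 < c K \<and> 0 < l K) \<and>
        (AE x in torus. \<forall>K>0. \<forall>m m'. 0 \<le> m \<and> m \<le> K \<and> 0 \<le> m' \<and> m' \<le> K \<longrightarrow>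
           \<bar>F x m\<bar> \<le> c K \<and> \<bar>F x m - F x m'\<bar> \<le> l K * \<bar>m - m'\<bar>))"

(* g is the weak gradient on the torus of the bounded function f.  As f and g are bounded,
   testing with C^1 functions is the same as testing with smooth ones. *)

definition weak_gradient :: "(real^'n \<Rightarrow> real) \<Rightarrow> (real^'n \<Rightarrow> real^'n) \<Rightarrow> bool" where
  "weak_gradient f g \<longleftrightarrow>
     (\<forall>\<phi> i. periodic \<phi> \<and> C1 \<phi> \<longrightarrow>
        (\<integral>x. f x * grad \<phi> x $ i \<partial>torus) = - (\<integral>x. g x $ i * \<phi> x \<partial>torus))"

definition W1inf_bounds ::
  "(real^'n \<Rightarrow> real) \<Rightarrow> real \<Rightarrow> real \<Rightarrow> bool" where
  "W1inf_bounds f a b \<longleftrightarrow>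
     periodic f \<and> f \<in> borel_measurable torus \<and> (AE x in torus. \<bar>f x\<bar> \<le> a) \<and>
     (\<exists>g. g \<in> borel_measurable torus \<and> weak_gradient f g \<and> (AE x in torus. norm (g x) \<le> b))"

(* The pairs (u, m) in L^oo((0,T); W^{1,oo}) x L^oo((0,T) x torus) with sup m <= M and
   sup |Du| <= U.  As usual in these spaces, suprema are essential suprema; for the
   solutions below, whose m and Du are continuous, they are suprema. *)

definition mfg_X ::
  "real \<Rightarrow> real \<Rightarrow> real \<Rightarrow> ((real \<Rightarrow> real^'n \<Rightarrow> real) \<times> (real \<Rightarrow> real^'n \<Rightarrow> real)) set" where
  "mfg_X T M U = {(u, m).
     (\<lambda>(t, x). u t x) \<in> borel_measurable (lebesgue_on ({0<..<T} \<times> cbox 0 1)) \<and>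
     (\<exists>C. AE t in lebesgue_on {0<..<T}. W1inf_bounds (u t) C U) \<and>
     (AE t in lebesgue_on {0<..<T}. periodic (m t)) \<and>
     (\<lambda>(t, x). m t x) \<in> borel_measurable (lebesgue_on ({0<..<T} \<times> cbox 0 1)) \<and>
     (\<exists>C. AE (t, x) in lebesgue_on ({0<..<T} \<times> cbox 0 1). \<bar>m t x\<bar> \<le> C) \<and>
     (AE (t, x) in lebesgue_on ({0<..<T} \<times> cbox 0 1). m t x \<le> M)}"

(* v is continuous on [0,T] x torus and C^{1,2} on (0,T) x torus. *)

definition classical_regularity :: "real \<Rightarrow> (real \<Rightarrow> real^'n \<Rightarrow> real) \<Rightarrow> bool" where
  "classical_regularity T v \<longleftrightarrow>
     (\<forall>t\<in>{0..T}. periodic (v t)) \<and>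
     continuous_on ({0..T} \<times> UNIV) (\<lambda>(t, x). v t x) \<and>
     (\<forall>t\<in>{0<..<T}. \<forall>x. (\<lambda>s. v s x) differentiable (at t)) \<and>
     (\<forall>t\<in>{0<..<T}. C2 (v t)) \<and>
     continuous_on ({0<..<T} \<times> UNIV) (\<lambda>(t, x). deriv (\<lambda>s. v s x) t) \<and>
     continuous_on ({0<..<T} \<times> UNIV) (\<lambda>(t, x). grad (v t) x) \<and>
     continuous_on ({0<..<T} \<times> UNIV) (\<lambda>(t, x). hessian (v t) x)"

(* H is only measurable in x, so differentiability of m H_p(x,Du) in x, needed for the
   divergence to make sense classically, is part of the notion of classical solution.
   The densities m(t,.) are nonnegative, so F and G are only evaluated at m >= 0. *)

definition mfg_classical_solution ::
  "real \<Rightarrow> real \<Rightarrow> (real^'n \<Rightarrow> real^'n \<Rightarrow> real) \<Rightarrow> (real^'n \<Rightarrow> real \<Rightarrow> real) \<Rightarrow>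
   (real^'n \<Rightarrow> real \<Rightarrow> real) \<Rightarrow> (real^'n \<Rightarrow> real) \<Rightarrow>
   (real \<Rightarrow> real^'n \<Rightarrow> real) \<Rightarrow> (real \<Rightarrow> real^'n \<Rightarrow> real) \<Rightarrow> bool" where
  "mfg_classical_solution \<kappa> T H F G m0 u m \<longleftrightarrow>
     classical_regularity T u \<and> classical_regularity T m \<and>
     (\<forall>t\<in>{0..T}. prob_density (m t)) \<and>
     (\<forall>t\<in>{0<..<T}. \<forall>i. C1 (\<lambda>x. (m t x *\<^sub>R grad (H x) (grad (u t) x)) $ i)) \<and>
     (\<forall>t\<in>{0<..<T}. \<forall>x.
        - deriv (\<lambda>s. u s x) t - \<kappa> * laplacian (u t) x + H x (grad (u t) x) = F x (m t x)) \<and>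
     (\<forall>t\<in>{0<..<T}. \<forall>x.
        deriv (\<lambda>s. m s x) t - \<kappa> * laplacian (m t) x
          - divergence (\<lambda>y. m t y *\<^sub>R grad (H y) (grad (u t) y)) x = 0) \<and>
     (\<forall>x. m 0 x = m0 x) \<and>
     (\<forall>x. u T x = G x (m T x))"

end

theory Submission
  imports Defs
begin

text \<open>
  Let (u1, m1) and (u2, m2) be two solutions and put w = u1 - u2, \<mu> = m1 - m2, s = m1 + m2.  By
  strong convexity of H on the ball of radius U, the Lasry-Lions computation gives
  d/dt \<integral>w\<mu> \<le> \<gamma> \<integral>\<mu>^2 - \<alpha>/2 \<integral>s|Dw|^2, where the first term on the right is the price of
  non-monotonicity (\<open>lasry_lions_derivative\<close>); moreover w\<mu> vanishes at time 0 and has integral at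
  least -\<gamma> \<integral>\<mu>(T)^2 at time T.  Hence it suffices to bound \<integral>\<mu>(T)^2 and the integral of \<mu>^2
  over space-time by the integral of s|Dw|^2, with a constant that does not depend on T.

  Such a bound is a statement about the two Fokker-Planck equations.  It is obtained from the
  triangular discrimination S = \<integral>\<mu>^2/s.  This divergence dominates \<integral>\<mu>^2, because the densities are
  bounded, and it is dissipated by diffusion: with r = \<mu>/s one finds
  S' \<le> -\<kappa> \<integral>s|Dr|^2 + \<beta>^2/(2\<kappa>) \<integral>s|Dw|^2 (\<open>discrimination_has_derivative\<close>).  The
  transport by a common drift leaves no trace, so no growth in time occurs.  Once s is bounded below,
  the Poincare inequality for r turns the dissipation into exponential decay
  (\<open>discrimination_le_dissipation\<close>).

  The lower bound (\<open>density_lower_bound\<close>) holds from time 2 on, with a constant that depends only on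
  \<kappa>, on the bounds M and L for the density and its drift, and on the dimension.  It comes from
  \<ell> = -log m, which satisfies
  \<ell>_t \<le> \<kappa>\<Delta>\<ell> - \<kappa>/2 |D\<ell>|^2 - div b + L^2/(2\<kappa>), b being the drift.  The gradient term and the
  Poincare inequality bound \<integral>\<ell> after a unit of time, whatever the initial value
  (\<open>log_integral_bound\<close>).  Testing with an approximate heat kernel, on whose gradient the
  divergence falls, turns this into a pointwise bound after another unit of time
  (\<open>log_pointwise_bound\<close>).

  Up to time 2 the decay of S is replaced by a decreasing weight: for a suitable \<theta>, the functional
  \<integral>w\<mu> + \<theta>(t) S decreases at a rate of at least \<gamma> \<integral>\<mu>^2, vanishes at 0 and is nonnegative at T.
  Thus \<mu> = 0 (\<open>densities_agree\<close>), and an energy estimate for w gives w = 0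
  (\<open>value_functions_agree\<close>).

  All integrals over the torus are integrals of continuous functions over the unit cell.  The
  structural conditions on H hold for almost every x only; they are always used in inequalities
  between continuous functions, which then hold everywhere.
\<close>

section \<open>Integration over the unit cell\<close>

abbreviation cell_integral :: "(real^'n \<Rightarrow> real) \<Rightarrow> real" where
  "cell_integral f \<equiv> integral (cbox 0 1) f"

lemma cell_integrable: "continuous_on UNIV f \<Longrightarrow> f integrable_on cbox (0::real^'n) 1"
  for f :: "real^'n \<Rightarrow> real"
  by (rule integrable_continuous) (rule continuous_on_subset, auto)

lemma cell_integral_add:
  fixes f g :: "real^'n \<Rightarrow> real"
  assumes "continuous_on UNIV f" "continuous_on UNIV g"
  shows "cell_integral (\<lambda>x. f x + g x) = cell_integral f + cell_integral g"
  by (rule integral_add) (use assms cell_integrable in auto)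

lemma cell_integral_diff:
  fixes f g :: "real^'n \<Rightarrow> real"
  assumes "continuous_on UNIV f" "continuous_on UNIV g"
  shows "cell_integral (\<lambda>x. f x - g x) = cell_integral f - cell_integral g"
  by (rule integral_diff) (use assms cell_integrable in auto)

lemma cell_integral_sum:
  fixes f :: "'i \<Rightarrow> real^'n \<Rightarrow> real"
  assumes "finite I" "\<And>i. i \<in> I \<Longrightarrow> continuous_on UNIV (f i)"
  shows "cell_integral (\<lambda>x. \<Sum>i\<in>I. f i x) = (\<Sum>i\<in>I. cell_integral (f i))"
  by (rule integral_sum) (use assms cell_integrable in auto)

lemma cell_integral_mono:
  fixes f g :: "real^'n \<Rightarrow> real"
  assumes "continuous_on UNIV f" "continuous_on UNIV g" "\<And>x. x \<in> cbox 0 1 \<Longrightarrow> f x \<le> g x"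
  shows "cell_integral f \<le> cell_integral g"
  by (rule integral_le) (use assms cell_integrable in auto)

lemma cell_measure [simp]: "measure lborel (cbox 0 (1::real^'n)) = 1"
  by (subst content_cbox_cart) (auto simp: interval_ne_empty_cart)

lemma cell_integral_const: "cell_integral (\<lambda>x::real^'n. c) = c"
  by simp

lemma cell_integral_affine:
  fixes f g :: "real^'n \<Rightarrow> real"
  assumes "continuous_on UNIV f" "continuous_on UNIV g"
  shows "cell_integral (\<lambda>x. a * f x + b * g x + c) = a * cell_integral f + b * cell_integral g + c"
proof -
  have "cell_integral (\<lambda>x. (a * f x + b * g x) + c) = cell_integral (\<lambda>x. a * f x + b * g x) + cell_integral (\<lambda>x::real^'n. c)"
    by (intro cell_integral_add continuous_intros assms)
  also have "cell_integral (\<lambda>x. a * f x + b * g x) = cell_integral (\<lambda>x. a * f x) + cell_integral (\<lambda>x. b * g x)"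
    by (intro cell_integral_add continuous_intros assms)
  finally show ?thesis by simp
qed

lemma cell_integral_nonneg:
  fixes f :: "real^'n \<Rightarrow> real"
  assumes "continuous_on UNIV f" "\<And>x. x \<in> cbox 0 1 \<Longrightarrow> 0 \<le> f x"
  shows "0 \<le> cell_integral f"
  by (rule integral_nonneg) (use assms cell_integrable in auto)

lemma cell_integral_eq_0_imp:
  fixes f :: "real^'n \<Rightarrow> real"
  assumes f: "continuous_on UNIV f" "\<And>x. x \<in> cbox 0 1 \<Longrightarrow> 0 \<le> f x" and 0: "cell_integral f \<le> 0"
    and x: "x \<in> cbox 0 1"
  shows "f x = 0"
proof -
  have ne: "box (0::real^'n) 1 \<noteq> {}"
    by (simp add: interval_ne_empty_cart)
  have "(f has_integral 0) (cbox 0 1)"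
    using cell_integral_nonneg[OF f] 0 integrable_integral[OF cell_integrable[OF f(1)]] by simp
  from has_integral_0_cbox_imp_0[OF continuous_on_subset[OF f(1) subset_UNIV] f(2)[OF subsetD[OF box_subset_cbox]] this ne x] show ?thesis .
qed

text \<open>
  Cut the translated cell along the face where the coordinate is 1 and move the protruding slab
  back by one period.
\<close>

lemma cell_integral_axis_translate:
  fixes f :: "real^'n \<Rightarrow> real"
  assumes per: "periodic f" and f: "continuous_on UNIV f" and h: "0 \<le> h" "h \<le> 1"
  shows "cell_integral (\<lambda>x. f (x + h *\<^sub>R axis i 1)) = cell_integral f"
proof -
  define e :: "real^'n" where "e = axis i 1"
  have eB: "e \<in> Basis" by (simp add: e_def axis_in_Basis_iff)
  have e_nth: "e $ j = (if j = i then 1 else 0)" for j by (simp add: e_def axis_def)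
  have inner_e: "x \<bullet> e = x $ i" for x by (simp add: e_def inner_axis)
  have mem: "x \<in> cbox a b \<longleftrightarrow> (a $ i \<le> x $ i \<and> x $ i \<le> b $ i) \<and> (\<forall>j. j \<noteq> i \<longrightarrow> a $ j \<le> x $ j \<and> x $ j \<le> b $ j)" for a b x :: "real^'n"
    unfolding mem_box_cart by metis
  have int: "f integrable_on cbox a b" for a b
    by (rule integrable_continuous) (rule continuous_on_subset[OF f], auto)
  have "cell_integral (\<lambda>x. f (x + h *\<^sub>R e)) = integral (cbox (h *\<^sub>R e) (1 + h *\<^sub>R e)) f"
    using integral_shift_cbox[of "h *\<^sub>R e" "h *\<^sub>R e" "1 + h *\<^sub>R e" f] by simp
  also have "\<dots> = integral (cbox (h *\<^sub>R e) (1 + h *\<^sub>R e) \<inter> {x. x \<bullet> e \<le> 1}) f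
                + integral (cbox (h *\<^sub>R e) (1 + h *\<^sub>R e) \<inter> {x. x \<bullet> e \<ge> 1}) f"
    by (rule integral_split[OF int eB])
  also have "cbox (h *\<^sub>R e) (1 + h *\<^sub>R e) \<inter> {x. x \<bullet> e \<le> 1} = cbox (h *\<^sub>R e) 1"
    using h by (auto simp: mem inner_e e_nth)
  also have "cbox (h *\<^sub>R e) (1 + h *\<^sub>R e) \<inter> {x. x \<bullet> e \<ge> 1} = cbox e (1 + h *\<^sub>R e)"
    using h by (auto simp: mem inner_e e_nth)
  also have "integral (cbox e (1 + h *\<^sub>R e)) f = integral (cbox (e - e) (1 + h *\<^sub>R e - e)) (\<lambda>x. f (x + e))"
    by (rule integral_shift_cbox[symmetric])
  also have "(\<lambda>x. f (x + e)) = f"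
    using per by (auto simp: periodic_def e_def)
  also have "integral (cbox (h *\<^sub>R e) 1) f + integral (cbox (e - e) (1 + h *\<^sub>R e - e)) f = cell_integral f"
  proof -
    have "cell_integral f = integral (cbox 0 1 \<inter> {x. x \<bullet> e \<le> h}) f + integral (cbox 0 1 \<inter> {x. x \<bullet> e \<ge> h}) f"
      by (rule integral_split[OF int eB])
    also have "cbox 0 1 \<inter> {x. x \<bullet> e \<le> h} = cbox (e - e) (1 + h *\<^sub>R e - e)"
      using h by (auto simp: mem inner_e e_nth)
    also have "cbox 0 1 \<inter> {x. x \<bullet> e \<ge> h} = cbox (h *\<^sub>R e) 1"
      using h by (auto simp: mem inner_e e_nth)
    finally show ?thesis by simp
  qed
  finally show ?thesis by (simp add: e_def)
qed

lemma axis_expansion: "(\<Sum>i\<in>UNIV. (x $ i) *\<^sub>R axis i 1) = (x :: real^'n)"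
  by (simp add: vec_eq_iff axis_def if_distrib[where f="(*) _"] cong: if_cong)

lemma periodic_translate:
  fixes f :: "real^'n \<Rightarrow> 'b"
  assumes "periodic f"
  shows "periodic (\<lambda>x. f (x + z))"
  unfolding periodic_def
proof (intro allI)
  fix x :: "real^'n" and i :: 'n
  have eq: "x + axis i 1 + z = (x + z) + axis i 1" by (rule add.assoc[THEN trans]) (simp only: add.commute add.left_commute)
  have "f ((x + z) + axis i 1) = f (x + z)" using assms unfolding periodic_def by blast
  then show "f (x + axis i 1 + z) = f (x + z)" by (simp only: eq)
qed

lemma cell_integral_translate:
  fixes f :: "real^'n \<Rightarrow> real"
  assumes "periodic f" "continuous_on UNIV f" "z \<in> cbox 0 1"
  shows "cell_integral (\<lambda>x. f (x + z)) = cell_integral f"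
proof -
  have "cell_integral (\<lambda>x. f (x + (\<Sum>i\<in>S. (z $ i) *\<^sub>R axis i 1))) = cell_integral f" if "finite S" for S
    using that
  proof induction
    case (insert j S)
    define g where "g = (\<lambda>x. f (x + (\<Sum>i\<in>S. (z $ i) *\<^sub>R axis i 1)))"
    have g: "periodic g" "continuous_on UNIV g"
      unfolding g_def by (auto intro!: periodic_translate assms continuous_on_compose2[OF assms(2)] continuous_intros)
    have "cell_integral (\<lambda>x. g (x + (z $ j) *\<^sub>R axis j 1)) = cell_integral g"
      using assms(3) by (intro cell_integral_axis_translate g) (auto simp: mem_box_cart)
    then show ?case using insert by (simp add: g_def add_ac)
  qed simp
  from this[OF finite[of UNIV]] show ?thesis by (simp only: axis_expansion)
qed

section \<open>Gradients and integration by parts on the torus\<close>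

lemma grad_eqI: "GDERIV f x :> D \<Longrightarrow> grad f x = D"
proof -
  assume "GDERIV f x :> D"
  then have "frechet_derivative f (at x) = (\<lambda>h. h \<bullet> D)"
    unfolding gderiv_def by (rule frechet_derivative_at[symmetric])
  then show ?thesis by (simp add: grad_def vec_eq_iff inner_axis')
qed

lemma GDERIV_grad:
  assumes "f differentiable (at x)"
  shows "GDERIV f x :> grad f x"
proof -
  have d: "(f has_derivative frechet_derivative f (at x)) (at x)"
    using assms frechet_derivative_works by blast
  then have lin: "linear (frechet_derivative f (at x))" by (rule has_derivative_linear)
  have "frechet_derivative f (at x) h = h \<bullet> grad f x" for h
  proof -
    have "frechet_derivative f (at x) h = frechet_derivative f (at x) (\<Sum>i\<in>UNIV. (h $ i) *\<^sub>R axis i 1)"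
      by (simp only: axis_expansion)
    also have "\<dots> = h \<bullet> grad f x"
      by (simp add: linear_sum[OF lin] linear_cmul[OF lin] grad_def inner_vec_def)
    finally show ?thesis .
  qed
  then have "frechet_derivative f (at x) = (\<lambda>h. h \<bullet> grad f x)" by (rule ext)
  then show ?thesis using d unfolding gderiv_def by simp
qed

lemma C1_GDERIV: "C1 f \<Longrightarrow> GDERIV f x :> grad f x"
  by (simp add: C1_def GDERIV_grad)

lemma C1_continuous_grad: "C1 f \<Longrightarrow> continuous_on UNIV (grad f)"
  by (simp add: C1_def)

lemma C1_continuous: "C1 f \<Longrightarrow> continuous_on UNIV f"
  unfolding C1_def by (meson continuous_at_imp_continuous_on differentiable_imp_continuous_within)

lemma C1I:
  assumes "\<And>x. GDERIV f x :> g x" "continuous_on UNIV g"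
  shows "C1 f"
proof -
  have "grad f = g" using assms(1) grad_eqI by blast
  then show ?thesis using assms unfolding C1_def gderiv_def differentiable_def by blast
qed

lemma C1_mult:
  assumes "C1 f" "C1 g"
  shows "C1 (\<lambda>x. f x * g x)"
  by (rule C1I[where g="\<lambda>x. f x *\<^sub>R grad g x + g x *\<^sub>R grad f x"])
    (auto intro!: GDERIV_mult C1_GDERIV assms continuous_intros C1_continuous C1_continuous_grad)

lemma grad_mult: "C1 f \<Longrightarrow> C1 g \<Longrightarrow> grad (\<lambda>x. f x * g x) x = f x *\<^sub>R grad g x + g x *\<^sub>R grad f x"
  by (intro grad_eqI GDERIV_mult C1_GDERIV)

lemma C1_add: assumes "C1 f" "C1 g" shows "C1 (\<lambda>x. f x + g x)"
  by (rule C1I[where g="\<lambda>x. grad f x + grad g x"])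
    (auto intro!: GDERIV_add C1_GDERIV assms continuous_intros C1_continuous_grad)

lemma grad_add: "C1 f \<Longrightarrow> C1 g \<Longrightarrow> grad (\<lambda>x. f x + g x) x = grad f x + grad g x"
  by (intro grad_eqI GDERIV_add C1_GDERIV)

lemma C1_diff: assumes "C1 f" "C1 g" shows "C1 (\<lambda>x. f x - g x)"
  by (rule C1I[where g="\<lambda>x. grad f x - grad g x"])
    (auto intro!: GDERIV_diff C1_GDERIV assms continuous_intros C1_continuous_grad)

lemma grad_diff: "C1 f \<Longrightarrow> C1 g \<Longrightarrow> grad (\<lambda>x. f x - g x) x = grad f x - grad g x"
  by (intro grad_eqI GDERIV_diff C1_GDERIV)

lemma C1_const: "C1 (\<lambda>x. c)"
  by (rule C1I[where g="\<lambda>x. 0"]) (auto intro!: GDERIV_const)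

lemma grad_const: "grad (\<lambda>x. c) x = 0"
  by (intro grad_eqI GDERIV_const)

lemma C1_cmult: "C1 f \<Longrightarrow> C1 (\<lambda>x. c * f x)"
  using C1_mult[OF C1_const] by blast

lemma grad_cmult: "C1 f \<Longrightarrow> grad (\<lambda>x. c * f x) x = c *\<^sub>R grad f x"
  using grad_mult[OF C1_const, of f c x] by (simp add: grad_const)

lemma C1_compose:
  fixes \<phi> \<phi>' :: "real \<Rightarrow> real"
  assumes f: "C1 f" and \<phi>: "\<And>x. (\<phi> has_real_derivative \<phi>' (f x)) (at (f x))"
    and c: "continuous_on (range f) \<phi>'"
  shows "C1 (\<lambda>x. \<phi> (f x))" and "grad (\<lambda>x. \<phi> (f x)) x = \<phi>' (f x) *\<^sub>R grad f x"
proof -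
  have d: "GDERIV (\<lambda>x. \<phi> (f x)) x :> \<phi>' (f x) *\<^sub>R grad f x" for x
    by (rule GDERIV_DERIV_compose[OF C1_GDERIV[OF f] \<phi>])
  show "C1 (\<lambda>x. \<phi> (f x))"
  proof (rule C1I[OF d])
    have "continuous_on UNIV (\<lambda>x. \<phi>' (f x))"
      by (rule continuous_on_compose2[OF c C1_continuous[OF f]]) auto
    then show "continuous_on UNIV (\<lambda>x. \<phi>' (f x) *\<^sub>R grad f x)"
      by (intro continuous_intros C1_continuous_grad f)
  qed
  show "grad (\<lambda>x. \<phi> (f x)) x = \<phi>' (f x) *\<^sub>R grad f x"
    by (rule grad_eqI[OF d])
qed

lemma C1_inverse:
  assumes f: "C1 f" and pos: "\<And>x. 0 < f x"
  shows "C1 (\<lambda>x. 1 / f x)" "grad (\<lambda>x. 1 / f x) x = - (1 / f x)\<^sup>2 *\<^sub>R grad f x"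
proof -
  have d: "((\<lambda>r. 1 / r) has_real_derivative - (1 / f y)\<^sup>2) (at (f y))" for y
    using pos[of y] by (auto intro!: derivative_eq_intros simp: divide_simps power2_eq_square)
  have c: "continuous_on (range f) (\<lambda>r. - (1 / r)\<^sup>2)"
    by (intro continuous_intros) (use pos in \<open>auto simp: less_imp_neq[THEN not_sym]\<close>)
  show "C1 (\<lambda>x. 1 / f x)" "grad (\<lambda>x. 1 / f x) x = - (1 / f x)\<^sup>2 *\<^sub>R grad f x"
    by (rule C1_compose[OF f d c])+
qed

lemma DERIV_along_line:
  assumes "f differentiable (at (x + h *\<^sub>R v))"
  shows "((\<lambda>h. f (x + h *\<^sub>R v)) has_real_derivative (v \<bullet> grad f (x + h *\<^sub>R v))) (at h within S)"
proof -
  have 1: "((\<lambda>h. x + h *\<^sub>R v) has_derivative (\<lambda>k. k *\<^sub>R v)) (at h within S)"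
    by (auto intro!: derivative_eq_intros)
  have 2: "(f has_derivative (\<lambda>k. k \<bullet> grad f (x + h *\<^sub>R v))) (at (x + h *\<^sub>R v))"
    using GDERIV_grad[OF assms] by (simp add: gderiv_def)
  show ?thesis using has_derivative_compose[OF 1 2]
    by (simp add: has_field_derivative_def mult_commute_abs)
qed

lemma periodic_grad:
  fixes f :: "real^'n \<Rightarrow> real"
  assumes "periodic f" "\<And>x. f differentiable (at x)"
  shows "periodic (grad f)"
  unfolding periodic_def
proof (intro allI)
  fix x :: "real^'n" and i :: 'n
  have "((\<lambda>y. f (y + axis i 1)) has_derivative (\<lambda>h. h \<bullet> grad f (x + axis i 1))) (at x)"
    by (rule has_derivative_compose[OF _ GDERIV_grad[OF assms(2), unfolded gderiv_def]])
      (auto intro!: derivative_eq_intros)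
  moreover have "(\<lambda>y. f (y + axis i 1)) = f"
    using assms(1) by (auto simp: periodic_def)
  ultimately show "grad f (x + axis i 1) = grad f x"
    using grad_eqI[of f x] by (simp add: gderiv_def)
qed

text \<open>
  The integral of f over the translates of the cell is constant, so its derivative vanishes.
\<close>

lemma cell_integral_grad_nth:
  fixes f :: "real^'n \<Rightarrow> real"
  assumes per: "periodic f" and f: "C1 f"
  shows "cell_integral (\<lambda>x. grad f x $ i) = 0"
proof -
  let ?F = "\<lambda>h::real. cell_integral (\<lambda>x. f (x + h *\<^sub>R axis i 1))"
  have "(?F has_real_derivative cell_integral (\<lambda>x. grad f (x + 0 *\<^sub>R axis i 1) $ i)) (at 0 within {0..1})"
  proof (rule leibniz_rule_field_derivative)
    show "((\<lambda>h. f (x + h *\<^sub>R axis i 1)) has_real_derivative grad f (x + h *\<^sub>R axis i 1) $ i) (at h within {0..1})" for x h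
      using DERIV_along_line[of f x h "axis i 1"] f by (simp add: C1_def inner_axis')
    show "(\<lambda>x. f (x + h *\<^sub>R axis i 1)) integrable_on cbox 0 1" for h
      by (intro cell_integrable continuous_on_compose2[OF C1_continuous[OF f]] continuous_intros) auto
    show "continuous_on ({0..1} \<times> cbox 0 1) (\<lambda>(h, x). grad f (x + h *\<^sub>R axis i 1) $ i)"
      unfolding split_beta
      by (intro continuous_on_compose2[OF C1_continuous_grad[OF f]] continuous_intros) auto
  qed auto
  moreover have "(?F has_real_derivative 0) (at 0 within {0..1})"
    by (rule has_field_derivative_transform_within[where f="\<lambda>_. cell_integral f" and d=1])
      (auto simp: cell_integral_axis_translate[OF per C1_continuous[OF f]])
  ultimately have "cell_integral (\<lambda>x. grad f (x + 0 *\<^sub>R axis i 1) $ i) = 0"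
    by (rule has_field_derivative_unique) (simp add: trivial_limit_within islimpt_Icc)
  then show ?thesis by simp
qed

lemma periodic_mult: "periodic f \<Longrightarrow> periodic g \<Longrightarrow> periodic (\<lambda>x. f x * (g x :: real))"
  by (simp add: periodic_def)

lemma cell_integral_by_parts:
  fixes f :: "real^'n \<Rightarrow> real" and \<Phi> :: "real^'n \<Rightarrow> real^'n"
  assumes f: "periodic f" "C1 f" and \<Phi>: "periodic \<Phi>" "\<And>i. C1 (\<lambda>x. \<Phi> x $ i)"
  shows "cell_integral (\<lambda>x. f x * divergence \<Phi> x) = - cell_integral (\<lambda>x. grad f x \<bullet> \<Phi> x)"
proof -
  have c: "continuous_on UNIV (\<lambda>x. f x * grad (\<lambda>y. \<Phi> y $ i) x $ i)" "continuous_on UNIV (\<lambda>x. grad f x $ i * \<Phi> x $ i)" for i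
    by (auto intro!: continuous_intros C1_continuous[OF f(2)] C1_continuous[OF \<Phi>(2)] C1_continuous_grad[OF f(2)] C1_continuous_grad[OF \<Phi>(2)])
  have "cell_integral (\<lambda>x. f x * grad (\<lambda>y. \<Phi> y $ i) x $ i) = - cell_integral (\<lambda>x. grad f x $ i * \<Phi> x $ i)" for i
  proof -
    have "periodic (\<lambda>x. f x * \<Phi> x $ i)"
      using f \<Phi> by (auto simp: periodic_def)
    then have "cell_integral (\<lambda>x. grad (\<lambda>x. f x * \<Phi> x $ i) x $ i) = 0"
      by (rule cell_integral_grad_nth) (intro C1_mult f \<Phi>)
    also have "(\<lambda>x. grad (\<lambda>x. f x * \<Phi> x $ i) x $ i) = (\<lambda>x. f x * grad (\<lambda>y. \<Phi> y $ i) x $ i + grad f x $ i * \<Phi> x $ i)"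
      by (simp add: grad_mult[OF f(2) \<Phi>(2)] mult.commute)
    finally show ?thesis by (simp add: cell_integral_add c)
  qed
  then have "(\<Sum>i\<in>UNIV. cell_integral (\<lambda>x. f x * grad (\<lambda>y. \<Phi> y $ i) x $ i)) = (\<Sum>i\<in>UNIV. - cell_integral (\<lambda>x. grad f x $ i * \<Phi> x $ i))"
    by simp
  then show ?thesis
    by (simp add: divergence_def inner_vec_def sum_distrib_left cell_integral_sum c sum_negf)
qed

lemma laplacian_eq_divergence: "laplacian f x = divergence (grad f) x"
  by (simp add: laplacian_def trace_def hessian_def divergence_def)

lemma C1_components_continuous:
  fixes \<Phi> :: "real^'n \<Rightarrow> real^'n"
  assumes "\<And>i. C1 (\<lambda>x. \<Phi> x $ i)"
  shows "continuous_on UNIV \<Phi>" "continuous_on UNIV (divergence \<Phi>)"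
proof -
  show "continuous_on UNIV \<Phi>"
    using continuous_on_vec_lambda[of UNIV "\<lambda>i x. \<Phi> x $ i"] C1_continuous[OF assms] by simp
  show "continuous_on UNIV (divergence \<Phi>)"
    unfolding divergence_def[abs_def] by (intro continuous_intros C1_continuous_grad assms)
qed

lemma C2_C1_grad_nth: "C2 f \<Longrightarrow> C1 (\<lambda>y. grad f y $ i)"
  by (simp add: C2_def)

lemma laplacian_continuous: "C2 f \<Longrightarrow> continuous_on UNIV (laplacian f)"
  unfolding laplacian_eq_divergence[abs_def] by (intro C1_components_continuous C2_C1_grad_nth)

lemma divergence_add_scaleR:
  assumes "\<And>i. C1 (\<lambda>y. \<Phi> y $ i)" "\<And>i. C1 (\<lambda>y. \<Psi> y $ i)"
  shows "divergence (\<lambda>y. c *\<^sub>R \<Phi> y + \<Psi> y) x = c * divergence \<Phi> x + divergence \<Psi> x"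
proof -
  have "grad (\<lambda>y. (c *\<^sub>R \<Phi> y + \<Psi> y) $ i) x = c *\<^sub>R grad (\<lambda>y. \<Phi> y $ i) x + grad (\<lambda>y. \<Psi> y $ i) x" for i
    by (simp add: grad_add[OF C1_cmult[OF assms(1)] assms(2)] grad_cmult[OF assms(1)])
  then show ?thesis by (simp add: divergence_def sum.distrib sum_distrib_left)
qed

section \<open>Periodic functions and the Poincare inequality\<close>

lemma periodic_add_of_nat:
  fixes f :: "real^'n \<Rightarrow> 'b"
  assumes "periodic f"
  shows "f (x + real k *\<^sub>R axis i 1) = f x"
proof (induction k)
  case (Suc k)
  have "f ((x + real k *\<^sub>R axis i 1) + axis i 1) = f (x + real k *\<^sub>R axis i 1)"
    using assms unfolding periodic_def by blast
  then show ?case using Suc by (simp add: algebra_simps)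
qed simp

lemma periodic_add_of_int:
  fixes f :: "real^'n \<Rightarrow> 'b"
  assumes "periodic f"
  shows "f (x + real_of_int k *\<^sub>R axis i 1) = f x"
proof (cases "k \<ge> 0")
  case True
  then show ?thesis using periodic_add_of_nat[OF assms, of x "nat k" i] by simp
next
  case False
  then show ?thesis using periodic_add_of_nat[OF assms, of "x + real_of_int k *\<^sub>R axis i 1" "nat (- k)" i] by simp
qed

text \<open>
  One representative serves all periodic functions at once; this is what makes comparisons of
  several periodic functions reduce to the cell.
\<close>

lemma periodic_cell_representative:
  fixes x :: "real^'n"
  obtains y where "y \<in> cbox 0 1" "\<And>f :: real^'n \<Rightarrow> 'b. periodic f \<Longrightarrow> f y = f x"
proof -
  define y where "y = x + (\<Sum>i\<in>UNIV. real_of_int (- \<lfloor>x $ i\<rfloor>) *\<^sub>R axis i 1)"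
  have "f (x + (\<Sum>i\<in>S. real_of_int (- \<lfloor>x $ i\<rfloor>) *\<^sub>R axis i 1)) = f x" if "periodic f" "finite S" for f :: "real^'n \<Rightarrow> 'b" and S
    using that(2)
  proof induction
    case (insert j S)
    then show ?case
      using periodic_add_of_int[OF that(1), of "x + (\<Sum>i\<in>S. real_of_int (- \<lfloor>x $ i\<rfloor>) *\<^sub>R axis i 1)" "- \<lfloor>x $ j\<rfloor>" j]
      by (simp add: algebra_simps)
  qed simp
  then have "f y = f x" if "periodic f" for f :: "real^'n \<Rightarrow> 'b"
    unfolding y_def using that finite by blast
  moreover have "y $ j = x $ j - \<lfloor>x $ j\<rfloor>" for j
    by (simp add: y_def axis_def if_distrib[where f="(*) _"] sum_negf cong: if_cong)
  then have "y \<in> cbox 0 1" unfolding mem_box_cart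
    by (smt (verit) floor_correct one_index zero_index of_int_add of_int_1)
  ultimately show ?thesis using that by blast
qed

text \<open>
  The set where a continuous inequality fails is open, and a nonempty open set is not negligible.
\<close>

lemma AE_lebesgue_on_imp_interior_le:
  fixes f g :: "'a::euclidean_space \<Rightarrow> real"
  assumes S: "S \<in> sets lebesgue" and ae: "AE x in lebesgue_on S. f x \<le> g x"
    and c: "continuous_on (interior S) f" "continuous_on (interior S) g" and x: "x \<in> interior S"
  shows "f x \<le> g x"
proof -
  define A where "A = {x \<in> interior S. g x < f x}"
  have "open A"
    using continuous_open_preimage[of "interior S" "\<lambda>x. f x - g x" "{0<..}"] c
    by (auto simp: A_def vimage_def Collect_conj_eq intro: continuous_intros)
  have "AE x in lebesgue. x \<in> S \<longrightarrow> f x \<le> g x"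
    using ae S by (subst (asm) AE_restrict_space_iff) auto
  then obtain N where "N \<in> null_sets lebesgue" "{x. \<not> (x \<in> S \<longrightarrow> f x \<le> g x)} \<subseteq> N"
    by (auto simp: eventually_ae_filter)
  moreover have "A \<subseteq> {x. \<not> (x \<in> S \<longrightarrow> f x \<le> g x)}"
    using interior_subset by (force simp: A_def)
  ultimately have "negligible A"
    by (metis negligible_iff_null_sets negligible_subset)
  then have "A = {}" using \<open>open A\<close> open_not_negligible by blast
  then show ?thesis using x by (force simp: A_def)
qed

lemma closure_cell: "closure (box 0 1) = cbox (0::real^'n) 1"
  by (rule closure_box) (simp add: interval_ne_empty_cart)

lemma cell_le_everywhere:
  fixes f g :: "real^'n \<Rightarrow> real"
  assumes le: "\<And>x. x \<in> box 0 1 \<Longrightarrow> f x \<le> g x"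
    and c: "continuous_on UNIV f" "continuous_on UNIV g" and per: "periodic f" "periodic g"
  shows "f x \<le> g x"
proof -
  obtain y where y: "y \<in> cbox 0 1" "\<And>h :: real^'n \<Rightarrow> real. periodic h \<Longrightarrow> h y = h x"
    using periodic_cell_representative[of x] by blast
  have "closure (box 0 1) \<subseteq> {y. f y \<le> g y}"
    by (rule closure_minimal) (use le in \<open>auto intro: closed_Collect_le[OF c]\<close>)
  then have "f y \<le> g y" using y(1) unfolding closure_cell by blast
  then show ?thesis using y(2) per by metis
qed

lemma AE_torus_imp_le_cell:
  fixes f g :: "real^'n \<Rightarrow> real"
  assumes ae: "AE x in torus. f x \<le> g x" and c: "continuous_on UNIV f" "continuous_on UNIV g"
    and x: "x \<in> cbox 0 1"
  shows "f x \<le> g x"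
proof -
  have "f y \<le> g y" if "y \<in> box 0 1" for y
    by (rule AE_lebesgue_on_imp_interior_le[OF _ ae]) (use that c in \<open>auto intro: continuous_on_subset\<close>)
  then have "closure (box 0 1) \<subseteq> {y. f y \<le> g y}"
    by (intro closure_minimal closed_Collect_le c) auto
  then show ?thesis using x unfolding closure_cell by blast
qed

lemma AE_torus_imp_le:
  fixes f g :: "real^'n \<Rightarrow> real"
  assumes ae: "AE x in torus. f x \<le> g x" and c: "continuous_on UNIV f" "continuous_on UNIV g"
    and per: "periodic f" "periodic g"
  shows "f x \<le> g x"
proof -
  obtain y where "y \<in> cbox 0 1" "\<And>h :: real^'n \<Rightarrow> real. periodic h \<Longrightarrow> h y = h x"
    using periodic_cell_representative[of x] by blast
  then show ?thesis using AE_torus_imp_le_cell[OF ae c, of y] per by metis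
qed

lemma cell_integral_square_eq_0:
  fixes f g :: "real^'n \<Rightarrow> real"
  assumes c: "continuous_on UNIV f" "continuous_on UNIV g" and per: "periodic f" "periodic g"
    and 0: "cell_integral (\<lambda>x. (f x - g x)\<^sup>2) \<le> 0"
  shows "f x = g x"
proof -
  have "(f y - g y)\<^sup>2 = 0" if "y \<in> cbox 0 1" for y
    by (rule cell_integral_eq_0_imp[OF _ _ 0 that]) (intro continuous_intros c | simp)+
  moreover obtain y where "y \<in> cbox 0 1" "\<And>h :: real^'n \<Rightarrow> real. periodic h \<Longrightarrow> h y = h x"
    using periodic_cell_representative[of x] by blast
  ultimately show ?thesis using per by (metis eq_iff_diff_eq_0 power_eq_0_iff)
qed

lemma jensen_square:
  fixes f :: "'a::euclidean_space \<Rightarrow> real"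
  assumes f: "continuous_on (cbox a b) f" and 1: "measure lborel (cbox a b) = 1"
  shows "(integral (cbox a b) f)\<^sup>2 \<le> integral (cbox a b) (\<lambda>x. (f x)\<^sup>2)"
proof -
  define I where "I = integral (cbox a b) f"
  have int: "f integrable_on cbox a b" "(\<lambda>x. (f x)\<^sup>2) integrable_on cbox a b"
    by (intro integrable_continuous continuous_intros f)+
  have "0 \<le> integral (cbox a b) (\<lambda>x. (f x - I)\<^sup>2)"
    by (intro integral_nonneg integrable_continuous continuous_intros f) auto
  also have "(\<lambda>x. (f x - I)\<^sup>2) = (\<lambda>x. (f x)\<^sup>2 - (2 * I) * f x + I\<^sup>2)"
    by (auto simp: power2_eq_square algebra_simps)
  also have "integral (cbox a b) \<dots> = integral (cbox a b) (\<lambda>x. (f x)\<^sup>2) - (2 * I) * I + I\<^sup>2"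
    using int 1 by (subst integral_add integral_diff integral_mult_right;
        (intro integrable_diff integrable_on_mult_right integrable_const)?; simp add: I_def)+
  finally show ?thesis by (simp add: I_def power2_eq_square)
qed

lemma cell_norm_le: "x \<in> cbox 0 (1::real^'n) \<Longrightarrow> (norm x)\<^sup>2 \<le> real CARD('n)"
proof -
  assume x: "x \<in> cbox 0 1"
  have "(norm x)\<^sup>2 = (\<Sum>i\<in>UNIV. (x $ i)\<^sup>2)"
    unfolding power2_norm_eq_inner inner_vec_def by (simp add: power2_eq_square)
  also have "\<dots> \<le> (\<Sum>i\<in>(UNIV::'n set). 1)"
    using x by (intro sum_mono) (auto simp: mem_box_cart abs_square_le_1 abs_le_iff intro: order.trans[of _ 0])
  finally show ?thesis by simp
qed

text \<open>
  Integrate the gradient along the segment from y to y + z.  By periodicity the mean square of the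
  gradient is the same on every translate of the cell, so no change of variables is needed.
\<close>

lemma translation_difference_bound:
  fixes f :: "real^'n \<Rightarrow> real"
  assumes per: "periodic f" and f: "C1 f" and z: "z \<in> cbox 0 1"
  shows "cell_integral (\<lambda>y. (f (y + z) - f y)\<^sup>2) \<le> real CARD('n) * cell_integral (\<lambda>y. (norm (grad f y))\<^sup>2)"
proof -
  have cf: "continuous_on S (\<lambda>x. f (h x))" if "continuous_on S h" for S :: "'z::topological_space set" and h
    by (rule continuous_on_compose2[OF C1_continuous[OF f] that]) auto
  have cg: "continuous_on S (\<lambda>x. grad f (h x))" if "continuous_on S h" for S :: "'z::topological_space set" and h
    by (rule continuous_on_compose2[OF C1_continuous_grad[OF f] that]) auto
  let ?G = "\<lambda>y t. (norm (grad f (y + t *\<^sub>R z)))\<^sup>2"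
  have pt: "(f (y + z) - f y)\<^sup>2 \<le> real CARD('n) * integral (cbox 0 1) (?G y)" for y
  proof -
    have "((\<lambda>t. z \<bullet> grad f (y + t *\<^sub>R z)) has_integral (f (y + 1 *\<^sub>R z) - f (y + 0 *\<^sub>R z))) {0..1}"
      by (rule fundamental_theorem_of_calculus)
        (use f in \<open>auto simp: has_real_derivative_iff_has_vector_derivative[symmetric] C1_def intro!: DERIV_along_line\<close>)
    then have "(f (y + z) - f y)\<^sup>2 = (integral (cbox 0 1) (\<lambda>t::real. z \<bullet> grad f (y + t *\<^sub>R z)))\<^sup>2"
      by (simp add: integral_unique)
    also have "\<dots> \<le> integral (cbox 0 1) (\<lambda>t. (z \<bullet> grad f (y + t *\<^sub>R z))\<^sup>2)"
      by (intro jensen_square continuous_intros cg) auto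
    also have "\<dots> \<le> integral (cbox 0 1) (\<lambda>t. real CARD('n) * ?G y t)"
    proof (intro integral_le integrable_continuous continuous_intros cg)
      fix t
      have "(z \<bullet> grad f (y + t *\<^sub>R z))\<^sup>2 \<le> (norm z)\<^sup>2 * (norm (grad f (y + t *\<^sub>R z)))\<^sup>2"
        by (metis Cauchy_Schwarz_ineq power2_norm_eq_inner)
      also have "\<dots> \<le> real CARD('n) * ?G y t"
        by (intro mult_right_mono cell_norm_le z) auto
      finally show "(z \<bullet> grad f (y + t *\<^sub>R z))\<^sup>2 \<le> real CARD('n) * ?G y t" .
    qed
    finally show ?thesis by simp
  qed
  have cG: "continuous_on UNIV (\<lambda>y. integral (cbox 0 1) (?G y))"
    by (rule integral_continuous_on_param) (auto simp: split_beta intro!: continuous_intros cg)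
  have pG: "periodic (\<lambda>y. (norm (grad f y))\<^sup>2)"
    using periodic_grad[OF per] f by (simp add: periodic_def C1_def)
  have "cell_integral (\<lambda>y. (f (y + z) - f y)\<^sup>2) \<le> cell_integral (\<lambda>y. real CARD('n) * integral (cbox 0 1) (?G y))"
    by (intro cell_integral_mono pt continuous_intros cf cG)
  also have "\<dots> = real CARD('n) * integral (cbox 0 1) (\<lambda>t. cell_integral (\<lambda>y. ?G y t))"
    by (subst integral_swap_continuous[symmetric]) (auto simp: split_beta intro!: continuous_intros cg)
  also have "integral (cbox 0 1) (\<lambda>t. cell_integral (\<lambda>y. ?G y t))
     = integral (cbox (0::real) 1) (\<lambda>t. cell_integral (\<lambda>y. (norm (grad f y))\<^sup>2))"
  proof (rule integral_cong)
    fix t :: real assume "t \<in> cbox 0 1"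
    then have "t *\<^sub>R z \<in> cbox 0 1"
      using z by (auto simp: mem_box_cart mult_le_one)
    then show "cell_integral (\<lambda>y. ?G y t) = cell_integral (\<lambda>y. (norm (grad f y))\<^sup>2)"
      by (intro cell_integral_translate[OF pG] continuous_intros cg)
  qed
  finally show ?thesis by simp
qed

text \<open>
  The mean of f is the mean of its translates, so the deviation from the mean is an average of the
  differences \<open>f (y + z) - f y\<close>.
\<close>

lemma poincare_torus:
  fixes f :: "real^'n \<Rightarrow> real"
  assumes per: "periodic f" and f: "C1 f"
  shows "cell_integral (\<lambda>y. (f y - cell_integral f)\<^sup>2) \<le> real CARD('n) * cell_integral (\<lambda>y. (norm (grad f y))\<^sup>2)"
proof -
  have cf: "continuous_on S (\<lambda>x. f (h x))" if "continuous_on S h" for S :: "'z::topological_space set" and h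
    by (rule continuous_on_compose2[OF C1_continuous[OF f] that]) auto
  let ?D = "real CARD('n) * cell_integral (\<lambda>y. (norm (grad f y))\<^sup>2)"
  have c2: "continuous_on UNIV (\<lambda>y. cell_integral (\<lambda>z. (f (y + z) - f y)\<^sup>2))"
    by (rule integral_continuous_on_param) (auto simp: split_beta intro!: continuous_intros cf)
  have c3: "continuous_on UNIV (\<lambda>z. cell_integral (\<lambda>y. (f (y + z) - f y)\<^sup>2))"
    by (rule integral_continuous_on_param) (auto simp: split_beta intro!: continuous_intros cf)
  have "cell_integral (\<lambda>y. (f y - cell_integral f)\<^sup>2) \<le> cell_integral (\<lambda>y. cell_integral (\<lambda>z. (f (y + z) - f y)\<^sup>2))"
  proof (intro cell_integral_mono continuous_intros cf c2)
    fix y :: "real^'n" assume y: "y \<in> cbox 0 1"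
    have "cell_integral f = cell_integral (\<lambda>z. f (y + z))"
      using cell_integral_translate[OF per C1_continuous[OF f] y] by (simp add: add.commute)
    then have "f y - cell_integral f = - cell_integral (\<lambda>z. f (y + z) - f y)"
      by (subst cell_integral_diff) (auto intro!: continuous_intros cf simp: cell_measure)
    moreover have "(cell_integral (\<lambda>z. f (y + z) - f y))\<^sup>2 \<le> cell_integral (\<lambda>z. (f (y + z) - f y)\<^sup>2)"
      by (intro jensen_square cell_measure continuous_intros cf)
    ultimately show "(f y - cell_integral f)\<^sup>2 \<le> cell_integral (\<lambda>z. (f (y + z) - f y)\<^sup>2)"
      by (simp only: power2_minus)
  qed
  also have "\<dots> = cell_integral (\<lambda>z. cell_integral (\<lambda>y. (f (y + z) - f y)\<^sup>2))"
    by (rule integral_swap_continuous) (auto simp: split_beta intro!: continuous_intros cf)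
  also have "\<dots> \<le> cell_integral (\<lambda>z::real^'n. ?D)"
  proof (rule cell_integral_mono)
    show "continuous_on UNIV (\<lambda>z. cell_integral (\<lambda>y. (f (y + z) - f y)\<^sup>2))" by (rule c3)
    show "cell_integral (\<lambda>y. (f (y + z) - f y)\<^sup>2) \<le> ?D" if "z \<in> cbox 0 1" for z
      by (rule translation_difference_bound[OF per f that])
  qed (rule continuous_on_const)
  finally show ?thesis by (simp add: cell_integral_const)
qed

lemma continuous_on_section:
  assumes "continuous_on (A \<times> UNIV) (\<lambda>(s, x). g s x)" "s \<in> A"
  shows "continuous_on UNIV (g s)"
proof -
  have "continuous_on UNIV (Pair s)" by (intro continuous_intros)
  from continuous_on_compose2[OF assms(1) this] show ?thesis using assms(2) by auto
qed

lemma cell_integral_has_derivative: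
  fixes g g' :: "real \<Rightarrow> real^'n \<Rightarrow> real"
  assumes d: "\<And>s x. s \<in> {a<..<b} \<Longrightarrow> ((\<lambda>s. g s x) has_real_derivative g' s x) (at s)"
    and c': "continuous_on ({a<..<b} \<times> UNIV) (\<lambda>(s, x). g' s x)"
    and c: "\<And>s. s \<in> {a<..<b} \<Longrightarrow> continuous_on UNIV (g s)"
    and t: "t \<in> {a<..<b}"
  shows "((\<lambda>s. cell_integral (g s)) has_real_derivative cell_integral (g' t)) (at t)"
proof -
  have "((\<lambda>s. cell_integral (g s)) has_real_derivative cell_integral (g' t)) (at t within {a<..<b})"
  proof (rule leibniz_rule_field_derivative)
    show "continuous_on ({a<..<b} \<times> cbox 0 1) (\<lambda>(s, x). g' s x)"
      by (rule continuous_on_subset[OF c']) auto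
    show "((\<lambda>s. g s x) has_real_derivative g' s x) (at s within {a<..<b})" if "s \<in> {a<..<b}" for s x
      by (rule has_field_derivative_at_within[OF d[OF that]])
    show "g s integrable_on cbox 0 1" if "s \<in> {a<..<b}" for s
      by (rule cell_integrable[OF c[OF that]])
  qed (use t in auto)
  then show ?thesis using at_within_open[OF t] by simp
qed

lemma cell_integral_continuous_on:
  fixes g :: "real \<Rightarrow> real^'n \<Rightarrow> real"
  assumes "continuous_on (S \<times> UNIV) (\<lambda>(s, x). g s x)"
  shows "continuous_on S (\<lambda>s. cell_integral (g s))"
  by (rule integral_continuous_on_param) (rule continuous_on_subset[OF assms], auto)

section \<open>Logarithmic estimates for drift-diffusion equations\<close>

text \<open>
  Classical solutions of m_t = div (\<kappa> Dm + V).  For the mean field game V is m times the drift.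
  The Hamiltonian is only measurable in x, so this product is differentiable although the drift
  itself need not be; therefore V is kept as a single field.
\<close>

locale drift_diffusion =
  fixes \<kappa> T :: real and m :: "real \<Rightarrow> real^'n \<Rightarrow> real" and V :: "real \<Rightarrow> real^'n \<Rightarrow> real^'n"
  assumes kappa_pos: "0 < \<kappa>"
    and regular: "classical_regularity T m"
    and V_periodic: "t \<in> {0<..<T} \<Longrightarrow> periodic (V t)"
    and V_C1: "t \<in> {0<..<T} \<Longrightarrow> C1 (\<lambda>x. V t x $ i)"
    and conservation: "t \<in> {0<..<T} \<Longrightarrow>
      deriv (\<lambda>s. m s x) t = divergence (\<lambda>y. \<kappa> *\<^sub>R grad (m t) y + V t y) x"
begin

definition flux :: "real \<Rightarrow> real^'n \<Rightarrow> real^'n" where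
  "flux t x = \<kappa> *\<^sub>R grad (m t) x + V t x"

lemma density_C2: "t \<in> {0<..<T} \<Longrightarrow> C2 (m t)"
  using regular by (simp add: classical_regularity_def)

lemma density_C1: "t \<in> {0<..<T} \<Longrightarrow> C1 (m t)"
  using density_C2 by (simp add: C2_def)

lemma density_periodic: "t \<in> {0..T} \<Longrightarrow> periodic (m t)"
  using regular by (simp add: classical_regularity_def)

lemma density_continuous: "continuous_on ({0..T} \<times> UNIV) (\<lambda>(t, x). m t x)"
  using regular by (simp add: classical_regularity_def)

lemma density_continuous_compose:
  assumes "continuous_on S a" "continuous_on S b" "a ` S \<subseteq> {0..T}"
  shows "continuous_on S (\<lambda>z. m (a z) (b z))"
  using continuous_on_compose2[OF density_continuous, of S "\<lambda>z. (a z, b z)"] assms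
  by (auto intro: continuous_intros)

lemma flux_C1: "t \<in> {0<..<T} \<Longrightarrow> C1 (\<lambda>x. flux t x $ i)"
  using density_C2[of t] V_C1[of t i] by (auto simp: flux_def C2_def intro!: C1_add C1_cmult)

lemma flux_periodic: "t \<in> {0<..<T} \<Longrightarrow> periodic (flux t)"
  using periodic_grad[OF density_periodic, of t] density_C1[of t] V_periodic[of t]
  by (auto simp: flux_def periodic_def C1_def)

lemma density_has_derivative:
  assumes "t \<in> {0<..<T}"
  shows "((\<lambda>s. m s x) has_real_derivative divergence (flux t) x) (at t)"
proof -
  have "(\<lambda>s. m s x) differentiable (at t)"
    using regular assms by (simp add: classical_regularity_def)
  then have "((\<lambda>s. m s x) has_real_derivative deriv (\<lambda>s. m s x) t) (at t)"
    by (simp add: DERIV_deriv_iff_real_differentiable)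
  then show ?thesis using conservation[OF assms, of x] by (simp add: flux_def[abs_def])
qed

lemma divergence_flux_continuous:
  "continuous_on ({0<..<T} \<times> UNIV) (\<lambda>(t, x). divergence (flux t) x)"
proof -
  have "continuous_on ({0<..<T} \<times> UNIV) (\<lambda>(t, x). deriv (\<lambda>s. m s x) t)"
    using regular by (simp add: classical_regularity_def)
  then show ?thesis
    by (rule continuous_on_eq) (use conservation in \<open>auto simp: flux_def[abs_def]\<close>)
qed

end

text \<open>
  With p = Dm/m, v = V/m and a weight \<eta> with gradient g, the left side is m D(\<eta>/m) paired with the
  flux divided by m.  Half of the quadratic term absorbs the drift.
\<close>

lemma log_dissipation_pointwise:
  fixes g p v :: "'a::real_inner"
  assumes "0 < \<kappa>" "0 \<le> \<eta>" "norm v \<le> L"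
  shows "(g - \<eta> *\<^sub>R p) \<bullet> (\<kappa> *\<^sub>R p + v)
    \<le> \<kappa> * (g \<bullet> p) + L * norm g - \<kappa> / 2 * (\<eta> * (norm p)\<^sup>2) + L\<^sup>2 / (2 * \<kappa>) * \<eta>"
proof -
  have "g \<bullet> v \<le> norm g * norm v" by (rule norm_cauchy_schwarz)
  also have "\<dots> \<le> L * norm g"
    using mult_left_mono[OF assms(3) norm_ge_zero[of g]] by (simp add: mult.commute)
  finally have 1: "g \<bullet> v \<le> L * norm g" .
  have "0 \<le> (norm (\<kappa> *\<^sub>R p + v))\<^sup>2" by simp
  also have "\<dots> = \<kappa>\<^sup>2 * (norm p)\<^sup>2 + 2 * \<kappa> * (p \<bullet> v) + (norm v)\<^sup>2"
    unfolding power2_norm_eq_inner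
    by (simp add: inner_add_left inner_add_right power2_eq_square inner_commute[of v p] algebra_simps)
  also have "(norm v)\<^sup>2 \<le> L\<^sup>2" using assms(3) by (intro power_mono) auto
  finally have "- (2 * \<kappa> * (p \<bullet> v)) \<le> \<kappa>\<^sup>2 * (norm p)\<^sup>2 + L\<^sup>2" by simp
  then have "- (2 * \<kappa> * (p \<bullet> v)) / (2 * \<kappa>) \<le> (\<kappa>\<^sup>2 * (norm p)\<^sup>2 + L\<^sup>2) / (2 * \<kappa>)"
    using assms(1) by (intro divide_right_mono) auto
  then have "- (p \<bullet> v) \<le> \<kappa> / 2 * (norm p)\<^sup>2 + L\<^sup>2 / (2 * \<kappa>)"
    using assms(1) by (simp add: add_divide_distrib power2_eq_square)
  from mult_left_mono[OF this assms(2)]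
  have "- \<eta> * (p \<bullet> v) \<le> \<kappa> / 2 * (\<eta> * (norm p)\<^sup>2) + L\<^sup>2 / (2 * \<kappa>) * \<eta>" by (simp add: algebra_simps)
  moreover have "(g - \<eta> *\<^sub>R p) \<bullet> (\<kappa> *\<^sub>R p + v)
     = \<kappa> * (g \<bullet> p) + g \<bullet> v - \<kappa> * (\<eta> * (norm p)\<^sup>2) - \<eta> * (p \<bullet> v)"
    by (simp add: inner_add_right inner_diff_left dot_square_norm algebra_simps)
  moreover have "\<kappa> / 2 * (\<eta> * (norm p)\<^sup>2) = (\<kappa> * (\<eta> * (norm p)\<^sup>2)) / 2" by simp
  ultimately show ?thesis using 1 by linarith
qed

text \<open>
  The condition on V says that the drift V/m is bounded by L, in a form that makes sense where m
  vanishes.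
\<close>

locale bounded_drift_density = drift_diffusion \<kappa> T m V
  for \<kappa> T :: real and m :: "real \<Rightarrow> real^'n \<Rightarrow> real" and V :: "real \<Rightarrow> real^'n \<Rightarrow> real^'n" +
  fixes M L :: real
  assumes density_nonneg: "t \<in> {0..T} \<Longrightarrow> 0 \<le> m t x"
    and density_le: "t \<in> {0..T} \<Longrightarrow> m t x \<le> M"
    and density_mass: "t \<in> {0..T} \<Longrightarrow> cell_integral (m t) = 1"
    and V_bound: "t \<in> {0<..<T} \<Longrightarrow> norm (V t x) \<le> L * m t x"
    and L_nonneg: "0 \<le> L"
begin

text \<open>
  This is -log m up to a constant.  The density may vanish, so it is shifted by \<epsilon>; all estimates
  are uniform in \<epsilon>.  For \<epsilon> \<le> 1 the constant makes the deficit nonnegative.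
\<close>

definition log_deficit :: "real \<Rightarrow> real \<Rightarrow> real^'n \<Rightarrow> real" where
  "log_deficit \<epsilon> t x = ln (M + 1) - ln (m t x + \<epsilon>)"

lemma M_nonneg: "0 \<le> T \<Longrightarrow> 0 \<le> M"
  using order.trans[OF density_nonneg[of 0 undefined] density_le[of 0 undefined]] by simp

lemma log_deficit_nonneg:
  assumes "t \<in> {0..T}" "0 < \<epsilon>" "\<epsilon> \<le> 1"
  shows "0 \<le> log_deficit \<epsilon> t x"
  using density_nonneg[OF assms(1), of x] density_le[OF assms(1), of x] assms
  by (simp add: log_deficit_def)

lemma log_deficit_continuous_compose:
  assumes "continuous_on S a" "continuous_on S b" "a ` S \<subseteq> {0..T}" "0 < \<epsilon>"
  shows "continuous_on S (\<lambda>z. log_deficit \<epsilon> (a z) (b z))"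
  unfolding log_deficit_def
  by (intro continuous_intros density_continuous_compose assms)
     (use assms density_nonneg in \<open>smt (verit) image_subset_iff\<close>)

lemma log_deficit_C1:
  assumes "t \<in> {0<..<T}" "0 < \<epsilon>"
  shows "C1 (log_deficit \<epsilon> t)" "grad (log_deficit \<epsilon> t) x = - (1 / (m t x + \<epsilon>)) *\<^sub>R grad (m t) x"
proof -
  have pos: "0 < m t y + \<epsilon>" for y using density_nonneg[of t y] assms by auto
  have *: "((\<lambda>r. ln (M + 1) - ln (r + \<epsilon>)) has_real_derivative - (1 / (m t y + \<epsilon>))) (at (m t y))" for y
    using pos[of y] by (auto intro!: derivative_eq_intros simp: divide_simps)
  have c: "continuous_on (range (m t)) (\<lambda>r. - (1 / (r + \<epsilon>)))"
    by (intro continuous_intros) (use pos in \<open>auto simp: less_imp_neq[THEN not_sym]\<close>)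
  from C1_compose[OF density_C1[OF assms(1)] *, OF c]
  show "C1 (log_deficit \<epsilon> t)" "grad (log_deficit \<epsilon> t) x = - (1 / (m t x + \<epsilon>)) *\<^sub>R grad (m t) x"
    by (simp_all add: log_deficit_def[abs_def])
qed

text \<open>
  Test the equation with \<eta>/(m + \<epsilon>).  Integration by parts produces, besides the heat operator on \<eta>,
  the dissipation of the logarithm; the divergence of the drift falls on \<eta> and on the logarithm,
  where it costs a first power of D\<eta> and a constant.
\<close>

lemma weighted_log_dissipation:
  fixes \<eta> \<eta>' :: "real \<Rightarrow> real^'n \<Rightarrow> real"
  assumes ab: "{a<..<b} \<subseteq> {0<..<T}" and t: "t \<in> {a<..<b}" and \<epsilon>: "0 < \<epsilon>"
    and d: "\<And>s x. s \<in> {a<..<b} \<Longrightarrow> ((\<lambda>s. \<eta> s x) has_real_derivative \<eta>' s x) (at s)"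
    and c: "continuous_on ({a<..<b} \<times> UNIV) (\<lambda>(s, x). \<eta> s x)"
    and c': "continuous_on ({a<..<b} \<times> UNIV) (\<lambda>(s, x). \<eta>' s x)"
    and \<eta>: "periodic (\<eta> t)" "C2 (\<eta> t)" and nonneg: "\<And>x. 0 \<le> \<eta> t x"
  shows "\<exists>D. ((\<lambda>t. cell_integral (\<lambda>x. \<eta> t x * log_deficit \<epsilon> t x)) has_real_derivative D) (at t) \<and>
    D \<le> cell_integral (\<lambda>x. (\<eta>' t x + \<kappa> * laplacian (\<eta> t) x) * log_deficit \<epsilon> t x)
      + L * cell_integral (\<lambda>x. norm (grad (\<eta> t) x))
      - \<kappa> / 2 * cell_integral (\<lambda>x. \<eta> t x * (norm (grad (log_deficit \<epsilon> t) x))\<^sup>2)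
      + L\<^sup>2 / (2 * \<kappa>) * cell_integral (\<eta> t)"
proof -
  have t0: "t \<in> {0<..<T}" and tc: "t \<in> {0..T}" using ab t by auto
  have pos: "0 < m s x + \<epsilon>" if "s \<in> {0..T}" for s x using density_nonneg[OF that, of x] \<epsilon> by simp
  let ?l = "log_deficit \<epsilon>"
  let ?P = "\<lambda>s x. 1 / (m s x + \<epsilon>)"
  have C1\<eta>: "C1 (\<eta> t)" and C1g\<eta>: "C1 (\<lambda>x. grad (\<eta> t) x $ i)" for i using \<eta> by (auto simp: C2_def)
  have C1m: "C1 (m t)" by (rule density_C1[OF t0])
  have C1l: "C1 (?l t)" by (rule log_deficit_C1[OF t0 \<epsilon>])
  have "C1 (\<lambda>x. m t x + \<epsilon>)" "grad (\<lambda>x. m t x + \<epsilon>) x = grad (m t) x" for x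
    using C1_add[OF C1m C1_const] grad_add[OF C1m C1_const] by (simp_all add: grad_const)
  then have P: "C1 (?P t)" "grad (?P t) x = - (?P t x)\<^sup>2 *\<^sub>R grad (m t) x" for x
    using C1_inverse[of "\<lambda>x. m t x + \<epsilon>", OF _ pos[OF tc]] by simp_all
  define D where "D = cell_integral (\<lambda>x. \<eta>' t x * ?l t x - \<eta> t x * ?P t x * divergence (flux t) x)"
  have "((\<lambda>t. cell_integral (\<lambda>x. \<eta> t x * ?l t x)) has_real_derivative D) (at t)"
    unfolding D_def
  proof (rule cell_integral_has_derivative[OF _ _ _ t])
    fix s x assume s: "s \<in> {a<..<b}"
    then have s0: "s \<in> {0<..<T}" using ab by auto
    have "((\<lambda>s. ?l s x) has_real_derivative 0 - 1 / (m s x + \<epsilon>) * (divergence (flux s) x + 0)) (at s)"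
      unfolding log_deficit_def using s0
      by (intro DERIV_diff DERIV_const DERIV_chain2[where f=ln] DERIV_ln_divide pos DERIV_add density_has_derivative[OF s0]) auto
    from DERIV_mult[OF d[OF s] this]
    show "((\<lambda>s. \<eta> s x * ?l s x) has_real_derivative
        \<eta>' s x * ?l s x - \<eta> s x * ?P s x * divergence (flux s) x) (at s)"
      by (rule DERIV_cong) (simp add: algebra_simps)
  next
    have sub: "fst ` ({a<..<b} \<times> (UNIV :: (real^'n) set)) \<subseteq> {0..T}"
      using subsetD[OF ab] by force
    have cm: "continuous_on ({a<..<b} \<times> UNIV) (\<lambda>z. m (fst z) (snd z))"
      by (rule density_continuous_compose[OF _ _ sub]) (intro continuous_intros)+
    have c1: "continuous_on ({a<..<b} \<times> UNIV) (\<lambda>z. ?l (fst z) (snd z))"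
      by (rule log_deficit_continuous_compose[OF _ _ sub \<epsilon>]) (intro continuous_intros)+
    have c2: "continuous_on ({a<..<b} \<times> UNIV) (\<lambda>z. ?P (fst z) (snd z))"
      by (intro continuous_intros cm ballI pos[THEN less_imp_neq, THEN not_sym] subsetD[OF sub] imageI)
    have "{a<..<b} \<times> (UNIV :: (real^'n) set) \<subseteq> {0<..<T} \<times> UNIV" using ab by (rule Sigma_mono) simp
    then have c3: "continuous_on ({a<..<b} \<times> UNIV) (\<lambda>z. divergence (flux (fst z)) (snd z))"
      by (rule continuous_on_subset[OF divergence_flux_continuous[unfolded split_beta]])
    show "continuous_on ({a<..<b} \<times> UNIV) (\<lambda>(s, x). \<eta>' s x * ?l s x - \<eta> s x * ?P s x * divergence (flux s) x)"
      using c c' c1 c2 c3 unfolding split_beta by (intro continuous_on_diff continuous_on_mult)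
  next
    fix s assume s: "s \<in> {a<..<b}"
    have "(\<lambda>_::real^'n. s) ` UNIV \<subseteq> {0..T}" using subsetD[OF ab s] by auto
    then have "continuous_on UNIV (?l s)"
      by (rule log_deficit_continuous_compose[OF continuous_on_const continuous_on_id _ \<epsilon>])
    moreover have "continuous_on UNIV (\<eta> s)"
      by (rule continuous_on_section[OF c s])
    ultimately show "continuous_on UNIV (\<lambda>x. \<eta> s x * ?l s x)" by (intro continuous_intros)
  qed
  moreover have "D \<le> cell_integral (\<lambda>x. (\<eta>' t x + \<kappa> * laplacian (\<eta> t) x) * ?l t x)
      + L * cell_integral (\<lambda>x. norm (grad (\<eta> t) x))
      - \<kappa> / 2 * cell_integral (\<lambda>x. \<eta> t x * (norm (grad (?l t) x))\<^sup>2)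
      + L\<^sup>2 / (2 * \<kappa>) * cell_integral (\<eta> t)"
  proof -
    have c'': "continuous_on UNIV (\<eta>' t)"
      by (rule continuous_on_section[OF c' t])
    note cs = continuous_intros c'' C1_continuous[OF C1l] C1_continuous[OF C1\<eta>] C1_continuous[OF P(1)]
      C1_continuous_grad[OF C1l] C1_continuous_grad[OF C1\<eta>] C1_continuous_grad[OF C1m]
      C1_components_continuous(2)[OF C1g\<eta>] C1_components_continuous[OF flux_C1[OF t0]]
    have C1\<eta>P: "C1 (\<lambda>x. \<eta> t x * ?P t x)" by (rule C1_mult[OF C1\<eta> P(1)])
    have per\<eta>P: "periodic (\<lambda>x. \<eta> t x * ?P t x)" and perl: "periodic (?l t)"
      using \<eta>(1) density_periodic[OF tc] by (auto simp: periodic_def log_deficit_def)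
    have gradP: "grad (\<lambda>x. \<eta> t x * ?P t x) x = ?P t x *\<^sub>R (grad (\<eta> t) x - \<eta> t x *\<^sub>R (?P t x *\<^sub>R grad (m t) x))" for x
    proof -
      have "e *\<^sub>R (- p\<^sup>2 *\<^sub>R d) + p *\<^sub>R g = p *\<^sub>R (g - e *\<^sub>R (p *\<^sub>R d))" for e p :: real and d g :: "real^'n"
        by (simp add: algebra_simps power2_eq_square)
      then show ?thesis unfolding grad_mult[OF C1\<eta> P(1)] P(2) .
    qed
    have gradl: "grad (?l t) x = - (?P t x *\<^sub>R grad (m t) x)" for x
      by (simp add: log_deficit_C1(2)[OF t0 \<epsilon>])
    have "D = cell_integral (\<lambda>x. \<eta>' t x * ?l t x) - cell_integral (\<lambda>x. (\<eta> t x * ?P t x) * divergence (flux t) x)"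
      unfolding D_def by (rule cell_integral_diff; intro cs)
    also have "cell_integral (\<lambda>x. (\<eta> t x * ?P t x) * divergence (flux t) x)
      = - cell_integral (\<lambda>x. grad (\<lambda>x. \<eta> t x * ?P t x) x \<bullet> flux t x)"
      by (rule cell_integral_by_parts[OF per\<eta>P C1\<eta>P flux_periodic[OF t0] flux_C1[OF t0]])
    also have "cell_integral (\<lambda>x. \<eta>' t x * ?l t x) - - cell_integral (\<lambda>x. grad (\<lambda>x. \<eta> t x * ?P t x) x \<bullet> flux t x)
       \<le> cell_integral (\<lambda>x. \<eta>' t x * ?l t x) + cell_integral (\<lambda>x. - \<kappa> * (grad (?l t) x \<bullet> grad (\<eta> t) x) + L * norm (grad (\<eta> t) x)
          - \<kappa> / 2 * (\<eta> t x * (norm (grad (?l t) x))\<^sup>2) + L\<^sup>2 / (2 * \<kappa>) * \<eta> t x)"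
    proof -
      have "cell_integral (\<lambda>x. grad (\<lambda>x. \<eta> t x * ?P t x) x \<bullet> flux t x) \<le> cell_integral (\<lambda>x. - \<kappa> * (grad (?l t) x \<bullet> grad (\<eta> t) x) + L * norm (grad (\<eta> t) x)
          - \<kappa> / 2 * (\<eta> t x * (norm (grad (?l t) x))\<^sup>2) + L\<^sup>2 / (2 * \<kappa>) * \<eta> t x)"
      proof (rule cell_integral_mono)
        fix x :: "real^'n"
        let ?p = "?P t x *\<^sub>R grad (m t) x"
        have "norm (?P t x *\<^sub>R V t x) \<le> ?P t x * (L * m t x)"
          using V_bound[OF t0, of x] pos[OF tc, of x] by (auto intro!: divide_right_mono)
        also have "\<dots> \<le> L"
        proof -
          have "L * m t x \<le> L * (m t x + \<epsilon>)" using L_nonneg \<epsilon> by (intro mult_left_mono) auto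
          then show ?thesis using pos[OF tc, of x] by (simp add: field_simps)
        qed
        finally have bd: "norm (?P t x *\<^sub>R V t x) \<le> L" .
        have "grad (\<lambda>x. \<eta> t x * ?P t x) x \<bullet> flux t x
          = (grad (\<eta> t) x - \<eta> t x *\<^sub>R ?p) \<bullet> (\<kappa> *\<^sub>R ?p + ?P t x *\<^sub>R V t x)"
        proof -
          have "(p *\<^sub>R y) \<bullet> (\<kappa> *\<^sub>R d + v) = y \<bullet> (\<kappa> *\<^sub>R (p *\<^sub>R d) + p *\<^sub>R v)" for p :: real and y d v :: "real^'n"
            by (simp add: inner_add_right algebra_simps)
          then show ?thesis unfolding gradP flux_def .
        qed
        also have "\<dots> \<le> \<kappa> * (grad (\<eta> t) x \<bullet> ?p) + L * norm (grad (\<eta> t) x) - \<kappa> / 2 * (\<eta> t x * (norm ?p)\<^sup>2) + L\<^sup>2 / (2 * \<kappa>) * \<eta> t x"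
          by (rule log_dissipation_pointwise[OF kappa_pos nonneg bd])
        also have "\<dots> = - \<kappa> * (grad (?l t) x \<bullet> grad (\<eta> t) x) + L * norm (grad (\<eta> t) x)
          - \<kappa> / 2 * (\<eta> t x * (norm (grad (?l t) x))\<^sup>2) + L\<^sup>2 / (2 * \<kappa>) * \<eta> t x"
          by (simp add: gradl inner_commute)
        finally show "grad (\<lambda>x. \<eta> t x * ?P t x) x \<bullet> flux t x \<le> \<dots>" .
      qed (intro cs C1_continuous_grad[OF C1\<eta>P])+
      then show ?thesis by simp
    qed
    also have "\<dots> = cell_integral (\<lambda>x. \<eta>' t x * ?l t x) + (- \<kappa> * cell_integral (\<lambda>x. grad (?l t) x \<bullet> grad (\<eta> t) x))
      + L * cell_integral (\<lambda>x. norm (grad (\<eta> t) x))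
      - \<kappa> / 2 * cell_integral (\<lambda>x. \<eta> t x * (norm (grad (?l t) x))\<^sup>2)
      + L\<^sup>2 / (2 * \<kappa>) * cell_integral (\<eta> t)"
      by (subst cell_integral_add cell_integral_diff; (intro cs)?; simp)+
    also have "- \<kappa> * cell_integral (\<lambda>x. grad (?l t) x \<bullet> grad (\<eta> t) x) = \<kappa> * cell_integral (\<lambda>x. ?l t x * divergence (grad (\<eta> t)) x)"
    proof -
      have "periodic (grad (\<eta> t))" by (rule periodic_grad[OF \<eta>(1)]) (use C1\<eta> in \<open>simp add: C1_def\<close>)
      from cell_integral_by_parts[OF perl C1l this C1g\<eta>] show ?thesis by simp
    qed
    also have "cell_integral (\<lambda>x. \<eta>' t x * ?l t x) + \<kappa> * cell_integral (\<lambda>x. ?l t x * divergence (grad (\<eta> t)) x)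
       = cell_integral (\<lambda>x. (\<eta>' t x + \<kappa> * laplacian (\<eta> t) x) * ?l t x)"
    proof -
      have "cell_integral (\<lambda>x. \<eta>' t x * ?l t x + \<kappa> * (?l t x * divergence (grad (\<eta> t)) x)) =
         cell_integral (\<lambda>x. \<eta>' t x * ?l t x) + \<kappa> * cell_integral (\<lambda>x. ?l t x * divergence (grad (\<eta> t)) x)"
        by (subst cell_integral_add; (intro cs)?; simp)
      then show ?thesis by (simp add: laplacian_eq_divergence algebra_simps)
    qed
    finally show ?thesis .
  qed
  ultimately show ?thesis by blast
qed

lemma log_deficit_periodic: "t \<in> {0..T} \<Longrightarrow> periodic (log_deficit \<epsilon> t)"
  using density_periodic by (simp add: periodic_def log_deficit_def)

text \<open>
  The density has mass 1, and its product with the deficit is at most M + 1 because r log (1/r) is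
  bounded.  Hence the mean K of the deficit exceeds M + 1 by at most the m-average of K minus the
  deficit, and the Poincare inequality controls the deviation of the deficit from its mean.
\<close>

lemma log_integral_le_dissipation:
  assumes t: "t \<in> {0<..<T}" and \<epsilon>: "0 < \<epsilon>" "\<epsilon> \<le> 1" and \<theta>: "0 < \<theta>"
  shows "cell_integral (log_deficit \<epsilon> t) - (M + 1)
    \<le> \<theta> * (real CARD('n) * cell_integral (\<lambda>x. (norm (grad (log_deficit \<epsilon> t) x))\<^sup>2)) + M\<^sup>2 / (4 * \<theta>)"
proof -
  have tc: "t \<in> {0..T}" using t by auto
  let ?l = "log_deficit \<epsilon> t"
  define K where "K = cell_integral ?l"
  note C1l = log_deficit_C1(1)[OF t \<epsilon>(1)]
  note cl = C1_continuous[OF C1l] and cm = C1_continuous[OF density_C1[OF t]]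
  have pos: "0 < m t x + \<epsilon>" "m t x \<le> M" "0 \<le> m t x" for x
    using density_nonneg[OF tc, of x] \<epsilon> density_le[OF tc, of x] by auto
  have "m t x * ?l x \<le> M + 1" for x
  proof -
    have "?l x = ln ((M + 1) / (m t x + \<epsilon>))"
      using pos[of x] by (simp add: log_deficit_def ln_div)
    also have "\<dots> \<le> (M + 1) / (m t x + \<epsilon>)"
      using pos[of x] by (intro ln_bound) (auto intro!: divide_pos_pos)
    finally have "m t x * ?l x \<le> m t x * ((M + 1) / (m t x + \<epsilon>))"
      using pos[of x] by (intro mult_left_mono)
    also have "\<dots> \<le> M + 1"
    proof -
      have "m t x * (M + 1) \<le> (m t x + \<epsilon>) * (M + 1)" using pos[of x] \<epsilon> by (intro mult_right_mono) auto
      then show ?thesis using pos[of x] by (simp add: field_simps)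
    qed
    finally show ?thesis .
  qed
  then have "cell_integral (\<lambda>x. m t x * ?l x) \<le> cell_integral (\<lambda>x::real^'n. M + 1)"
    by (intro cell_integral_mono continuous_intros cl cm)
  moreover have "cell_integral (\<lambda>x. K * m t x - m t x * ?l x) = K * cell_integral (m t) - cell_integral (\<lambda>x. m t x * ?l x)"
    by (subst cell_integral_diff) (auto intro!: continuous_intros cl cm)
  ultimately have "K - (M + 1) \<le> cell_integral (\<lambda>x. K * m t x - m t x * ?l x)"
    using density_mass[OF tc] by simp
  also have "\<dots> \<le> cell_integral (\<lambda>x. \<theta> * (?l x - K)\<^sup>2 + M\<^sup>2 / (4 * \<theta>))"
  proof (intro cell_integral_mono continuous_intros cl cm)
    fix x :: "real^'n"
    have "0 \<le> (2 * \<theta> * (?l x - K) + m t x)\<^sup>2" by simp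
    also have "\<dots> = 4 * \<theta> * (\<theta> * (?l x - K)\<^sup>2 - (K * m t x - m t x * ?l x)) + (m t x)\<^sup>2"
      by (simp add: power2_eq_square algebra_simps)
    also have "(m t x)\<^sup>2 \<le> M\<^sup>2" using pos[of x] by (intro power_mono) auto
    finally have "(K * m t x - m t x * ?l x) * (4 * \<theta>) \<le> \<theta> * (?l x - K)\<^sup>2 * (4 * \<theta>) + M\<^sup>2"
      by (simp add: algebra_simps)
    then show "K * m t x - m t x * ?l x \<le> \<theta> * (?l x - K)\<^sup>2 + M\<^sup>2 / (4 * \<theta>)"
      using \<theta> by (simp add: field_simps)
  qed
  also have "\<dots> = \<theta> * cell_integral (\<lambda>x. (?l x - K)\<^sup>2) + M\<^sup>2 / (4 * \<theta>)"
    by (subst cell_integral_add) (auto intro!: continuous_intros cl)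
  also have "cell_integral (\<lambda>x. (?l x - K)\<^sup>2) \<le> real CARD('n) * cell_integral (\<lambda>x. (norm (grad ?l x))\<^sup>2)"
    unfolding K_def by (rule poincare_torus[OF log_deficit_periodic[OF tc] C1l])
  finally show ?thesis using \<theta> by (simp add: K_def)
qed

lemma log_integral_has_derivative:
  assumes t: "t \<in> {0<..<T}" and \<epsilon>: "0 < \<epsilon>"
  shows "\<exists>D. ((\<lambda>t. cell_integral (log_deficit \<epsilon> t)) has_real_derivative D) (at t) \<and>
    D \<le> L\<^sup>2 / (2 * \<kappa>) - \<kappa> / 2 * cell_integral (\<lambda>x. (norm (grad (log_deficit \<epsilon> t) x))\<^sup>2)"
proof -
  have lap: "laplacian (\<lambda>x::real^'n. 1) = (\<lambda>x. 0)"
    by (simp add: fun_eq_iff laplacian_eq_divergence divergence_def grad_const[abs_def])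
  have "C2 (\<lambda>x::real^'n. 1)"
    using C1_const by (auto simp: C2_def grad_const)
  from weighted_log_dissipation[OF order_refl t \<epsilon>, of "\<lambda>_ _. 1" "\<lambda>_ _. 0", OF _ _ _ _ this]
  show ?thesis by (simp add: lap grad_const periodic_def algebra_simps)
qed

text \<open>
  The dissipation is quadratic in the integral K of the deficit, so the inequality for K is of
  Riccati type and K comes down from infinity.  In particular the bound does not depend on the
  value at time t0.
\<close>

lemma log_integral_bound:
  assumes \<epsilon>: "0 < \<epsilon>" "\<epsilon> \<le> 1" and t0: "0 \<le> t0" "t0 + 1 < T"
  shows "cell_integral (log_deficit \<epsilon> (t0 + 1))
    \<le> L\<^sup>2 / (2 * \<kappa>) + 2 * (M + 1) + 2 * real CARD('n) * M\<^sup>2 / \<kappa>"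
proof -
  define N where "N = real CARD('n)"
  have N: "0 < N" by (simp add: N_def)
  have M: "0 \<le> M" using M_nonneg t0 by simp
  note k = kappa_pos
  define B where "B = L\<^sup>2 / (2 * \<kappa>) + 2 * (M + 1) + 2 * N * M\<^sup>2 / \<kappa>"
  let ?K = "\<lambda>t. cell_integral (log_deficit \<epsilon> t)"
  have "continuous_on ({t0..t0 + 1} \<times> UNIV) (\<lambda>z. log_deficit \<epsilon> (fst z) (snd z))"
    by (rule log_deficit_continuous_compose) (use \<epsilon> t0 in \<open>auto intro: continuous_intros\<close>)
  then have cK: "continuous_on {t0..t0 + 1} ?K"
    by (intro cell_integral_continuous_on) (simp add: split_beta)
  \<comment> \<open>The weight vanishes at t0, where K may be arbitrarily large, to the order at which the Riccati
    inequality lets K blow up.  With the parameter \<kappa>\<tau>/(4n) below, the dissipation absorbs the term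
    2\<tau>K that comes from differentiating the weight.\<close>
  let ?h = "\<lambda>t. (t - t0)\<^sup>2 * ?K t - B * (t - t0)"
  have "?h (t0 + 1) \<le> ?h t0"
  proof (rule DERIV_nonpos_imp_decreasing_open[where f="?h" and a=t0])
    fix t assume t: "t0 < t" "t < t0 + 1"
    then have t': "t \<in> {0<..<T}" using t0 by auto
    define \<tau> where "\<tau> = t - t0"
    have \<tau>: "0 < \<tau>" "\<tau> \<le> 1" using t by (auto simp: \<tau>_def)
    obtain D where D: "(?K has_real_derivative D) (at t)"
      "D \<le> L\<^sup>2 / (2 * \<kappa>) - \<kappa> / 2 * cell_integral (\<lambda>x. (norm (grad (log_deficit \<epsilon> t) x))\<^sup>2)" (is "_ \<le> _ - _ * ?G")
      using log_integral_has_derivative[OF t' \<epsilon>(1)] by blast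
    have "?K t - (M + 1) \<le> \<kappa> * \<tau> / (4 * N) * (N * ?G) + M\<^sup>2 / (4 * (\<kappa> * \<tau> / (4 * N)))"
      unfolding N_def by (rule log_integral_le_dissipation[OF t' \<epsilon>]) (use \<tau> k in auto)
    then have "?K t - (M + 1) \<le> \<kappa> * \<tau> / 4 * ?G + N * M\<^sup>2 / (\<kappa> * \<tau>)"
      using N \<tau> k by (simp add: field_simps)
    then have "2 * \<tau> * (?K t - (M + 1)) \<le> 2 * \<tau> * (\<kappa> * \<tau> / 4 * ?G + N * M\<^sup>2 / (\<kappa> * \<tau>))"
      using \<tau> by (intro mult_left_mono) auto
    also have "\<dots> = \<tau>\<^sup>2 * (\<kappa> / 2 * ?G) + 2 * N * M\<^sup>2 / \<kappa>"
      using \<tau> k by (simp add: field_simps power2_eq_square)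
    finally have 1: "2 * \<tau> * ?K t \<le> 2 * \<tau> * (M + 1) + \<tau>\<^sup>2 * (\<kappa> / 2 * ?G) + 2 * N * M\<^sup>2 / \<kappa>"
      by (simp add: algebra_simps)
    have 2: "\<tau>\<^sup>2 * D \<le> \<tau>\<^sup>2 * (L\<^sup>2 / (2 * \<kappa>) - \<kappa> / 2 * ?G)"
      using D(2) by (intro mult_left_mono) auto
    have 3: "\<tau>\<^sup>2 * (L\<^sup>2 / (2 * \<kappa>)) \<le> 1 * (L\<^sup>2 / (2 * \<kappa>))"
      by (rule mult_right_mono) (use \<tau> k in \<open>auto simp: power_le_one\<close>)
    have 4: "\<tau> * (2 * (M + 1)) \<le> 1 * (2 * (M + 1))"
      by (rule mult_right_mono) (use \<tau> M in auto)
    from 1 2 3 4 have "2 * \<tau> * ?K t + \<tau>\<^sup>2 * D - B \<le> 0"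
      by (simp add: B_def algebra_simps)
    moreover have "(?h has_real_derivative (2 * \<tau> * ?K t + \<tau>\<^sup>2 * D - B)) (at t)"
      unfolding \<tau>_def by (auto intro!: derivative_eq_intros D(1))
    ultimately show "\<exists>y. (?h has_real_derivative y) (at t) \<and> y \<le> 0" by blast
  qed (auto intro!: continuous_intros cK)
  then show ?thesis by (simp add: B_def N_def)
qed

end

section \<open>A periodic Gaussian\<close>

text \<open>
  A smooth periodic substitute for |y - x|^2.
\<close>

definition periodic_gap :: "real^'n \<Rightarrow> real^'n \<Rightarrow> real" where
  "periodic_gap x y = (\<Sum>i\<in>UNIV. 1 - cos (2 * pi * (y $ i - x $ i)))"

text \<open>
  The heat kernel with |y - x|^2 replaced by a constant times the periodic gap.  The constant is
  chosen so that this explicit function is a supersolution of the heat equation up to a multiple of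
  itself.
\<close>

definition gauss :: "real \<Rightarrow> real^'n \<Rightarrow> real \<Rightarrow> real^'n \<Rightarrow> real" where
  "gauss \<kappa> x \<tau> y = exp (- (real CARD('n) / 2) * ln \<tau> - 1 / (8 * pi\<^sup>2 * \<kappa>) / \<tau> * periodic_gap x y)"

definition gauss_dt :: "real \<Rightarrow> real^'n \<Rightarrow> real \<Rightarrow> real^'n \<Rightarrow> real" where
  "gauss_dt \<kappa> x \<tau> y = gauss \<kappa> x \<tau> y * (1 / (8 * pi\<^sup>2 * \<kappa>) / \<tau>\<^sup>2 * periodic_gap x y - real CARD('n) / 2 / \<tau>)"

lemma periodic_gap_nonneg: "0 \<le> periodic_gap x y"
  by (simp add: periodic_gap_def sum_nonneg)

lemma periodic_gap_periodic:
  fixes x :: "real^'n"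
  shows "periodic (periodic_gap x)"
proof -
  have "cos (2 * pi * (y $ j + axis i 1 $ j - x $ j)) = cos (2 * pi * (y $ j - x $ j))" for y :: "real^'n" and i j
    by (cases "j = i") (auto simp: axis_def algebra_simps cos_add cos_diff sin_add sin_diff)
  then show ?thesis by (simp add: periodic_def periodic_gap_def)
qed

lemma GDERIV_nth: "GDERIV (\<lambda>y::real^'n. y $ i) y :> axis i 1"
  by (auto simp: gderiv_def inner_axis intro!: bounded_linear_imp_has_derivative bounded_linear_vec_nth)

lemma C1_nth: "C1 (\<lambda>y::real^'n. y $ i)"
  by (rule C1I[OF GDERIV_nth]) (rule continuous_on_const)

lemma grad_nth: "grad (\<lambda>y::real^'n. y $ i) y = axis i 1"
  by (rule grad_eqI[OF GDERIV_nth])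

lemma GDERIV_sum:
  assumes "finite I" "\<And>i. i \<in> I \<Longrightarrow> GDERIV (f i) x :> g i"
  shows "GDERIV (\<lambda>x. \<Sum>i\<in>I. f i x) x :> (\<Sum>i\<in>I. g i)"
  using assms by (induction rule: finite_induct) (auto intro!: GDERIV_add GDERIV_const)

lemma C1_sin_nth:
  fixes x :: "real^'n"
  shows "C1 (\<lambda>y. 2 * pi * sin (2 * pi * (y $ i - x $ i)))" (is ?A)
    and "grad (\<lambda>y. 2 * pi * sin (2 * pi * (y $ i - x $ i))) y = (4 * pi\<^sup>2 * cos (2 * pi * (y $ i - x $ i))) *\<^sub>R axis i 1" (is ?B)
proof -
  have d: "((\<lambda>r. 2 * pi * sin (2 * pi * (r - x $ i))) has_real_derivative 4 * pi\<^sup>2 * cos (2 * pi * (r - x $ i))) (at r)" for r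
    by (auto intro!: derivative_eq_intros simp: power2_eq_square)
  have c: "continuous_on S (\<lambda>r. 4 * pi\<^sup>2 * cos (2 * pi * (r - x $ i)))" for S by (intro continuous_intros)
  show ?A by (rule C1_compose(1)[OF C1_nth d c])
  show ?B using C1_compose(2)[OF C1_nth d c] by (simp add: grad_nth)
qed

lemma C1_periodic_gap:
  shows "C1 (periodic_gap x)"
    and "grad (periodic_gap x) y $ i = 2 * pi * sin (2 * pi * (y $ i - x $ i))"
proof -
  let ?g = "\<lambda>y. \<Sum>i\<in>UNIV. (2 * pi * sin (2 * pi * (y $ i - x $ i))) *\<^sub>R axis i 1"
  have 1: "GDERIV (\<lambda>y. 1 - cos (2 * pi * (y $ i - x $ i))) y :> (2 * pi * sin (2 * pi * (y $ i - x $ i))) *\<^sub>R axis i 1" for i y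
  proof (rule GDERIV_DERIV_compose[OF GDERIV_nth])
    show "((\<lambda>r. 1 - cos (2 * pi * (r - x $ i))) has_real_derivative 2 * pi * sin (2 * pi * (y $ i - x $ i))) (at (y $ i))"
      by (auto intro!: derivative_eq_intros)
  qed
  have 2: "GDERIV (periodic_gap x) y :> ?g y" for y
    unfolding periodic_gap_def[abs_def] by (rule GDERIV_sum) (auto intro: 1)
  show "C1 (periodic_gap x)"
    by (rule C1I[OF 2]) (intro continuous_intros)
  show "grad (periodic_gap x) y $ i = 2 * pi * sin (2 * pi * (y $ i - x $ i))"
    unfolding grad_eqI[OF 2] by (simp add: axis_def if_distrib[where f="(*) _"] cong: if_cong)
qed

lemma gauss_pos: "0 < gauss \<kappa> x \<tau> y"
  by (simp add: gauss_def)

lemma gauss_periodic: "periodic (gauss \<kappa> x \<tau>)"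
  using periodic_gap_periodic[of x] by (auto simp: periodic_def gauss_def)

lemma gauss_C1:
  shows "C1 (gauss \<kappa> x \<tau>)"
    and "grad (gauss \<kappa> x \<tau>) y = (- (1 / (8 * pi\<^sup>2 * \<kappa>) / \<tau> * gauss \<kappa> x \<tau> y)) *\<^sub>R grad (periodic_gap x) y"
proof -
  fix y
  let ?\<phi> = "\<lambda>r. exp (- (real CARD('a) / 2) * ln \<tau> - 1 / (8 * pi\<^sup>2 * \<kappa>) / \<tau> * r)"
  have d: "(?\<phi> has_real_derivative - (1 / (8 * pi\<^sup>2 * \<kappa>) / \<tau> * ?\<phi> r)) (at r)" for r
    by (rule derivative_eq_intros refl)+ simp
  have c: "continuous_on S (\<lambda>r. - (1 / (8 * pi\<^sup>2 * \<kappa>) / \<tau> * ?\<phi> r))" for S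
    unfolding divide_inverse by (intro continuous_intros)
  show "C1 (gauss \<kappa> x \<tau>)"
    unfolding gauss_def[abs_def] by (rule C1_compose(1)[OF C1_periodic_gap(1) d c])
  show "grad (gauss \<kappa> x \<tau>) y = (- (1 / (8 * pi\<^sup>2 * \<kappa>) / \<tau> * gauss \<kappa> x \<tau> y)) *\<^sub>R grad (periodic_gap x) y"
    unfolding gauss_def[abs_def] by (rule C1_compose(2)[OF C1_periodic_gap(1) d c])
qed

lemma gauss_grad_nth:
  "grad (gauss \<kappa> x \<tau>) y $ i = - (1 / (8 * pi\<^sup>2 * \<kappa>) / \<tau>) * (gauss \<kappa> x \<tau> y * (2 * pi * sin (2 * pi * (y $ i - x $ i))))"
  unfolding gauss_C1(2) vector_scaleR_component C1_periodic_gap(2) by simp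

lemma gauss_C2: "C2 (gauss \<kappa> x \<tau>)"
  unfolding C2_def gauss_grad_nth
  by (intro conjI allI gauss_C1(1) C1_cmult[OF C1_mult[OF gauss_C1(1) C1_sin_nth(1)]])

lemma gauss_laplacian:
  "laplacian (gauss \<kappa> x \<tau>) y = gauss \<kappa> x \<tau> y * (\<Sum>i\<in>UNIV. (1 / (8 * pi\<^sup>2 * \<kappa>) / \<tau>)\<^sup>2 * (2 * pi * sin (2 * pi * (y $ i - x $ i)))\<^sup>2
      - (1 / (8 * pi\<^sup>2 * \<kappa>) / \<tau>) * (4 * pi\<^sup>2 * cos (2 * pi * (y $ i - x $ i))))"
proof -
  let ?a = "1 / (8 * pi\<^sup>2 * \<kappa>) / \<tau>"
  have "grad (\<lambda>y. grad (gauss \<kappa> x \<tau>) y $ i) y $ i = gauss \<kappa> x \<tau> y * (?a\<^sup>2 * (2 * pi * sin (2 * pi * (y $ i - x $ i)))\<^sup>2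
      - ?a * (4 * pi\<^sup>2 * cos (2 * pi * (y $ i - x $ i))))" for i
  proof -
    let ?s = "\<lambda>y. 2 * pi * sin (2 * pi * (y $ i - x $ i))"
    have "grad (\<lambda>y. grad (gauss \<kappa> x \<tau>) y $ i) y
       = (- ?a) *\<^sub>R (gauss \<kappa> x \<tau> y *\<^sub>R grad ?s y + ?s y *\<^sub>R grad (gauss \<kappa> x \<tau>) y)"
      unfolding gauss_grad_nth
      by (subst grad_cmult, intro C1_mult gauss_C1(1) C1_sin_nth(1), subst grad_mult, rule gauss_C1(1), rule C1_sin_nth(1), rule refl)
    then have "grad (\<lambda>y. grad (gauss \<kappa> x \<tau>) y $ i) y $ i
       = - ?a * (gauss \<kappa> x \<tau> y * grad ?s y $ i + ?s y * grad (gauss \<kappa> x \<tau>) y $ i)"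
      by (simp only: vector_scaleR_component vector_add_component real_scaleR_def)
    also have "\<dots> = - ?a * (gauss \<kappa> x \<tau> y * (4 * pi\<^sup>2 * cos (2 * pi * (y $ i - x $ i))) + ?s y * (- ?a * (gauss \<kappa> x \<tau> y * ?s y)))"
      unfolding C1_sin_nth(2) gauss_grad_nth by (simp add: axis_def)
    finally show ?thesis by (simp add: power2_eq_square algebra_simps)
  qed
  then show ?thesis by (simp add: laplacian_def trace_def hessian_def sum_distrib_left)
qed

text \<open>
  The operator splits into a sum over the coordinates.  In each of them the difference of the two
  sides, divided by the kernel, is a nonnegative multiple of a square.
\<close>

lemma gauss_supersolution:
  fixes x :: "real^'n"
  assumes "0 < \<kappa>" "0 < \<tau>"
  shows "\<kappa> * laplacian (gauss \<kappa> x \<tau>) y \<le> gauss_dt \<kappa> x \<tau> y + real CARD('n) * pi\<^sup>2 * \<kappa> * gauss \<kappa> x \<tau> y"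
proof -
  let ?a = "1 / (8 * pi\<^sup>2 * \<kappa>)"
  let ?c = "\<lambda>i. cos (2 * pi * (y $ i - x $ i))"
  let ?s = "\<lambda>i. sin (2 * pi * (y $ i - x $ i))"
  have "\<kappa> * ((?a / \<tau>)\<^sup>2 * (2 * pi * ?s i)\<^sup>2 - ?a / \<tau> * (4 * pi\<^sup>2 * ?c i)) \<le> ?a / \<tau>\<^sup>2 * (1 - ?c i) - 1 / 2 / \<tau> + pi\<^sup>2 * \<kappa>" for i
  proof -
    define X where "X = (1 - ?c i) / \<tau>"
    have c: "?c i = 1 - \<tau> * X" using assms by (simp add: X_def)
    have s: "(?s i)\<^sup>2 = 1 - (1 - \<tau> * X)\<^sup>2" using sin_squared_eq[of "2 * pi * (y $ i - x $ i)"] c by simp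
    have pp: "pi\<^sup>2 > 0" by simp
    have "?a / \<tau>\<^sup>2 * (1 - ?c i) - 1 / 2 / \<tau> + pi\<^sup>2 * \<kappa> - \<kappa> * ((?a / \<tau>)\<^sup>2 * (2 * pi * ?s i)\<^sup>2 - ?a / \<tau> * (4 * pi\<^sup>2 * ?c i))
      = ?a / 2 * (X - 4 * pi\<^sup>2 * \<kappa>)\<^sup>2"
      unfolding power_mult_distrib s c using assms pp
      by (simp add: field_simps power2_eq_square)
    also have "\<dots> \<ge> 0" using assms by simp
    finally show ?thesis by linarith
  qed
  then have "(\<Sum>i\<in>UNIV. \<kappa> * ((?a / \<tau>)\<^sup>2 * (2 * pi * ?s i)\<^sup>2 - ?a / \<tau> * (4 * pi\<^sup>2 * ?c i)))
     \<le> (\<Sum>i\<in>UNIV. ?a / \<tau>\<^sup>2 * (1 - ?c i) - 1 / 2 / \<tau> + pi\<^sup>2 * \<kappa>)"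
    by (rule sum_mono)
  also have "\<dots> = ?a / \<tau>\<^sup>2 * periodic_gap x y - real CARD('n) / 2 / \<tau> + real CARD('n) * pi\<^sup>2 * \<kappa>"
    by (simp only: sum.distrib sum_subtractf sum_distrib_left[symmetric] periodic_gap_def) (simp add: algebra_simps)
  finally have "gauss \<kappa> x \<tau> y * (\<Sum>i\<in>UNIV. \<kappa> * ((?a / \<tau>)\<^sup>2 * (2 * pi * ?s i)\<^sup>2 - ?a / \<tau> * (4 * pi\<^sup>2 * ?c i)))
     \<le> gauss \<kappa> x \<tau> y * (?a / \<tau>\<^sup>2 * periodic_gap x y - real CARD('n) / 2 / \<tau> + real CARD('n) * pi\<^sup>2 * \<kappa>)"
    by (rule mult_left_mono) (rule less_imp_le[OF gauss_pos])
  then show ?thesis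
    unfolding gauss_laplacian gauss_dt_def sum_distrib_left[symmetric] by (simp only: algebra_simps)
qed

lemma gauss_has_derivative:
  assumes "0 < \<tau>"
  shows "((\<lambda>\<tau>. gauss \<kappa> x \<tau> y) has_real_derivative gauss_dt \<kappa> x \<tau> y) (at \<tau>)"
proof -
  define a where "a = 1 / (8 * pi\<^sup>2 * \<kappa>)"
  define b where "b = real CARD('a) / 2"
  show ?thesis unfolding gauss_dt_def gauss_def a_def[symmetric] b_def[symmetric] using assms
    by (auto intro!: derivative_eq_intros simp: field_simps power2_eq_square)
qed

lemma periodic_gap_continuous_compose [continuous_intros]:
  "continuous_on S h \<Longrightarrow> continuous_on S (\<lambda>z. periodic_gap x (h z))"
  by (rule continuous_on_compose2[OF C1_continuous[OF C1_periodic_gap(1)]]) auto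

lemma gauss_continuous_compose:
  assumes "continuous_on S f" "continuous_on S h" "\<And>z. z \<in> S \<Longrightarrow> 0 < f z"
  shows "continuous_on S (\<lambda>z. gauss \<kappa> x (f z) (h z))" "continuous_on S (\<lambda>z. gauss_dt \<kappa> x (f z) (h z))"
proof -
  have nz: "\<forall>z\<in>S. f z \<noteq> 0" using assms(3) by force
  define a where "a = 1 / (8 * pi\<^sup>2 * \<kappa>)"
  have 1: "continuous_on S (\<lambda>z. gauss \<kappa> x (f z) (h z))"
    unfolding gauss_def a_def[symmetric] using nz by (intro continuous_intros assms) auto
  then show "continuous_on S (\<lambda>z. gauss \<kappa> x (f z) (h z))" .
  show "continuous_on S (\<lambda>z. gauss_dt \<kappa> x (f z) (h z))"
    unfolding gauss_dt_def a_def[symmetric] using nz by (intro continuous_intros assms 1) auto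
qed

lemma gauss_continuous: "continuous_on UNIV (gauss \<kappa> x \<tau>)"
  by (rule C1_continuous[OF gauss_C1(1)])

lemma sqrt_mult_exp_le: "0 \<le> r \<Longrightarrow> sqrt r * exp (- r) \<le> exp (- (r / 2))"
proof -
  assume r: "0 \<le> r"
  have "r \<le> exp r" using exp_ge_add_one_self[of r] by linarith
  then have "sqrt r \<le> sqrt (exp r)" by simp
  also have "sqrt (exp r) = exp (r / 2)"
    by (rule real_sqrt_unique) (auto simp: power2_eq_square exp_add[symmetric])
  finally have "sqrt r * exp (- r) \<le> exp (r / 2) * exp (- r)" by (intro mult_right_mono) auto
  also have "\<dots> = exp (- (r / 2))" by (simp add: exp_add[symmetric])
  finally show ?thesis .
qed

text \<open>
  The gradient costs a factor of the order of \<surd>(gap/\<tau>)/\<surd>\<tau>; the first root is absorbed by doubling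
  the variance.
\<close>

lemma gauss_grad_le:
  fixes x :: "real^'n"
  assumes "0 < \<kappa>" "0 < \<tau>"
  shows "norm (grad (gauss \<kappa> x \<tau>) y) \<le> exp (real CARD('n) / 2 * ln 2) / sqrt (\<kappa> * \<tau>) * gauss \<kappa> x (2 * \<tau>) y"
proof -
  define a where "a = 1 / (8 * pi\<^sup>2 * \<kappa>)"
  define b where "b = real CARD('n) / 2"
  have a: "0 < a" using assms by (simp add: a_def)
  let ?D = "periodic_gap x y"
  have "(norm (grad (periodic_gap x) y))\<^sup>2 = (\<Sum>i\<in>UNIV. (2 * pi * sin (2 * pi * (y $ i - x $ i)))\<^sup>2)"
    unfolding power2_norm_eq_inner inner_vec_def C1_periodic_gap(2) by (simp add: power2_eq_square)
  also have "\<dots> \<le> (\<Sum>i\<in>UNIV. 8 * pi\<^sup>2 * (1 - cos (2 * pi * (y $ i - x $ i))))"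
  proof (rule sum_mono)
    fix i
    let ?c = "cos (2 * pi * (y $ i - x $ i))"
    have "0 \<le> (1 - ?c)\<^sup>2" by simp
    then have "1 - ?c\<^sup>2 \<le> 2 * (1 - ?c)" by (simp add: power2_eq_square algebra_simps)
    then have "4 * pi\<^sup>2 * (1 - ?c\<^sup>2) \<le> 4 * pi\<^sup>2 * (2 * (1 - ?c))" by (rule mult_left_mono) simp
    then show "(2 * pi * sin (2 * pi * (y $ i - x $ i)))\<^sup>2 \<le> 8 * pi\<^sup>2 * (1 - ?c)"
      by (simp add: power_mult_distrib sin_squared_eq)
  qed
  also have "\<dots> = 8 * pi\<^sup>2 * ?D" by (simp only: periodic_gap_def sum_distrib_left)
  finally have "norm (grad (periodic_gap x) y) \<le> sqrt (8 * pi\<^sup>2 * ?D)"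
    by (rule real_le_rsqrt)
  then have "norm (grad (gauss \<kappa> x \<tau>) y) \<le> (a / \<tau> * gauss \<kappa> x \<tau> y) * sqrt (8 * pi\<^sup>2 * ?D)"
  proof -
    assume le: "norm (grad (periodic_gap x) y) \<le> sqrt (8 * pi\<^sup>2 * ?D)"
    have nn: "0 \<le> a / \<tau> * gauss \<kappa> x \<tau> y" using a assms gauss_pos[of \<kappa> x \<tau> y] by simp
    have "norm (grad (gauss \<kappa> x \<tau>) y) = (a / \<tau> * gauss \<kappa> x \<tau> y) * norm (grad (periodic_gap x) y)"
      unfolding gauss_C1(2) a_def[symmetric] norm_scaleR abs_minus_cancel abs_of_nonneg[OF nn] ..
    then show ?thesis using mult_left_mono[OF le nn] by simp
  qed
  also have "(a / \<tau> * gauss \<kappa> x \<tau> y) * sqrt (8 * pi\<^sup>2 * ?D) = (1 / sqrt (\<kappa> * \<tau>)) * (sqrt (a / \<tau> * ?D) * gauss \<kappa> x \<tau> y)"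
  proof -
    have "a / \<tau> * sqrt (8 * pi\<^sup>2 * ?D) = sqrt ((a / \<tau>)\<^sup>2 * (8 * pi\<^sup>2 * ?D))"
      using a assms by (simp add: real_sqrt_mult)
    also have "(a / \<tau>)\<^sup>2 * (8 * pi\<^sup>2 * ?D) = (1 / (\<kappa> * \<tau>)) * (a / \<tau> * ?D)"
      using assms by (simp add: a_def field_simps power2_eq_square)
    also have "sqrt \<dots> = (1 / sqrt (\<kappa> * \<tau>)) * sqrt (a / \<tau> * ?D)"
      by (simp add: real_sqrt_mult real_sqrt_divide)
    finally have eq: "a / \<tau> * sqrt (8 * pi\<^sup>2 * ?D) = (1 / sqrt (\<kappa> * \<tau>)) * sqrt (a / \<tau> * ?D)" .
    have "(a / \<tau> * gauss \<kappa> x \<tau> y) * sqrt (8 * pi\<^sup>2 * ?D) = (a / \<tau> * sqrt (8 * pi\<^sup>2 * ?D)) * gauss \<kappa> x \<tau> y"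
      by (simp only: mult_ac)
    then show ?thesis unfolding eq by (simp only: mult_ac)
  qed
  also have "gauss \<kappa> x \<tau> y = exp (- b * ln \<tau>) * exp (- (a / \<tau> * ?D))"
    by (simp add: gauss_def a_def b_def exp_add[symmetric])
  also have "1 / sqrt (\<kappa> * \<tau>) * (sqrt (a / \<tau> * ?D) * (exp (- b * ln \<tau>) * exp (- (a / \<tau> * ?D))))
     = (1 / sqrt (\<kappa> * \<tau>) * exp (- b * ln \<tau>)) * (sqrt (a / \<tau> * ?D) * exp (- (a / \<tau> * ?D)))" by simp
  also have "\<dots> \<le> (1 / sqrt (\<kappa> * \<tau>) * exp (- b * ln \<tau>)) * exp (- ((a / \<tau> * ?D) / 2))"
    using a assms by (intro mult_left_mono sqrt_mult_exp_le) (auto intro!: mult_nonneg_nonneg divide_nonneg_pos periodic_gap_nonneg)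
  also have "\<dots> = exp (b * ln 2) / sqrt (\<kappa> * \<tau>) * gauss \<kappa> x (2 * \<tau>) y"
  proof -
    have "gauss \<kappa> x (2 * \<tau>) y = exp (- b * ln 2) * (exp (- b * ln \<tau>) * exp (- ((a / \<tau> * ?D) / 2)))"
      using assms unfolding exp_add[symmetric]
      by (simp add: gauss_def a_def b_def ln_mult algebra_simps)
    then show ?thesis by (simp add: exp_minus)
  qed
  finally show ?thesis by (simp only: b_def)
qed

lemma gauss_le_one: "1 \<le> \<tau> \<Longrightarrow> 0 < \<kappa> \<Longrightarrow> gauss \<kappa> x \<tau> y \<le> 1" for x :: "real^'a"
proof -
  assume "1 \<le> \<tau>" "0 < \<kappa>"
  then have "0 \<le> real CARD('a) / 2 * ln \<tau>" "0 \<le> 1 / (8 * pi\<^sup>2 * \<kappa>) / \<tau> * periodic_gap x y"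
    by (intro mult_nonneg_nonneg periodic_gap_nonneg; simp)+
  then show ?thesis unfolding gauss_def exp_le_one_iff by linarith
qed

text \<open>
  Integrating the supersolution property shows that the mass, up to an exponential factor, increases
  with \<tau>.  It is therefore bounded by its value at \<tau> = 2, and no Gaussian integral is computed.
\<close>

lemma gauss_mass_le:
  fixes x :: "real^'n"
  assumes \<kappa>: "0 < \<kappa>" and \<tau>: "0 < \<tau>" "\<tau> \<le> 2"
  shows "cell_integral (gauss \<kappa> x \<tau>) \<le> exp (2 * (real CARD('n) * pi\<^sup>2 * \<kappa>))"
proof -
  define \<Gamma> where "\<Gamma> = real CARD('n) * pi\<^sup>2 * \<kappa>"
  let ?N = "\<lambda>\<tau>. cell_integral (gauss \<kappa> x \<tau>)"
  have \<Gamma>: "0 \<le> \<Gamma>" using \<kappa> by (simp add: \<Gamma>_def)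
  have N0: "0 \<le> ?N s" for s
    by (rule cell_integral_nonneg[OF gauss_continuous less_imp_le[OF gauss_pos]])
  have d: "(?N has_real_derivative cell_integral (gauss_dt \<kappa> x s)) (at s)" if s: "s \<in> {0<..<3}" for s
  proof (rule cell_integral_has_derivative[OF _ _ _ s])
    show "continuous_on ({0<..<3} \<times> UNIV) (\<lambda>(s, y). gauss_dt \<kappa> x s y)"
      unfolding split_beta by (intro gauss_continuous_compose continuous_intros) auto
  qed (auto intro: gauss_has_derivative gauss_continuous)
  have "exp (\<Gamma> * \<tau>) * ?N \<tau> \<le> exp (\<Gamma> * 2) * ?N 2"
  proof (rule DERIV_nonneg_imp_nondecreasing[of _ _ "\<lambda>s. exp (\<Gamma> * s) * ?N s", OF \<tau>(2)])
    fix s assume "\<tau> \<le> s" "s \<le> 2"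
    then have s: "s \<in> {0<..<3}" "0 < s" using \<tau> by auto
    have cdt: "continuous_on UNIV (gauss_dt \<kappa> x s)"
      using gauss_continuous_compose(2)[of UNIV "\<lambda>_. s" "\<lambda>y. y"] s by (auto intro: continuous_intros)
    have clap: "continuous_on UNIV (\<lambda>y. divergence (grad (gauss \<kappa> x s)) y)"
      by (intro C1_components_continuous C2_C1_grad_nth gauss_C2)
    have "cell_integral (\<lambda>y. 1 * divergence (grad (gauss \<kappa> x s)) y) = - cell_integral (\<lambda>y. grad (\<lambda>y::real^'n. 1) y \<bullet> grad (gauss \<kappa> x s) y)"
      by (rule cell_integral_by_parts)
        (use gauss_C2[of \<kappa> x s] in \<open>auto simp: periodic_def[of "\<lambda>_. 1"] C1_const C2_def intro!: periodic_grad gauss_periodic simp: C1_def\<close>)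
    then have "0 = \<kappa> * cell_integral (\<lambda>y. divergence (grad (gauss \<kappa> x s)) y)"
      by (simp add: grad_const)
    also have "\<dots> = cell_integral (\<lambda>y. \<kappa> * divergence (grad (gauss \<kappa> x s)) y)" by simp
    also have "\<dots> \<le> cell_integral (\<lambda>y. gauss_dt \<kappa> x s y + \<Gamma> * gauss \<kappa> x s y)"
      using gauss_supersolution[OF \<kappa> s(2), of x] unfolding laplacian_eq_divergence \<Gamma>_def
      by (intro cell_integral_mono continuous_intros clap cdt gauss_continuous) auto
    also have "\<dots> = cell_integral (gauss_dt \<kappa> x s) + \<Gamma> * ?N s"
      by (subst cell_integral_add) (auto intro!: continuous_intros cdt gauss_continuous)
    finally have "0 \<le> exp (\<Gamma> * s) * (cell_integral (gauss_dt \<kappa> x s) + \<Gamma> * ?N s)" by simp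
    moreover have "((\<lambda>s. exp (\<Gamma> * s) * ?N s) has_real_derivative exp (\<Gamma> * s) * (cell_integral (gauss_dt \<kappa> x s) + \<Gamma> * ?N s)) (at s)"
      by (auto intro!: derivative_eq_intros d[OF s(1)] simp: algebra_simps)
    ultimately show "\<exists>y. ((\<lambda>s. exp (\<Gamma> * s) * ?N s) has_real_derivative y) (at s) \<and> 0 \<le> y" by blast
  qed
  also have "?N 2 \<le> cell_integral (\<lambda>y::real^'n. 1)"
    by (intro cell_integral_mono gauss_continuous continuous_intros gauss_le_one \<kappa>) auto
  then have "exp (\<Gamma> * 2) * ?N 2 \<le> exp (2 * \<Gamma>)" by (simp add: mult.commute)
  finally have "exp (\<Gamma> * \<tau>) * ?N \<tau> \<le> exp (2 * \<Gamma>)" .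
  moreover have "1 * ?N \<tau> \<le> exp (\<Gamma> * \<tau>) * ?N \<tau>"
    using \<Gamma> \<tau> N0 by (intro mult_right_mono) auto
  ultimately show ?thesis by (simp add: \<Gamma>_def)
qed

lemma gauss_ge:
  fixes x :: "real^'n"
  assumes \<kappa>: "0 < \<kappa>" and \<tau>: "0 < \<tau>" and y: "\<And>i. \<bar>y $ i - x $ i\<bar> \<le> sqrt \<tau>"
  shows "exp (- (real CARD('n) / (4 * \<kappa>))) / sqrt \<tau> ^ CARD('n) \<le> gauss \<kappa> x \<tau> y"
proof -
  have "periodic_gap x y \<le> (\<Sum>i\<in>(UNIV::'n set). 2 * pi\<^sup>2 * \<tau>)"
    unfolding periodic_gap_def
  proof (rule sum_mono)
    fix i
    let ?\<theta> = "pi * (y $ i - x $ i)"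
    have "1 - cos (2 * ?\<theta>) = 2 * (sin ?\<theta>)\<^sup>2" by (simp add: cos_double_sin)
    also have "(sin ?\<theta>)\<^sup>2 \<le> ?\<theta>\<^sup>2" using abs_sin_x_le_abs_x[of ?\<theta>] by (simp add: abs_le_square_iff)
    also have "?\<theta>\<^sup>2 \<le> pi\<^sup>2 * \<tau>"
      using power_mono[OF y[of i], of 2] \<tau> by (simp add: power_mult_distrib mult_left_mono)
    finally show "1 - cos (2 * pi * (y $ i - x $ i)) \<le> 2 * pi\<^sup>2 * \<tau>" by (simp add: mult.assoc)
  qed
  then have "1 / (8 * pi\<^sup>2 * \<kappa>) / \<tau> * periodic_gap x y \<le> 1 / (8 * pi\<^sup>2 * \<kappa>) / \<tau> * (real CARD('n) * (2 * pi\<^sup>2 * \<tau>))"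
    using \<kappa> \<tau> by (intro mult_left_mono) auto
  also have "\<dots> = real CARD('n) / (4 * \<kappa>)" using \<kappa> \<tau> by (simp add: field_simps)
  finally have "exp (- (real CARD('n) / 2) * ln \<tau> - real CARD('n) / (4 * \<kappa>)) \<le> gauss \<kappa> x \<tau> y"
    unfolding gauss_def by simp
  moreover have "exp (- (real CARD('n) / 2) * ln \<tau>) = 1 / sqrt \<tau> ^ CARD('n)"
  proof -
    have "sqrt \<tau> ^ CARD('n) = exp (real CARD('n) * ln (sqrt \<tau>))"
      using \<tau> by (simp add: exp_of_nat_mult)
    then show ?thesis using \<tau> by (simp add: ln_sqrt exp_minus inverse_eq_divide)
  qed
  ultimately show ?thesis by (simp add: exp_diff exp_minus inverse_eq_divide mult.commute)
qed

section \<open>A lower bound for densities\<close>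

context bounded_drift_density
begin

text \<open>
  Test with the kernel whose pole is the point (t0 + 2, x).  On the last unit of time before the
  pole, the weighted integral Q grows at most by a factor and a constant, since the singularity
  1/\<surd>(t1 - t) contributed by the gradient of the kernel is integrable.  At the start Q is
  bounded by the unweighted integral; near the pole Q dominates a fixed fraction of the value at
  the pole.
\<close>

lemma log_pointwise_bound:
  assumes \<epsilon>: "0 < \<epsilon>" "\<epsilon> \<le> 1" and t0: "0 \<le> t0" "t0 + 2 < T" and x: "x \<in> box 0 1"
  defines "\<Gamma> \<equiv> real CARD('n) * pi\<^sup>2 * \<kappa>"
  defines "A \<equiv> L * (exp (real CARD('n) / 2 * ln 2) * exp (2 * \<Gamma>)) / sqrt \<kappa>"
  defines "B \<equiv> L\<^sup>2 / (2 * \<kappa>) * exp (2 * \<Gamma>)"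
  shows "log_deficit \<epsilon> (t0 + 2) x \<le> exp (real CARD('n) / (4 * \<kappa>)) *
    (exp \<Gamma> * (L\<^sup>2 / (2 * \<kappa>) + 2 * (M + 1) + 2 * real CARD('n) * M\<^sup>2 / \<kappa> + 2 * (A + B)))"
    (is "_ \<le> _ * ?Q")
proof -
  define t1 where "t1 = t0 + 2"
  note k = kappa_pos
  have AB: "0 \<le> A" "0 \<le> B" using k L_nonneg by (auto simp: A_def B_def)
  have \<Gamma>: "0 \<le> \<Gamma>" using k by (simp add: \<Gamma>_def)
  let ?l = "log_deficit \<epsilon>"
  let ?\<eta> = "\<lambda>t. gauss \<kappa> x (t1 - t)"
  let ?Q = "\<lambda>t. cell_integral (\<lambda>y. ?\<eta> t y * ?l t y)"
  have cl: "continuous_on UNIV (?l t)" if "t \<in> {0..T}" for t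
    by (rule log_deficit_continuous_compose[OF continuous_on_const continuous_on_id _ \<epsilon>(1)]) (use that in auto)
  have Q0: "0 \<le> ?Q t" if "t \<in> {0..T}" for t
    by (intro cell_integral_nonneg continuous_intros gauss_continuous cl that mult_nonneg_nonneg log_deficit_nonneg \<epsilon> less_imp_le[OF gauss_pos])
  have deriv: "\<exists>D. (?Q has_real_derivative D) (at t) \<and> D \<le> \<Gamma> * ?Q t + (A + B) / sqrt (t1 - t)"
    if t: "t0 + 1 \<le> t" "t < t1" for t
  proof -
    define \<tau> where "\<tau> = t1 - t"
    have \<tau>: "0 < \<tau>" "\<tau> \<le> 1" using t by (auto simp: \<tau>_def t1_def)
    have tt: "t \<in> {0<..<t1}" "t \<in> {0..T}" using t t0 by (auto simp: t1_def)
    have "\<exists>D. (?Q has_real_derivative D) (at t) \<and>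
    D \<le> cell_integral (\<lambda>y. (- gauss_dt \<kappa> x (t1 - t) y + \<kappa> * laplacian (?\<eta> t) y) * ?l t y)
      + L * cell_integral (\<lambda>y. norm (grad (?\<eta> t) y))
      - \<kappa> / 2 * cell_integral (\<lambda>y. ?\<eta> t y * (norm (grad (?l t) y))\<^sup>2)
      + L\<^sup>2 / (2 * \<kappa>) * cell_integral (?\<eta> t)"
    proof (rule weighted_log_dissipation[OF _ tt(1) \<epsilon>(1)])
      show "((\<lambda>s. gauss \<kappa> x (t1 - s) y) has_real_derivative - gauss_dt \<kappa> x (t1 - s) y) (at s)"
        if "s \<in> {0<..<t1}" for s y
      proof -
        have "((\<lambda>s. t1 - s) has_real_derivative - 1) (at s)" by (auto intro!: derivative_eq_intros)
        from DERIV_chain2[where f="\<lambda>\<tau>. gauss \<kappa> x \<tau> y" and g="\<lambda>s. t1 - s", OF gauss_has_derivative this] that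
        show ?thesis by simp
      qed
      show "continuous_on ({0<..<t1} \<times> UNIV) (\<lambda>(s, y). gauss \<kappa> x (t1 - s) y)"
        unfolding split_beta by (intro gauss_continuous_compose continuous_intros) auto
      show "continuous_on ({0<..<t1} \<times> UNIV) (\<lambda>(s, y). - gauss_dt \<kappa> x (t1 - s) y)"
        unfolding split_beta by (intro gauss_continuous_compose continuous_intros) auto
    qed (use t0 in \<open>auto simp: t1_def intro: gauss_periodic gauss_C2 less_imp_le[OF gauss_pos]\<close>)
    then obtain D where D: "(?Q has_real_derivative D) (at t)"
      "D \<le> cell_integral (\<lambda>y. (- gauss_dt \<kappa> x (t1 - t) y + \<kappa> * laplacian (?\<eta> t) y) * ?l t y)
      + L * cell_integral (\<lambda>y. norm (grad (?\<eta> t) y))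
      - \<kappa> / 2 * cell_integral (\<lambda>y. ?\<eta> t y * (norm (grad (?l t) y))\<^sup>2)
      + L\<^sup>2 / (2 * \<kappa>) * cell_integral (?\<eta> t)" by blast
    note cg = C1_continuous_grad[OF gauss_C1(1)]
    have clap: "continuous_on UNIV (laplacian (gauss \<kappa> x s))" for s
      by (rule laplacian_continuous[OF gauss_C2])
    have cdt: "continuous_on UNIV (gauss_dt \<kappa> x (t1 - t))"
      using gauss_continuous_compose(2)[of UNIV "\<lambda>_. t1 - t" "\<lambda>y. y"] t by (auto intro: continuous_intros)
    have 1: "cell_integral (\<lambda>y. (- gauss_dt \<kappa> x (t1 - t) y + \<kappa> * laplacian (?\<eta> t) y) * ?l t y)
      \<le> cell_integral (\<lambda>y. \<Gamma> * (?\<eta> t y * ?l t y))"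
    proof (rule cell_integral_mono)
      fix y
      have "- gauss_dt \<kappa> x (t1 - t) y + \<kappa> * laplacian (?\<eta> t) y \<le> \<Gamma> * ?\<eta> t y"
        using gauss_supersolution[OF k \<tau>(1), of x y] unfolding \<tau>_def \<Gamma>_def by linarith
      from mult_right_mono[OF this log_deficit_nonneg[OF tt(2) \<epsilon>, of y]]
      show "(- gauss_dt \<kappa> x (t1 - t) y + \<kappa> * laplacian (?\<eta> t) y) * ?l t y \<le> \<Gamma> * (?\<eta> t y * ?l t y)"
        by (simp only: mult.assoc)
    qed (intro continuous_intros clap cdt cl tt gauss_continuous)+
    have mass: "cell_integral (gauss \<kappa> x s) \<le> exp (2 * \<Gamma>)" if "0 < s" "s \<le> 2" for s
      unfolding \<Gamma>_def by (rule gauss_mass_le[OF k that])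
    define c where "c = exp (real CARD('n) / 2 * ln 2) / sqrt (\<kappa> * \<tau>)"
    have c0: "0 \<le> c" using k \<tau> by (simp add: c_def)
    have "cell_integral (\<lambda>y. norm (grad (?\<eta> t) y)) \<le> cell_integral (\<lambda>y. c * gauss \<kappa> x (2 * \<tau>) y)"
      using gauss_grad_le[OF k \<tau>(1), of x] unfolding \<tau>_def c_def
      by (intro cell_integral_mono continuous_intros cg gauss_continuous) auto
    also have "\<dots> = c * cell_integral (gauss \<kappa> x (2 * \<tau>))" by simp
    also have "\<dots> \<le> c * exp (2 * \<Gamma>)" using c0 \<tau> by (intro mult_left_mono mass) auto
    finally have "L * cell_integral (\<lambda>y. norm (grad (?\<eta> t) y)) \<le> L * (c * exp (2 * \<Gamma>))"
      using L_nonneg by (rule mult_left_mono)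
    also have "\<dots> = A / sqrt \<tau>" using k \<tau> by (simp add: A_def c_def real_sqrt_mult)
    finally have 2: "L * cell_integral (\<lambda>y. norm (grad (?\<eta> t) y)) \<le> A / sqrt \<tau>" .
    have 3: "0 \<le> \<kappa> / 2 * cell_integral (\<lambda>y. ?\<eta> t y * (norm (grad (?l t) y))\<^sup>2)"
      using k t t0
      by (intro mult_nonneg_nonneg cell_integral_nonneg continuous_intros gauss_continuous less_imp_le[OF gauss_pos]
          C1_continuous_grad log_deficit_C1(1) \<epsilon>) (auto simp: t1_def)
    have "L\<^sup>2 / (2 * \<kappa>) * cell_integral (?\<eta> t) \<le> B"
      unfolding B_def using \<tau> k by (intro mult_left_mono mass) (auto simp: \<tau>_def)
    also have "B \<le> B / sqrt \<tau>" using \<tau> AB by (simp add: pos_le_divide_eq mult_left_le)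
    finally have 4: "L\<^sup>2 / (2 * \<kappa>) * cell_integral (?\<eta> t) \<le> B / sqrt \<tau>" .
    have "D \<le> \<Gamma> * ?Q t + (A + B) / sqrt \<tau>"
      using D(2) 1 2 3 4 by (simp add: add_divide_distrib)
    then show ?thesis using D(1) by (auto simp: \<tau>_def)
  qed
  define Qs where "Qs = exp \<Gamma> * (L\<^sup>2 / (2 * \<kappa>) + 2 * (M + 1) + 2 * real CARD('n) * M\<^sup>2 / \<kappa> + 2 * (A + B))"
  have Q_le: "?Q t \<le> Qs" if t: "t0 + 1 \<le> t" "t < t1" for t
  proof -
    \<comment> \<open>The root compensates the integrable singularity: its derivative is -1/(2\<surd>(t1 - t)).\<close>
    let ?Z = "\<lambda>t. exp (- \<Gamma> * (t - (t0 + 1))) * ?Q t + 2 * (A + B) * sqrt (t1 - t)"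
    have "?Z t \<le> ?Z (t0 + 1)"
    proof (rule DERIV_nonpos_imp_nonincreasing[where f="?Z", OF t(1)])
      fix s assume s: "t0 + 1 \<le> s" "s \<le> t"
      then have s1: "s < t1" using t by simp
      obtain D where D: "(?Q has_real_derivative D) (at s)" "D \<le> \<Gamma> * ?Q s + (A + B) / sqrt (t1 - s)"
        using deriv[OF s(1) s1] by blast
      define e where "e = exp (- \<Gamma> * (s - (t0 + 1)))"
      have e: "0 < e" "e \<le> 1" using \<Gamma> s by (auto simp: e_def)
      have "(?Z has_real_derivative e * (D - \<Gamma> * ?Q s) - (A + B) / sqrt (t1 - s)) (at s)"
      proof -
        have d1: "((\<lambda>t. exp (- \<Gamma> * (t - (t0 + 1)))) has_real_derivative - \<Gamma> * e) (at s)"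
          unfolding e_def by (auto intro!: derivative_eq_intros)
        have d2: "((\<lambda>t. sqrt (t1 - t)) has_real_derivative - (1 / (2 * sqrt (t1 - s)))) (at s)"
          using s1 by (auto intro!: derivative_eq_intros simp: divide_simps)
        show ?thesis
          by (rule DERIV_cong[OF DERIV_add[OF DERIV_mult[OF d1 D(1)] DERIV_cmult[OF d2, of "2 * (A + B)"]]])
            (unfold e_def[symmetric], simp add: algebra_simps add_divide_distrib)
      qed
      moreover have "e * (D - \<Gamma> * ?Q s) \<le> e * ((A + B) / sqrt (t1 - s))"
        using D(2) e by (intro mult_left_mono) auto
      moreover have "e * ((A + B) / sqrt (t1 - s)) \<le> 1 * ((A + B) / sqrt (t1 - s))"
        using e AB s1 by (intro mult_right_mono) auto
      ultimately show "\<exists>y. (?Z has_real_derivative y) (at s) \<and> y \<le> 0" by fastforce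
    qed
    also have "?Z (t0 + 1) = ?Q (t0 + 1) + 2 * (A + B)" by (simp add: t1_def)
    also have "?Q (t0 + 1) \<le> cell_integral (?l (t0 + 1))"
    proof (rule cell_integral_mono)
      fix y
      show "?\<eta> (t0 + 1) y * ?l (t0 + 1) y \<le> ?l (t0 + 1) y"
        using mult_right_mono[OF gauss_le_one[of 1 \<kappa> x y] log_deficit_nonneg[of "t0 + 1" \<epsilon> y]] k \<epsilon> t0
        by (simp add: t1_def)
    qed (use t0 in \<open>auto intro!: continuous_intros cl gauss_continuous\<close>)
    also have "\<dots> \<le> L\<^sup>2 / (2 * \<kappa>) + 2 * (M + 1) + 2 * real CARD('n) * M\<^sup>2 / \<kappa>"
      using t0 by (intro log_integral_bound \<epsilon>) auto
    finally have "exp (- \<Gamma> * (t - (t0 + 1))) * ?Q t + 2 * (A + B) * sqrt (t1 - t)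
       \<le> L\<^sup>2 / (2 * \<kappa>) + 2 * (M + 1) + 2 * real CARD('n) * M\<^sup>2 / \<kappa> + 2 * (A + B)" by simp
    moreover have "0 \<le> 2 * (A + B) * sqrt (t1 - t)" using AB t by simp
    moreover have "exp (- \<Gamma>) * ?Q t \<le> exp (- \<Gamma> * (t - (t0 + 1))) * ?Q t"
    proof (rule mult_right_mono)
      have "\<Gamma> * (t - (t0 + 1)) \<le> \<Gamma> * 1" using \<Gamma> t by (intro mult_left_mono) (auto simp: t1_def)
      then show "exp (- \<Gamma>) \<le> exp (- \<Gamma> * (t - (t0 + 1)))" by simp
      show "0 \<le> ?Q t" using t t0 by (intro Q0) (auto simp: t1_def)
    qed
    ultimately have "exp (- \<Gamma>) * ?Q t \<le> L\<^sup>2 / (2 * \<kappa>) + 2 * (M + 1) + 2 * real CARD('n) * M\<^sup>2 / \<kappa> + 2 * (A + B)"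
      by linarith
    then have "exp \<Gamma> * (exp (- \<Gamma>) * ?Q t) \<le> Qs" unfolding Qs_def by (rule mult_left_mono) simp
    then show ?thesis by (simp add: mult.assoc[symmetric] exp_add[symmetric])
  qed
  define c1 where "c1 = exp (- (real CARD('n) / (4 * \<kappa>)))"
  have c1: "0 < c1" by (simp add: c1_def)
  have "c1 * ?l t1 x \<le> Qs"
  proof (rule ccontr)
    assume "\<not> c1 * ?l t1 x \<le> Qs"
    then have "Qs / c1 < ?l t1 x" using c1 by (simp add: field_simps)
    \<comment> \<open>A level strictly below the value at the pole survives on a neighbourhood of the pole.  On a cube of
      side r = \<surd>(t1 - t) the kernel is at least c1/r^n, which the volume of the cube compensates.\<close>
    then obtain level where level: "Qs / c1 < level" "level < ?l t1 x" using dense by blast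
    have "0 \<le> Qs" using Q0[of "t0 + 1"] Q_le[of "t0 + 1"] t0 by (simp add: t1_def)
    then have level0: "0 \<le> level" using level(1) c1 by (smt (verit) divide_nonneg_pos)
    have "continuous_on ({0..T} \<times> UNIV) (\<lambda>z. ?l (fst z) (snd z))"
      by (rule log_deficit_continuous_compose[OF _ _ _ \<epsilon>(1)]) (auto intro: continuous_intros)
    moreover have "(t1, x) \<in> {0..T} \<times> UNIV" using t0 by (auto simp: t1_def)
    ultimately obtain \<delta> where \<delta>: "0 < \<delta>" "\<And>t y. t \<in> {0..T} \<Longrightarrow> dist (t, y) (t1, x) < \<delta> \<Longrightarrow> dist (?l t y) (?l t1 x) < ?l t1 x - level"
      unfolding continuous_on_iff using level(2) by (metis SigmaI UNIV_I diff_gt_0_iff_gt fst_conv snd_conv)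
    obtain \<delta>' where \<delta>': "0 < \<delta>'" "ball x \<delta>' \<subseteq> box 0 1"
      using open_box[of "0::real^'n" 1] x by (meson open_contains_ball)
    define n where "n = real CARD('n)"
    have n: "1 \<le> n" using finite_UNIV_card_ge_0[where ?'a='n] by (simp add: n_def Suc_leI)
    define r where "r = min (1 / 2) (min \<delta> \<delta>' / (2 * (n + 1)))"
    have "r \<le> 1 / 2" "r \<le> min \<delta> \<delta>' / (2 * (n + 1))" unfolding r_def by (rule min.cobounded1 min.cobounded2)+
    moreover have "0 < r" using \<delta> \<delta>' n by (simp add: r_def)
    ultimately have r: "0 < r" "r \<le> 1 / 2" and "r * (2 * (n + 1)) \<le> min \<delta> \<delta>'"
      using n by (simp_all add: pos_le_divide_eq)
    moreover have "r * (n + 1) < r * (2 * (n + 1))" using r n by simp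
    ultimately have rd: "r * (n + 1) < \<delta>" "r * (n + 1) < \<delta>'" by linarith+
    define t where "t = t1 - r\<^sup>2"
    have "r\<^sup>2 \<le> r * 1" unfolding power2_eq_square using r by (intro mult_left_mono) auto
    moreover have "0 < r\<^sup>2" using r by simp
    ultimately have t: "t0 + 1 \<le> t" "t < t1" "t \<in> {0..T}" "t1 - t \<le> r"
      using r t0 unfolding t_def t1_def atLeastAtMost_iff by linarith+
    let ?S = "cbox x (x + r *\<^sub>R 1)"
    have near: "\<bar>y $ i - x $ i\<bar> \<le> r" if "y \<in> ?S" for y i
      using that by (auto simp: mem_box_cart abs_le_iff) (smt (verit))+
    have norm: "norm (y - x) \<le> n * r" if "y \<in> ?S" for y
    proof -
      have "norm (y - x) \<le> (\<Sum>i\<in>UNIV. \<bar>(y - x) $ i\<bar>)" by (rule norm_le_l1_cart)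
      also have "\<dots> \<le> (\<Sum>i\<in>(UNIV::'n set). r)" using near[OF that] by (intro sum_mono) simp
      finally show ?thesis by (simp add: n_def)
    qed
    have S: "?S \<subseteq> cbox 0 1"
    proof
      fix y assume y: "y \<in> ?S"
      have "dist x y < \<delta>'" using norm[OF y] rd(2) r by (simp add: dist_norm norm_minus_commute algebra_simps)
      then show "y \<in> cbox 0 1" using \<delta>'(2) box_subset_cbox[of "0::real^'n" 1] by (auto simp: subset_iff)
    qed
    have low: "c1 / r ^ CARD('n) * level \<le> ?\<eta> t y * ?l t y" if y: "y \<in> ?S" for y
    proof (rule mult_mono)
      show "c1 / r ^ CARD('n) \<le> ?\<eta> t y"
        using gauss_ge[OF k, of "r\<^sup>2" y x] near[OF y] r by (simp add: t_def c1_def)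
      have "dist (t, y) (t1, x) \<le> dist t t1 + dist y x"
        unfolding dist_prod_def by (simp add: sqrt_sum_squares_le_sum)
      also have "\<dots> \<le> r + n * r" using t(2,4) norm[OF y] by (simp add: dist_norm)
      also have "\<dots> < \<delta>" using rd(1) by (simp add: algebra_simps)
      finally have "dist (?l t y) (?l t1 x) < ?l t1 x - level" by (rule \<delta>(2)[OF t(3)])
      then show "level \<le> ?l t y" by (simp add: dist_real_def)
    qed (use gauss_pos[of \<kappa> x "t1 - t" y] level0 in auto)
    have cont: "continuous_on UNIV (\<lambda>y. ?\<eta> t y * ?l t y)"
      by (intro continuous_intros gauss_continuous cl t)
    have "measure lborel ?S = (\<Prod>i\<in>(UNIV::'n set). r)"
      using r by (subst content_cbox_cart) (auto simp: interval_ne_empty_cart)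
    then have "measure lborel ?S = r ^ CARD('n)" by simp
    then have "c1 * level = integral ?S (\<lambda>y. c1 / r ^ CARD('n) * level)" using r by simp
    also have "\<dots> \<le> integral ?S (\<lambda>y. ?\<eta> t y * ?l t y)"
      by (intro integral_le low integrable_continuous continuous_on_subset[OF cont] continuous_on_const) auto
    also have "\<dots> \<le> ?Q t"
      by (intro integral_subset_le S integrable_continuous continuous_on_subset[OF cont]
          ballI mult_nonneg_nonneg less_imp_le[OF gauss_pos] log_deficit_nonneg[OF t(3) \<epsilon>]) auto
    also have "\<dots> \<le> Qs" by (rule Q_le[OF t(1,2)])
    finally show False using level(1) c1 by (simp add: field_simps)
  qed
  then have "exp (real CARD('n) / (4 * \<kappa>)) * (c1 * ?l t1 x) \<le> exp (real CARD('n) / (4 * \<kappa>)) * Qs"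
    by (rule mult_left_mono) simp
  then show ?thesis by (simp add: c1_def t1_def Qs_def mult.assoc[symmetric] exp_add[symmetric])
qed

end

text \<open>
  The bound for the deficit is uniform in \<epsilon>, so the shift can be removed.
\<close>

lemma density_lower_bound:
  fixes \<kappa> M L :: real
  assumes M: "0 \<le> M"
  obtains c where "0 < c"
    "\<And>T (m :: real \<Rightarrow> real^'n \<Rightarrow> real) V t x. bounded_drift_density \<kappa> T m V M L \<Longrightarrow> 2 \<le> t \<Longrightarrow> t < T \<Longrightarrow> c \<le> m t x"
proof -
  define \<Gamma> where "\<Gamma> = real CARD('n) * pi\<^sup>2 * \<kappa>"
  define A where "A = L * (exp (real CARD('n) / 2 * ln 2) * exp (2 * \<Gamma>)) / sqrt \<kappa>"
  define B where "B = L\<^sup>2 / (2 * \<kappa>) * exp (2 * \<Gamma>)"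
  define \<Lambda> where "\<Lambda> = exp (real CARD('n) / (4 * \<kappa>)) *
    (exp \<Gamma> * (L\<^sup>2 / (2 * \<kappa>) + 2 * (M + 1) + 2 * real CARD('n) * M\<^sup>2 / \<kappa> + 2 * (A + B)))"
  define c where "c = (M + 1) * exp (- \<Lambda>)"
  show ?thesis
  proof
    show "0 < c" using M by (simp add: c_def)
    fix T and m :: "real \<Rightarrow> real^'n \<Rightarrow> real" and V t and x :: "real^'n"
    assume "bounded_drift_density \<kappa> T m V M L" and t: "2 \<le> t" "t < T"
    then interpret bounded_drift_density \<kappa> T m V M L by blast
    have tc: "t \<in> {0..T}" "t \<in> {0<..<T}" using t by auto
    have cell: "c \<le> m t y" if y: "y \<in> box 0 1" for y
    proof (rule field_le_epsilon)
      fix e :: real assume "0 < e"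
      define \<epsilon> where "\<epsilon> = min e 1"
      have \<epsilon>: "0 < \<epsilon>" "\<epsilon> \<le> 1" "\<epsilon> \<le> e" using \<open>0 < e\<close> by (auto simp: \<epsilon>_def)
      have pos: "0 < m t y + \<epsilon>" using density_nonneg[OF tc(1), of y] \<epsilon> by simp
      have "log_deficit \<epsilon> (t - 2 + 2) y \<le> \<Lambda>"
        unfolding \<Lambda>_def A_def B_def \<Gamma>_def by (rule log_pointwise_bound) (use \<epsilon> t y in auto)
      then have "ln (M + 1) - \<Lambda> \<le> ln (m t y + \<epsilon>)" by (simp add: log_deficit_def)
      then have "exp (ln (M + 1) - \<Lambda>) \<le> m t y + \<epsilon>" using pos by (simp add: ln_ge_iff)
      then show "c \<le> m t y + e" using M \<epsilon> by (simp add: c_def exp_diff exp_minus divide_inverse)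
    qed
    then show "c \<le> m t x"
      by (rule cell_le_everywhere[where f="\<lambda>_. c"])
        (use C1_continuous[OF density_C1[OF tc(2)]] density_periodic[OF tc(1)] in \<open>auto simp: periodic_def\<close>)
  qed
qed

section \<open>Comparison of two densities\<close>

text \<open>
  Here d is the gradient of the ratio (m1 - m2)/\<sigma>.  Since 4 m1 m2 \<le> (m1 + m2)^2, the difference of
  the drifts enters with the weight m1 + m2 only; the terms created by the shift \<epsilon> are of order \<epsilon>.
\<close>

lemma triangular_dissipation_pointwise:
  fixes d v1 v2 :: "'a::real_inner" and \<kappa> \<beta> L \<epsilon> m1 m2 g :: real
  assumes \<kappa>: "0 < \<kappa>" and \<epsilon>: "0 < \<epsilon>" and m: "0 \<le> m1" "0 \<le> m2" and L: "0 \<le> L" and \<beta>: "0 \<le> \<beta>" and g: "0 \<le> g"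
    and v: "norm v1 \<le> L * m1" "norm v2 \<le> L * m2"
    and vv: "norm (m2 *\<^sub>R v1 - m1 *\<^sub>R v2) \<le> \<beta> * (m1 * m2) * g"
  defines "\<sigma> \<equiv> m1 + m2 + \<epsilon>"
  shows "- 2 * (d \<bullet> (\<kappa> *\<^sub>R (\<sigma> *\<^sub>R d) + (1 / \<sigma>) *\<^sub>R (2 *\<^sub>R (m2 *\<^sub>R v1 - m1 *\<^sub>R v2) + \<epsilon> *\<^sub>R (v1 - v2))))
    \<le> - \<kappa> * (\<sigma> * (norm d)\<^sup>2) + \<beta>\<^sup>2 / (2 * \<kappa>) * ((m1 + m2) * g\<^sup>2) + 2 * \<epsilon> * L\<^sup>2 / \<kappa>"
proof -
  define s where "s = m1 + m2"
  have s: "0 \<le> s" using m by (simp add: s_def)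
  have \<sigma>: "0 < \<sigma>" "\<sigma> = s + \<epsilon>" using m \<epsilon> by (auto simp: \<sigma>_def s_def)
  define q e where "q = s / \<sigma>" and "e = \<epsilon> / \<sigma>"
  have q: "0 \<le> q" "q \<le> 1" and e: "0 \<le> e" "e \<le> 1" using s \<sigma> \<epsilon> by (auto simp: q_def e_def)
  define z where "z = (1 / \<sigma>) *\<^sub>R (2 *\<^sub>R (m2 *\<^sub>R v1 - m1 *\<^sub>R v2) + \<epsilon> *\<^sub>R (v1 - v2))"
  have "4 * (m1 * m2) \<le> s\<^sup>2"
    using zero_le_power2[of "m1 - m2"] by (simp add: s_def power2_eq_square algebra_simps)
  then have "\<beta> * g / 2 * (4 * (m1 * m2)) \<le> \<beta> * g / 2 * s\<^sup>2" using \<beta> g by (intro mult_left_mono) auto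
  then have mm: "2 * (\<beta> * (m1 * m2) * g) \<le> \<beta> / 2 * s\<^sup>2 * g" by (simp add: algebra_simps)
  have "norm (2 *\<^sub>R (m2 *\<^sub>R v1 - m1 *\<^sub>R v2) + \<epsilon> *\<^sub>R (v1 - v2))
      \<le> 2 * norm (m2 *\<^sub>R v1 - m1 *\<^sub>R v2) + \<epsilon> * norm (v1 - v2)"
    using \<epsilon> by (intro norm_triangle_le) simp
  also have "\<epsilon> * norm (v1 - v2) \<le> \<epsilon> * (L * s)"
    using norm_triangle_ineq4[of v1 v2] v \<epsilon> by (intro mult_left_mono) (auto simp: s_def algebra_simps)
  also have "2 * norm (m2 *\<^sub>R v1 - m1 *\<^sub>R v2) \<le> \<beta> / 2 * s\<^sup>2 * g" using vv mm by linarith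
  finally have "norm z \<le> (\<beta> / 2 * s\<^sup>2 * g + \<epsilon> * (L * s)) / \<sigma>"
    unfolding z_def using \<sigma> by (simp add: divide_right_mono)
  also have "\<dots> = \<beta> / 2 * s * q * g + \<epsilon> * L * q" using \<sigma>(1) by (simp add: q_def field_simps power2_eq_square)
  finally have "(norm z)\<^sup>2 \<le> (\<beta> / 2 * s * q * g + \<epsilon> * L * q)\<^sup>2" by (intro power_mono) auto
  also have "\<dots> \<le> 2 * (\<beta> / 2 * s * q * g)\<^sup>2 + 2 * (\<epsilon> * L * q)\<^sup>2"
    using zero_le_power2[of "\<beta> / 2 * s * q * g - \<epsilon> * L * q"] by (simp add: power2_eq_square algebra_simps)
  finally have "(norm z)\<^sup>2 / \<sigma> \<le> (2 * (\<beta> / 2 * s * q * g)\<^sup>2 + 2 * (\<epsilon> * L * q)\<^sup>2) / \<sigma>"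
    using \<sigma> by (intro divide_right_mono) auto
  also have "\<dots> = \<beta>\<^sup>2 / 2 * (s * g\<^sup>2) * q ^ 3 + 2 * \<epsilon> * L\<^sup>2 * (e * q\<^sup>2)"
    by (simp add: q_def e_def power2_eq_square power3_eq_cube add_divide_distrib mult_ac)
  also have "\<dots> \<le> \<beta>\<^sup>2 / 2 * (s * g\<^sup>2) * 1 + 2 * \<epsilon> * L\<^sup>2 * 1"
    using s q e \<epsilon> by (intro add_mono mult_left_mono) (auto intro: power_le_one mult_le_one)
  finally have z: "(norm z)\<^sup>2 / \<sigma> \<le> \<beta>\<^sup>2 / 2 * (s * g\<^sup>2) + 2 * \<epsilon> * L\<^sup>2" by simp
  have "0 \<le> (norm ((\<kappa> * \<sigma>) *\<^sub>R d + z))\<^sup>2 / (\<kappa> * \<sigma>)" using \<kappa> \<sigma> by simp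
  also have "(norm ((\<kappa> * \<sigma>) *\<^sub>R d + z))\<^sup>2 = (\<kappa> * \<sigma>)\<^sup>2 * (norm d)\<^sup>2 + 2 * (\<kappa> * \<sigma>) * (d \<bullet> z) + (norm z)\<^sup>2"
    unfolding power2_norm_eq_inner
    by (simp add: inner_add_left inner_add_right power2_eq_square inner_commute[of z d] algebra_simps)
  also have "\<dots> / (\<kappa> * \<sigma>) = \<kappa> * (\<sigma> * (norm d)\<^sup>2) + 2 * (d \<bullet> z) + (norm z)\<^sup>2 / \<sigma> / \<kappa>"
    using \<kappa> \<sigma> by (simp add: add_divide_distrib power2_eq_square)
  finally have "- 2 * (d \<bullet> z) \<le> \<kappa> * (\<sigma> * (norm d)\<^sup>2) + (norm z)\<^sup>2 / \<sigma> / \<kappa>" by simp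
  moreover have "(norm z)\<^sup>2 / \<sigma> / \<kappa> \<le> (\<beta>\<^sup>2 / 2 * (s * g\<^sup>2) + 2 * \<epsilon> * L\<^sup>2) / \<kappa>"
    using z \<kappa> by (intro divide_right_mono) auto
  moreover have "(\<beta>\<^sup>2 / 2 * (s * g\<^sup>2) + 2 * \<epsilon> * L\<^sup>2) / \<kappa> = \<beta>\<^sup>2 / (2 * \<kappa>) * (s * g\<^sup>2) + 2 * \<epsilon> * L\<^sup>2 / \<kappa>"
    by (simp add: add_divide_distrib)
  moreover have "d \<bullet> (\<kappa> *\<^sub>R (\<sigma> *\<^sub>R d) + z) = \<kappa> * (\<sigma> * (norm d)\<^sup>2) + d \<bullet> z"
    by (simp add: inner_add_right power2_norm_eq_inner)
  ultimately show ?thesis unfolding z_def[symmetric] s_def[symmetric] by linarith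
qed

text \<open>
  The last condition says that the drifts V1/m1 and V2/m2 differ by at most \<beta> g, again in a form
  that makes sense where the densities vanish.
\<close>

locale density_pair =
  d1: bounded_drift_density \<kappa> T m1 V1 M L + d2: bounded_drift_density \<kappa> T m2 V2 M L
  for \<kappa> T :: real and m1 m2 :: "real \<Rightarrow> real^'n \<Rightarrow> real" and V1 V2 :: "real \<Rightarrow> real^'n \<Rightarrow> real^'n" and M L +
  fixes \<beta> :: real and g :: "real \<Rightarrow> real^'n \<Rightarrow> real"
  assumes beta_nonneg: "0 \<le> \<beta>"
    and gap_nonneg: "\<And>t x. 0 \<le> g t x"
    and gap_continuous: "t \<in> {0<..<T} \<Longrightarrow> continuous_on UNIV (g t)"
    and drift_gap: "t \<in> {0<..<T} \<Longrightarrow>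
      norm (m2 t x *\<^sub>R V1 t x - m1 t x *\<^sub>R V2 t x) \<le> \<beta> * (m1 t x * m2 t x) * g t x"
begin

text \<open>
  The total density, shifted because it may vanish near the initial time.
\<close>

definition \<sigma> :: "real \<Rightarrow> real \<Rightarrow> real^'n \<Rightarrow> real" where
  "\<sigma> \<epsilon> t x = m1 t x + m2 t x + \<epsilon>"

definition ratio :: "real \<Rightarrow> real \<Rightarrow> real^'n \<Rightarrow> real" where
  "ratio \<epsilon> t x = (m1 t x - m2 t x) / \<sigma> \<epsilon> t x"

text \<open>
  The integral of (m1 - m2)^2/(m1 + m2), known as triangular discrimination, with the shifted total
  density.  Among the f-divergences it is symmetric, quadratic in the difference, and finite without
  any lower bound on the densities.
\<close>

definition discrimination :: "real \<Rightarrow> real \<Rightarrow> real" where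
  "discrimination \<epsilon> t = cell_integral (\<lambda>x. \<sigma> \<epsilon> t x * (ratio \<epsilon> t x)\<^sup>2)"

lemma \<sigma>_pos: "t \<in> {0..T} \<Longrightarrow> 0 < \<epsilon> \<Longrightarrow> 0 < \<sigma> \<epsilon> t x"
  using d1.density_nonneg[of t x] d2.density_nonneg[of t x] by (simp add: \<sigma>_def)

lemma discrimination_integrand:
  "t \<in> {0..T} \<Longrightarrow> 0 < \<epsilon> \<Longrightarrow> \<sigma> \<epsilon> t x * (ratio \<epsilon> t x)\<^sup>2 = (m1 t x - m2 t x)\<^sup>2 / \<sigma> \<epsilon> t x"
  using \<sigma>_pos[of t \<epsilon> x] by (simp add: ratio_def power2_eq_square)

lemma \<sigma>_C1:
  assumes "t \<in> {0<..<T}"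
  shows "C1 (\<sigma> \<epsilon> t)" "grad (\<sigma> \<epsilon> t) x = grad (m1 t) x + grad (m2 t) x"
proof -
  have 1: "C1 (\<lambda>x. m1 t x + m2 t x)" by (intro C1_add d1.density_C1 d2.density_C1 assms)
  then show "C1 (\<sigma> \<epsilon> t)" unfolding \<sigma>_def[abs_def] by (intro C1_add C1_const d1.density_C1 d2.density_C1 assms)
  show "grad (\<sigma> \<epsilon> t) x = grad (m1 t) x + grad (m2 t) x"
    unfolding \<sigma>_def[abs_def] grad_add[OF 1 C1_const]
      grad_add[OF d1.density_C1[OF assms] d2.density_C1[OF assms]] grad_const by simp
qed

lemma ratio_C1:
  assumes t: "t \<in> {0<..<T}" and \<epsilon>: "0 < \<epsilon>"
  shows "C1 (ratio \<epsilon> t)"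
    and "\<sigma> \<epsilon> t x *\<^sub>R grad (ratio \<epsilon> t) x = (grad (m1 t) x - grad (m2 t) x) - ratio \<epsilon> t x *\<^sub>R (grad (m1 t) x + grad (m2 t) x)"
proof -
  have tc: "t \<in> {0..T}" using t by auto
  note pos = \<sigma>_pos[OF tc \<epsilon>]
  note inv = C1_inverse[OF \<sigma>_C1(1)[OF t, of \<epsilon>] pos]
  have C1\<mu>: "C1 (\<lambda>x. m1 t x - m2 t x)" by (intro C1_diff d1.density_C1 d2.density_C1 t)
  have r: "ratio \<epsilon> t = (\<lambda>x. (m1 t x - m2 t x) * (1 / \<sigma> \<epsilon> t x))"
    by (simp add: ratio_def fun_eq_iff)
  show "C1 (ratio \<epsilon> t)" unfolding r by (rule C1_mult[OF C1\<mu> inv(1)])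
  have "s *\<^sub>R (\<mu> *\<^sub>R (- (1 / s)\<^sup>2 *\<^sub>R a) + (1 / s) *\<^sub>R b) = b - (\<mu> / s) *\<^sub>R a" if "0 < s" for s \<mu> :: real and a b :: "real^'n"
    using that by (simp add: scaleR_add_right scaleR_diff_right power2_eq_square)
  from this[OF pos]
  show "\<sigma> \<epsilon> t x *\<^sub>R grad (ratio \<epsilon> t) x = (grad (m1 t) x - grad (m2 t) x) - ratio \<epsilon> t x *\<^sub>R (grad (m1 t) x + grad (m2 t) x)"
    unfolding r grad_mult[OF C1\<mu> inv(1)] inv(2) \<sigma>_C1(2)[OF t]
      grad_diff[OF d1.density_C1[OF t] d2.density_C1[OF t]] by simp
qed

lemma ratio_periodic: "t \<in> {0..T} \<Longrightarrow> periodic (ratio \<epsilon> t)"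
  using d1.density_periodic[of t] d2.density_periodic[of t] by (simp add: periodic_def ratio_def \<sigma>_def)

lemma \<sigma>_continuous_compose:
  assumes "continuous_on S a" "continuous_on S b" "a ` S \<subseteq> {0..T}"
  shows "continuous_on S (\<lambda>z. \<sigma> \<epsilon> (a z) (b z))"
  unfolding \<sigma>_def by (intro continuous_intros d1.density_continuous_compose d2.density_continuous_compose assms)

lemma ratio_continuous_compose:
  assumes "continuous_on S a" "continuous_on S b" "a ` S \<subseteq> {0..T}" "0 < \<epsilon>"
  shows "continuous_on S (\<lambda>z. ratio \<epsilon> (a z) (b z))"
  unfolding ratio_def
  by (intro continuous_intros \<sigma>_continuous_compose d1.density_continuous_compose d2.density_continuous_compose assms ballI
      \<sigma>_pos[THEN less_imp_neq, THEN not_sym] subsetD[OF assms(3)] imageI)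

lemma discrimination_continuous: "0 < \<epsilon> \<Longrightarrow> continuous_on {0..T} (discrimination \<epsilon>)"
  unfolding discrimination_def
  by (rule cell_integral_continuous_on, unfold split_beta)
    (intro continuous_intros \<sigma>_continuous_compose ratio_continuous_compose; auto)

text \<open>
  The derivative of \<mu>^2/\<sigma> is (2r - r^2) times the divergence of the first flux minus (2r + r^2) times
  that of the second.  After integration by parts the two fluxes enter with the weights 1 - r and
  1 + r, which are proportional to m2 and m1 up to \<epsilon>; this cross-multiplication leaves only the
  difference of the drifts.
\<close>

lemma discrimination_has_derivative:
  assumes t: "t \<in> {0<..<T}" and \<epsilon>: "0 < \<epsilon>"
  shows "\<exists>D. (discrimination \<epsilon> has_real_derivative D) (at t) \<and>
    D \<le> - \<kappa> * cell_integral (\<lambda>x. \<sigma> \<epsilon> t x * (norm (grad (ratio \<epsilon> t) x))\<^sup>2)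
      + \<beta>\<^sup>2 / (2 * \<kappa>) * cell_integral (\<lambda>x. (m1 t x + m2 t x) * (g t x)\<^sup>2) + 2 * \<epsilon> * L\<^sup>2 / \<kappa>"
proof -
  have tc: "t \<in> {0..T}" using t by auto
  let ?r = "ratio \<epsilon>" and ?d1 = "\<lambda>t x. divergence (d1.flux t) x" and ?d2 = "\<lambda>t x. divergence (d2.flux t) x"
  define D where "D = cell_integral (\<lambda>x. (2 * ?r t x - (?r t x)\<^sup>2) * ?d1 t x - (2 * ?r t x + (?r t x)\<^sup>2) * ?d2 t x)"
  have "(discrimination \<epsilon> has_real_derivative D) (at t)"
    unfolding discrimination_def[abs_def] D_def
  proof (rule cell_integral_has_derivative[OF _ _ _ t])
    fix s x assume s: "s \<in> {0<..<T}"
    then have sc: "s \<in> {0..T}" by auto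
    have id: "(2 * \<mu> * (a - b) * z - \<mu>\<^sup>2 * (a + b)) / (z * z) = (2 * (\<mu> / z) - (\<mu> / z)\<^sup>2) * a - (2 * (\<mu> / z) + (\<mu> / z)\<^sup>2) * b"
      if "0 < z" for \<mu> a b z :: real
      using that by (simp add: field_simps power2_eq_square)
    note dm = d1.density_has_derivative[OF s, of x] d2.density_has_derivative[OF s, of x]
    have 1: "((\<lambda>s. (m1 s x - m2 s x)\<^sup>2) has_real_derivative 2 * (m1 s x - m2 s x) * (?d1 s x - ?d2 s x)) (at s)"
      by (rule DERIV_cong[OF DERIV_power[OF DERIV_diff[OF dm], of 2]]) simp
    have 2: "((\<lambda>s. \<sigma> \<epsilon> s x) has_real_derivative (?d1 s x + ?d2 s x)) (at s)"
      unfolding \<sigma>_def by (rule DERIV_cong[OF DERIV_add[OF DERIV_add[OF dm] DERIV_const]]) simp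
    have 3: "((\<lambda>s. (m1 s x - m2 s x)\<^sup>2 / \<sigma> \<epsilon> s x) has_real_derivative
        (2 * ?r s x - (?r s x)\<^sup>2) * ?d1 s x - (2 * ?r s x + (?r s x)\<^sup>2) * ?d2 s x) (at s)"
      unfolding ratio_def id[OF \<sigma>_pos[OF sc \<epsilon>], symmetric]
      by (rule DERIV_divide[OF 1 2]) (use \<sigma>_pos[OF sc \<epsilon>, of x] in simp)
    show "((\<lambda>s. \<sigma> \<epsilon> s x * (?r s x)\<^sup>2) has_real_derivative
        (2 * ?r s x - (?r s x)\<^sup>2) * ?d1 s x - (2 * ?r s x + (?r s x)\<^sup>2) * ?d2 s x) (at s)"
      by (rule has_field_derivative_transform_within_open[OF 3 open_greaterThanLessThan s])
        (rule discrimination_integrand[symmetric], use \<epsilon> in auto)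
  next
    have cr: "continuous_on ({0<..<T} \<times> UNIV) (\<lambda>z. ?r (fst z) (snd z))"
      by (rule ratio_continuous_compose[OF _ _ _ \<epsilon>]) (auto intro!: continuous_intros)
    show "continuous_on ({0<..<T} \<times> UNIV) (\<lambda>(t, x). (2 * ?r t x - (?r t x)\<^sup>2) * ?d1 t x - (2 * ?r t x + (?r t x)\<^sup>2) * ?d2 t x)"
      using d1.divergence_flux_continuous d2.divergence_flux_continuous unfolding split_beta
      by (intro continuous_intros cr)
  next
    fix s assume s: "s \<in> {0<..<T}"
    show "continuous_on UNIV (\<lambda>x. \<sigma> \<epsilon> s x * (?r s x)\<^sup>2)"
      by (intro continuous_intros C1_continuous \<sigma>_C1 ratio_C1 s \<epsilon>)
  qed
  moreover have "D \<le> - \<kappa> * cell_integral (\<lambda>x. \<sigma> \<epsilon> t x * (norm (grad (?r t) x))\<^sup>2)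
      + \<beta>\<^sup>2 / (2 * \<kappa>) * cell_integral (\<lambda>x. (m1 t x + m2 t x) * (g t x)\<^sup>2) + 2 * \<epsilon> * L\<^sup>2 / \<kappa>"
  proof -
    note r1 = ratio_C1(1)[OF t \<epsilon>]
    note cs = continuous_intros C1_continuous[OF r1] C1_continuous_grad[OF r1] C1_continuous[OF \<sigma>_C1(1)[OF t]]
      C1_continuous[OF d1.density_C1[OF t]] C1_continuous[OF d2.density_C1[OF t]] gap_continuous[OF t]
      C1_components_continuous[OF d1.flux_C1[OF t]] C1_components_continuous[OF d2.flux_C1[OF t]]
    have f1: "C1 (\<lambda>x. 2 * ?r t x - (?r t x)\<^sup>2)" "grad (\<lambda>x. 2 * ?r t x - (?r t x)\<^sup>2) x = (2 * (1 - ?r t x)) *\<^sub>R grad (?r t) x" for x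
    proof -
      have d: "((\<lambda>r. 2 * r - r\<^sup>2) has_real_derivative (2 * (1 - r))) (at r)" for r :: real
        by (auto intro!: derivative_eq_intros)
      have c: "continuous_on S (\<lambda>r::real. 2 * (1 - r))" for S by (intro continuous_intros)
      show "C1 (\<lambda>x. 2 * ?r t x - (?r t x)\<^sup>2)" "grad (\<lambda>x. 2 * ?r t x - (?r t x)\<^sup>2) x = (2 * (1 - ?r t x)) *\<^sub>R grad (?r t) x"
        by (rule C1_compose[OF r1 d c])+
    qed
    have f2: "C1 (\<lambda>x. 2 * ?r t x + (?r t x)\<^sup>2)" "grad (\<lambda>x. 2 * ?r t x + (?r t x)\<^sup>2) x = (2 * (1 + ?r t x)) *\<^sub>R grad (?r t) x" for x
    proof -
      have d: "((\<lambda>r. 2 * r + r\<^sup>2) has_real_derivative (2 * (1 + r))) (at r)" for r :: real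
        by (auto intro!: derivative_eq_intros)
      have c: "continuous_on S (\<lambda>r::real. 2 * (1 + r))" for S by (intro continuous_intros)
      show "C1 (\<lambda>x. 2 * ?r t x + (?r t x)\<^sup>2)" "grad (\<lambda>x. 2 * ?r t x + (?r t x)\<^sup>2) x = (2 * (1 + ?r t x)) *\<^sub>R grad (?r t) x"
        by (rule C1_compose[OF r1 d c])+
    qed
    have per: "periodic (\<lambda>x. 2 * ?r t x - (?r t x)\<^sup>2)" "periodic (\<lambda>x. 2 * ?r t x + (?r t x)\<^sup>2)"
      using ratio_periodic[OF tc] by (auto simp: periodic_def)
    have "D = cell_integral (\<lambda>x. (2 * ?r t x - (?r t x)\<^sup>2) * ?d1 t x) - cell_integral (\<lambda>x. (2 * ?r t x + (?r t x)\<^sup>2) * ?d2 t x)"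
      unfolding D_def by (rule cell_integral_diff; intro cs)
    also have "\<dots> = - cell_integral (\<lambda>x. ((2 * (1 - ?r t x)) *\<^sub>R grad (?r t) x) \<bullet> d1.flux t x)
        - - cell_integral (\<lambda>x. ((2 * (1 + ?r t x)) *\<^sub>R grad (?r t) x) \<bullet> d2.flux t x)"
      unfolding cell_integral_by_parts[OF per(1) f1(1) d1.flux_periodic[OF t] d1.flux_C1[OF t]]
        cell_integral_by_parts[OF per(2) f2(1) d2.flux_periodic[OF t] d2.flux_C1[OF t]] f1(2) f2(2) ..
    also have "\<dots> = cell_integral (\<lambda>x. ((2 * (1 + ?r t x)) *\<^sub>R grad (?r t) x) \<bullet> d2.flux t x
         - ((2 * (1 - ?r t x)) *\<^sub>R grad (?r t) x) \<bullet> d1.flux t x)"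
      by (subst cell_integral_diff; (intro cs)?; simp)
    also have "\<dots> \<le> cell_integral (\<lambda>x. - \<kappa> * (\<sigma> \<epsilon> t x * (norm (grad (?r t) x))\<^sup>2)
      + \<beta>\<^sup>2 / (2 * \<kappa>) * ((m1 t x + m2 t x) * (g t x)\<^sup>2) + 2 * \<epsilon> * L\<^sup>2 / \<kappa>)"
    proof (rule cell_integral_mono)
      fix x :: "real^'n"
      let ?G = "grad (?r t) x" and ?s = "\<sigma> \<epsilon> t x"
      have s: "0 < ?s" by (rule \<sigma>_pos[OF tc \<epsilon>])
      have r12: "1 - ?r t x = (1 / ?s) * (2 * m2 t x + \<epsilon>)" "1 + ?r t x = (1 / ?s) * (2 * m1 t x + \<epsilon>)"
        using s by (simp_all add: ratio_def \<sigma>_def divide_simps)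
      have drift: "(1 - ?r t x) *\<^sub>R V1 t x - (1 + ?r t x) *\<^sub>R V2 t x
        = (1 / ?s) *\<^sub>R (2 *\<^sub>R (m2 t x *\<^sub>R V1 t x - m1 t x *\<^sub>R V2 t x) + \<epsilon> *\<^sub>R (V1 t x - V2 t x))"
        unfolding r12 scaleR_scaleR[symmetric] scaleR_diff_right[symmetric]
        by (simp add: scaleR_add_left scaleR_diff_right algebra_simps)
      have diff: "(1 - ?r t x) *\<^sub>R grad (m1 t) x - (1 + ?r t x) *\<^sub>R grad (m2 t) x = ?s *\<^sub>R ?G"
        unfolding ratio_C1(2)[OF t \<epsilon>] by (simp add: algebra_simps)
      have "((2 * (1 + ?r t x)) *\<^sub>R ?G) \<bullet> d2.flux t x - ((2 * (1 - ?r t x)) *\<^sub>R ?G) \<bullet> d1.flux t x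
        = - 2 * (?G \<bullet> (\<kappa> *\<^sub>R ((1 - ?r t x) *\<^sub>R grad (m1 t) x - (1 + ?r t x) *\<^sub>R grad (m2 t) x)
            + ((1 - ?r t x) *\<^sub>R V1 t x - (1 + ?r t x) *\<^sub>R V2 t x)))"
      proof -
        have "((2 * b) *\<^sub>R G) \<bullet> (\<kappa> *\<^sub>R p2 + v2) - ((2 * a) *\<^sub>R G) \<bullet> (\<kappa> *\<^sub>R p1 + v1)
          = - 2 * (G \<bullet> (\<kappa> *\<^sub>R (a *\<^sub>R p1 - b *\<^sub>R p2) + (a *\<^sub>R v1 - b *\<^sub>R v2)))" for a b :: real and G p1 p2 v1 v2 :: "real^'n"
          by (simp add: inner_add_right inner_diff_right right_diff_distrib)
        then show ?thesis unfolding d1.flux_def d2.flux_def .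
      qed
      also have "\<dots> \<le> - \<kappa> * (?s * (norm ?G)\<^sup>2) + \<beta>\<^sup>2 / (2 * \<kappa>) * ((m1 t x + m2 t x) * (g t x)\<^sup>2) + 2 * \<epsilon> * L\<^sup>2 / \<kappa>"
        unfolding drift diff unfolding \<sigma>_def
        by (rule triangular_dissipation_pointwise)
          (use d1.kappa_pos \<epsilon> d1.density_nonneg[OF tc] d2.density_nonneg[OF tc] d1.L_nonneg beta_nonneg gap_nonneg
            d1.V_bound[OF t] d2.V_bound[OF t] drift_gap[OF t] in auto)
      finally show "((2 * (1 + ?r t x)) *\<^sub>R ?G) \<bullet> d2.flux t x - ((2 * (1 - ?r t x)) *\<^sub>R ?G) \<bullet> d1.flux t x \<le> \<dots>" .
    qed (intro cs)+
    also have "\<dots> = - \<kappa> * cell_integral (\<lambda>x. \<sigma> \<epsilon> t x * (norm (grad (?r t) x))\<^sup>2)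
      + \<beta>\<^sup>2 / (2 * \<kappa>) * cell_integral (\<lambda>x. (m1 t x + m2 t x) * (g t x)\<^sup>2) + 2 * \<epsilon> * L\<^sup>2 / \<kappa>"
    proof (rule cell_integral_affine)
      show "continuous_on UNIV (\<lambda>x. \<sigma> \<epsilon> t x * (norm (grad (?r t) x))\<^sup>2)" by (intro cs)
      show "continuous_on UNIV (\<lambda>x. (m1 t x + m2 t x) * (g t x)\<^sup>2)" by (intro cs)
    qed
    finally show ?thesis .
  qed
  ultimately show ?thesis by blast
qed

text \<open>
  The ratio has mean zero with respect to \<sigma>, because both densities have mass 1.  Hence subtracting
  its average over the cell only increases its \<sigma>-norm, and the Poincare inequality applies.
\<close>

lemma discrimination_le_dissipation:
  assumes t: "t \<in> {0<..<T}" and \<epsilon>: "0 < \<epsilon>" "\<epsilon> \<le> 1" and c: "0 < c" "\<And>x. c \<le> m1 t x"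
  shows "discrimination \<epsilon> t \<le> (2 * M + 1) * real CARD('n) / c * cell_integral (\<lambda>x. \<sigma> \<epsilon> t x * (norm (grad (ratio \<epsilon> t) x))\<^sup>2)"
proof -
  have tc: "t \<in> {0..T}" using t by auto
  let ?r = "ratio \<epsilon> t" and ?s = "\<sigma> \<epsilon> t"
  note r1 = ratio_C1(1)[OF t \<epsilon>(1)]
  note cs = continuous_intros C1_continuous[OF r1] C1_continuous_grad[OF r1] C1_continuous[OF \<sigma>_C1(1)[OF t]]
      C1_continuous[OF d1.density_C1[OF t]] C1_continuous[OF d2.density_C1[OF t]]
  define R where "R = cell_integral ?r"
  have pos: "0 < ?s x" for x by (rule \<sigma>_pos[OF tc \<epsilon>(1)])
  have M: "0 \<le> M" using order.trans[OF d1.density_nonneg[OF tc] d1.density_le[OF tc]] .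
  have s_le: "?s x \<le> 2 * M + 1" "c \<le> ?s x" for x
    using d1.density_le[OF tc, of x] d2.density_le[OF tc, of x] d2.density_nonneg[OF tc, of x] c(2)[of x] \<epsilon> by (auto simp: \<sigma>_def)
  have "cell_integral (\<lambda>x. ?s x * ?r x) = cell_integral (\<lambda>x. m1 t x - m2 t x)"
    using pos by (simp add: ratio_def less_imp_neq[THEN not_sym])
  also have "\<dots> = 0" by (subst cell_integral_diff) (auto intro!: cs simp: d1.density_mass[OF tc] d2.density_mass[OF tc])
  finally have 0: "cell_integral (\<lambda>x. ?s x * ?r x) = 0" .
  have "discrimination \<epsilon> t = cell_integral (\<lambda>x. ?s x * (?r x)\<^sup>2) - 2 * R * cell_integral (\<lambda>x. ?s x * ?r x)"
    by (simp add: 0 discrimination_def)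
  also have "\<dots> = cell_integral (\<lambda>x. ?s x * (?r x)\<^sup>2 - 2 * R * (?s x * ?r x))"
    by (subst cell_integral_diff; (intro cs)?; simp)
  also have "\<dots> \<le> cell_integral (\<lambda>x. (2 * M + 1) * (?r x - R)\<^sup>2)"
  proof (intro cell_integral_mono cs)
    fix x
    have "?s x * (?r x)\<^sup>2 - 2 * R * (?s x * ?r x) \<le> ?s x * (?r x - R)\<^sup>2"
      using mult_nonneg_nonneg[OF less_imp_le[OF pos[of x]] zero_le_power2[of R]] by (simp add: power2_eq_square algebra_simps)
    also have "\<dots> \<le> (2 * M + 1) * (?r x - R)\<^sup>2" by (intro mult_right_mono s_le) auto
    finally show "?s x * (?r x)\<^sup>2 - 2 * R * (?s x * ?r x) \<le> (2 * M + 1) * (?r x - R)\<^sup>2" .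
  qed
  also have "\<dots> = (2 * M + 1) * cell_integral (\<lambda>x. (?r x - R)\<^sup>2)" by simp
  also have "\<dots> \<le> (2 * M + 1) * (real CARD('n) * cell_integral (\<lambda>x. (norm (grad ?r x))\<^sup>2))"
    unfolding R_def using M by (intro mult_left_mono poincare_torus ratio_periodic tc r1) auto
  also have "cell_integral (\<lambda>x. (norm (grad ?r x))\<^sup>2) \<le> cell_integral (\<lambda>x. 1 / c * (?s x * (norm (grad ?r x))\<^sup>2))"
  proof (intro cell_integral_mono cs)
    fix x
    have "c * (norm (grad ?r x))\<^sup>2 \<le> ?s x * (norm (grad ?r x))\<^sup>2" by (intro mult_right_mono s_le) auto
    then show "(norm (grad ?r x))\<^sup>2 \<le> 1 / c * (?s x * (norm (grad ?r x))\<^sup>2)" using c(1) by (simp add: field_simps)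
  qed
  finally show ?thesis using M by (simp add: mult_left_mono)
qed

lemma difference_le_discrimination:
  assumes t: "t \<in> {0..T}" and \<epsilon>: "0 < \<epsilon>" "\<epsilon> \<le> 1"
  shows "cell_integral (\<lambda>x. (m1 t x - m2 t x)\<^sup>2) \<le> (2 * M + 1) * discrimination \<epsilon> t"
proof -
  have img: "(\<lambda>_::real^'n. t) ` UNIV \<subseteq> {0..T}" using t by auto
  note cs = continuous_intros d1.density_continuous_compose[OF continuous_on_const continuous_on_id img]
    d2.density_continuous_compose[OF continuous_on_const continuous_on_id img]
    \<sigma>_continuous_compose[OF continuous_on_const continuous_on_id img]
    ratio_continuous_compose[OF continuous_on_const continuous_on_id img \<epsilon>(1)]
  have "cell_integral (\<lambda>x. (m1 t x - m2 t x)\<^sup>2) \<le> cell_integral (\<lambda>x. (2 * M + 1) * (\<sigma> \<epsilon> t x * (ratio \<epsilon> t x)\<^sup>2))"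
  proof (intro cell_integral_mono cs)
    fix x
    have "\<sigma> \<epsilon> t x \<le> 2 * M + 1" using d1.density_le[OF t, of x] d2.density_le[OF t, of x] \<epsilon> by (simp add: \<sigma>_def)
    then have "(m1 t x - m2 t x)\<^sup>2 * \<sigma> \<epsilon> t x \<le> (m1 t x - m2 t x)\<^sup>2 * (2 * M + 1)" by (intro mult_left_mono) auto
    then show "(m1 t x - m2 t x)\<^sup>2 \<le> (2 * M + 1) * (\<sigma> \<epsilon> t x * (ratio \<epsilon> t x)\<^sup>2)"
      unfolding discrimination_integrand[OF t \<epsilon>(1)] using \<sigma>_pos[OF t \<epsilon>(1), of x] by (simp add: field_simps)
  qed
  then show ?thesis by (simp add: discrimination_def)
qed

end

section \<open>Consequences of the bounds on the Hamiltonian\<close>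

text \<open>
  Apply the mean value theorem in one coordinate direction, then in the other.
\<close>

lemma mixed_difference:
  fixes f :: "real^'n \<Rightarrow> real"
  assumes f: "C2 f" and h: "0 < h"
  obtains a b where "0 < a" "a < h" "0 < b" "b < h"
    "f (p + h *\<^sub>R axis i 1 + h *\<^sub>R axis j 1) - f (p + h *\<^sub>R axis i 1) - f (p + h *\<^sub>R axis j 1) + f p
      = h\<^sup>2 * hessian f (p + a *\<^sub>R axis i 1 + b *\<^sub>R axis j 1) $ i $ j"
proof -
  have d1: "f differentiable (at x)" for x using f by (simp add: C2_def C1_def)
  have d2: "(\<lambda>y. grad f y $ i) differentiable (at x)" for x using f by (simp add: C2_def C1_def)
  let ?ei = "axis i 1 :: real^'n" and ?ej = "axis j 1 :: real^'n"
  let ?F = "\<lambda>s. f ((p + h *\<^sub>R ?ej) + s *\<^sub>R ?ei) - f (p + s *\<^sub>R ?ei)"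
  have "\<exists>a>0. a < h \<and> ?F h - ?F 0 = (h - 0) * (?ei \<bullet> grad f ((p + h *\<^sub>R ?ej) + a *\<^sub>R ?ei) - ?ei \<bullet> grad f (p + a *\<^sub>R ?ei))"
    by (rule MVT2[OF h]) (intro DERIV_diff DERIV_along_line d1)
  then obtain a where a: "0 < a" "a < h"
    and F: "?F h - ?F 0 = h * (grad f ((p + h *\<^sub>R ?ej) + a *\<^sub>R ?ei) $ i - grad f (p + a *\<^sub>R ?ei) $ i)"
    by (auto simp: inner_axis')
  let ?G = "\<lambda>s. grad f ((p + a *\<^sub>R ?ei) + s *\<^sub>R ?ej) $ i"
  have "\<exists>b>0. b < h \<and> ?G h - ?G 0 = (h - 0) * (?ej \<bullet> grad (\<lambda>y. grad f y $ i) ((p + a *\<^sub>R ?ei) + b *\<^sub>R ?ej))"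
    by (rule MVT2[OF h]) (rule DERIV_along_line[OF d2])
  then obtain b where b: "0 < b" "b < h" and G: "?G h - ?G 0 = h * hessian f (p + a *\<^sub>R ?ei + b *\<^sub>R ?ej) $ i $ j"
    by (auto simp: inner_axis' hessian_def)
  have "?F h - ?F 0 = h * (?G h - ?G 0)" unfolding F by (simp add: algebra_simps)
  then have "?F h - ?F 0 = h\<^sup>2 * hessian f (p + a *\<^sub>R ?ei + b *\<^sub>R ?ej) $ i $ j" unfolding G by (simp add: power2_eq_square)
  then show ?thesis using that a b by (simp add: algebra_simps)
qed

text \<open>
  The second difference is symmetric in i and j, and both mixed derivatives are its limits.
\<close>

lemma hessian_symmetric:
  fixes f :: "real^'n \<Rightarrow> real"
  assumes f: "C2 f"
  shows "hessian f p $ i $ j = hessian f p $ j $ i"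
proof (rule ccontr)
  assume ne: "hessian f p $ i $ j \<noteq> hessian f p $ j $ i"
  define e where "e = \<bar>hessian f p $ i $ j - hessian f p $ j $ i\<bar> / 2"
  have e: "0 < e" using ne by (simp add: e_def)
  have c: "continuous_on UNIV (\<lambda>x. hessian f x $ k $ l)" for k l
    using f unfolding hessian_def C2_def C1_def by (auto intro!: continuous_intros)
  obtain d1 where d1: "0 < d1" "\<And>x. dist x p < d1 \<Longrightarrow> dist (hessian f x $ i $ j) (hessian f p $ i $ j) < e"
    using c[of i j] e unfolding continuous_on_iff by blast
  obtain d2 where d2: "0 < d2" "\<And>x. dist x p < d2 \<Longrightarrow> dist (hessian f x $ j $ i) (hessian f p $ j $ i) < e"
    using c[of j i] e unfolding continuous_on_iff by blast
  define h where "h = min d1 d2 / 2"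
  have h: "0 < h" using d1 d2 by (simp add: h_def)
  have near: "dist (p + a *\<^sub>R axis k 1 + b *\<^sub>R axis l 1) p < min d1 d2" if "0 < a" "a < h" "0 < b" "b < h" for a b k l
  proof -
    have "dist (p + a *\<^sub>R axis k 1 + b *\<^sub>R axis l 1) p = norm (a *\<^sub>R axis k 1 + b *\<^sub>R axis l (1::real))"
      by (simp add: dist_norm)
    also have "\<dots> \<le> a + b" using that by (intro norm_triangle_le) simp
    finally show ?thesis using that unfolding h_def by linarith
  qed
  obtain a b where ab: "0 < a" "a < h" "0 < b" "b < h" and 1:
    "f (p + h *\<^sub>R axis i 1 + h *\<^sub>R axis j 1) - f (p + h *\<^sub>R axis i 1) - f (p + h *\<^sub>R axis j 1) + f p
      = h\<^sup>2 * hessian f (p + a *\<^sub>R axis i 1 + b *\<^sub>R axis j 1) $ i $ j"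
    using mixed_difference[OF f h] by blast
  obtain a' b' where ab': "0 < a'" "a' < h" "0 < b'" "b' < h" and 2:
    "f (p + h *\<^sub>R axis j 1 + h *\<^sub>R axis i 1) - f (p + h *\<^sub>R axis j 1) - f (p + h *\<^sub>R axis i 1) + f p
      = h\<^sup>2 * hessian f (p + a' *\<^sub>R axis j 1 + b' *\<^sub>R axis i 1) $ j $ i"
    using mixed_difference[OF f h] by blast
  have "h\<^sup>2 * hessian f (p + a *\<^sub>R axis i 1 + b *\<^sub>R axis j 1) $ i $ j = h\<^sup>2 * hessian f (p + a' *\<^sub>R axis j 1 + b' *\<^sub>R axis i 1) $ j $ i"
    unfolding 1[symmetric] 2[symmetric] by (simp add: algebra_simps)
  then have eq: "hessian f (p + a *\<^sub>R axis i 1 + b *\<^sub>R axis j 1) $ i $ j = hessian f (p + a' *\<^sub>R axis j 1 + b' *\<^sub>R axis i 1) $ j $ i"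
    using h by simp
  have "dist (hessian f (p + a *\<^sub>R axis i 1 + b *\<^sub>R axis j 1) $ i $ j) (hessian f p $ i $ j) < e"
    using near[OF ab, of i j] by (intro d1(2)) simp
  moreover have "dist (hessian f (p + a' *\<^sub>R axis j 1 + b' *\<^sub>R axis i 1) $ j $ i) (hessian f p $ j $ i) < e"
    using near[OF ab', of j i] by (intro d2(2)) simp
  moreover have "\<bar>a - b\<bar> \<le> \<bar>z - a\<bar> + \<bar>z - b\<bar>" for a b z :: real by linarith
  ultimately show False unfolding eq dist_real_def e_def by (smt (verit) field_sum_of_halves)
qed

lemma DERIV_grad_along_line:
  fixes f :: "real^'n \<Rightarrow> real"
  assumes f: "C2 f"
  shows "((\<lambda>s. \<eta> \<bullet> grad f (p + s *\<^sub>R \<xi>)) has_real_derivative \<eta> \<bullet> (hessian f (p + s *\<^sub>R \<xi>) *v \<xi>)) (at s)"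
proof -
  have "((\<lambda>s. \<Sum>i\<in>UNIV. \<eta> $ i * grad f (p + s *\<^sub>R \<xi>) $ i) has_real_derivative
      (\<Sum>i\<in>UNIV. \<eta> $ i * (\<xi> \<bullet> grad (\<lambda>y. grad f y $ i) (p + s *\<^sub>R \<xi>)))) (at s)"
    by (intro DERIV_sum DERIV_cmult DERIV_along_line) (use f in \<open>simp add: C2_def C1_def\<close>)
  then show ?thesis
    by (simp add: inner_vec_def matrix_vector_mult_def hessian_def mult.commute)
qed

lemma norm_segment_le:
  fixes p q :: "'a::real_normed_vector"
  assumes "norm p \<le> U" "norm q \<le> U" "0 \<le> s" "s \<le> 1"
  shows "norm (p + s *\<^sub>R (q - p)) \<le> U"
proof -
  have "p + s *\<^sub>R (q - p) \<in> cball 0 U"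
    using convexD_alt[OF convex_cball[of "0::'a" U], of p q s] assms by (simp add: algebra_simps)
  then show ?thesis by simp
qed

lemma strong_convexity_on_ball:
  fixes f :: "real^'n \<Rightarrow> real"
  assumes f: "C2 f" and lower: "\<And>p \<xi>. norm p \<le> U \<Longrightarrow> \<alpha> * (\<xi> \<bullet> \<xi>) \<le> \<xi> \<bullet> (hessian f p *v \<xi>)"
    and p: "norm p \<le> U" and q: "norm q \<le> U"
  shows "f p + (q - p) \<bullet> grad f p + \<alpha> / 2 * (norm (q - p))\<^sup>2 \<le> f q"
proof -
  define \<xi> where "\<xi> = q - p"
  have d: "f differentiable (at x)" for x using f by (simp add: C2_def C1_def)
  have ball: "norm (p + s *\<^sub>R \<xi>) \<le> U" if "0 \<le> s" "s \<le> 1" for s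
    unfolding \<xi>_def using norm_segment_le[OF p q that] .
  have slope: "\<xi> \<bullet> grad f p + \<alpha> * s * (norm \<xi>)\<^sup>2 \<le> \<xi> \<bullet> grad f (p + s *\<^sub>R \<xi>)" if s: "0 \<le> s" "s \<le> 1" for s
  proof -
    let ?k = "\<lambda>s. \<xi> \<bullet> grad f (p + s *\<^sub>R \<xi>) - \<alpha> * s * (norm \<xi>)\<^sup>2"
    have "?k 0 \<le> ?k s"
    proof (rule DERIV_nonneg_imp_nondecreasing[where f="?k", OF s(1)])
      fix r assume r: "0 \<le> r" "r \<le> s"
      have "(?k has_real_derivative (\<xi> \<bullet> (hessian f (p + r *\<^sub>R \<xi>) *v \<xi>) - \<alpha> * 1 * (norm \<xi>)\<^sup>2)) (at r)"
        by (intro DERIV_diff DERIV_grad_along_line f DERIV_cmult_right DERIV_cmult DERIV_ident)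
      moreover have "\<alpha> * 1 * (norm \<xi>)\<^sup>2 \<le> \<xi> \<bullet> (hessian f (p + r *\<^sub>R \<xi>) *v \<xi>)"
        using lower[OF ball, of r \<xi>] r s by (simp add: power2_norm_eq_inner)
      ultimately show "\<exists>y. (?k has_real_derivative y) (at r) \<and> 0 \<le> y" by fastforce
    qed
    then show ?thesis by simp
  qed
  let ?g = "\<lambda>s. f (p + s *\<^sub>R \<xi>) - s * (\<xi> \<bullet> grad f p) - \<alpha> / 2 * s\<^sup>2 * (norm \<xi>)\<^sup>2"
  have "?g 0 \<le> ?g 1"
  proof (rule DERIV_nonneg_imp_nondecreasing[where f="?g"])
    fix r :: real assume r: "0 \<le> r" "r \<le> 1"
    have "(?g has_real_derivative (\<xi> \<bullet> grad f (p + r *\<^sub>R \<xi>) - 1 * (\<xi> \<bullet> grad f p) - \<alpha> / 2 * (2 * r) * (norm \<xi>)\<^sup>2)) (at r)"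
      by (intro DERIV_diff DERIV_along_line d DERIV_cmult_right DERIV_ident DERIV_cmult) (auto intro!: derivative_eq_intros)
    moreover have "0 \<le> \<xi> \<bullet> grad f (p + r *\<^sub>R \<xi>) - 1 * (\<xi> \<bullet> grad f p) - \<alpha> / 2 * (2 * r) * (norm \<xi>)\<^sup>2"
      using slope[OF r] by simp
    ultimately show "\<exists>y. (?g has_real_derivative y) (at r) \<and> 0 \<le> y" by blast
  qed simp
  then show ?thesis by (simp add: \<xi>_def)
qed

text \<open>
  Polarisation: \<open>4 * t * (\<eta> \<bullet> (A *v \<xi>))\<close> is the difference of the values of the form at \<open>\<eta> + t *\<^sub>R \<xi>\<close>
  and \<open>\<eta> - t *\<^sub>R \<xi>\<close>, the second of which is nonnegative.
\<close>

lemma symmetric_form_bound: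
  fixes A :: "real^'n^'n"
  assumes sym: "\<And>i j. A $ i $ j = A $ j $ i" and nonneg: "\<And>\<xi>. 0 \<le> \<xi> \<bullet> (A *v \<xi>)"
    and upper: "\<And>\<xi>. \<xi> \<bullet> (A *v \<xi>) \<le> \<beta> * (\<xi> \<bullet> \<xi>)"
  shows "\<eta> \<bullet> (A *v \<xi>) \<le> \<beta> * (norm \<eta> * norm \<xi>)"
proof (cases "\<eta> = 0 \<or> \<xi> = 0")
  case False
  have "transpose A = A" using sym by (simp add: transpose_def vec_eq_iff)
  then have comm: "\<xi> \<bullet> (A *v \<eta>) = \<eta> \<bullet> (A *v \<xi>)"
    by (metis dot_lmul_matrix inner_commute transpose_matrix_vector)
  \<comment> \<open>This choice gives both summands the same norm.\<close>
  define t where "t = norm \<eta> / norm \<xi>"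
  have t: "0 < t" using False by (simp add: t_def)
  have \<beta>: "0 \<le> \<beta>"
  proof -
    have "0 \<le> \<beta> * (\<eta> \<bullet> \<eta>)" using order.trans[OF nonneg upper] .
    then show ?thesis using False inner_gt_zero_iff[of \<eta>] by (simp add: zero_le_mult_iff del: inner_gt_zero_iff)
  qed
  have "4 * t * (\<eta> \<bullet> (A *v \<xi>)) = (\<eta> + t *\<^sub>R \<xi>) \<bullet> (A *v (\<eta> + t *\<^sub>R \<xi>)) - (\<eta> - t *\<^sub>R \<xi>) \<bullet> (A *v (\<eta> - t *\<^sub>R \<xi>))"
    by (simp add: matrix_vector_right_distrib matrix_vector_mult_diff_distrib
        matrix_vector_mult_scaleR inner_add_left inner_add_right inner_diff_left inner_diff_right comm algebra_simps)
  also have "\<dots> \<le> \<beta> * (norm (\<eta> + t *\<^sub>R \<xi>))\<^sup>2"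
    using upper[of "\<eta> + t *\<^sub>R \<xi>"] nonneg[of "\<eta> - t *\<^sub>R \<xi>"] by (simp add: power2_norm_eq_inner)
  also have "\<dots> \<le> \<beta> * (2 * norm \<eta>)\<^sup>2"
  proof (intro mult_left_mono power_mono \<beta>)
    show "norm (\<eta> + t *\<^sub>R \<xi>) \<le> 2 * norm \<eta>"
      using norm_triangle_ineq[of \<eta> "t *\<^sub>R \<xi>"] False t by (simp add: t_def)
  qed simp
  finally have "t * (\<eta> \<bullet> (A *v \<xi>)) \<le> t * (\<beta> * (norm \<eta> * norm \<xi>))"
    using False by (simp add: t_def power2_eq_square field_simps)
  then show ?thesis using t by simp
qed auto

text \<open>
  Apply the mean value theorem to the component of the gradient in the direction of the difference of
  its two values.
\<close>

lemma grad_lipschitz_on_ball: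
  fixes f :: "real^'n \<Rightarrow> real"
  assumes f: "C2 f" and lower: "\<And>p \<xi>. norm p \<le> U \<Longrightarrow> 0 \<le> \<xi> \<bullet> (hessian f p *v \<xi>)"
    and upper: "\<And>p \<xi>. norm p \<le> U \<Longrightarrow> \<xi> \<bullet> (hessian f p *v \<xi>) \<le> \<beta> * (\<xi> \<bullet> \<xi>)"
    and p: "norm p \<le> U" and q: "norm q \<le> U"
  shows "norm (grad f q - grad f p) \<le> \<beta> * norm (q - p)"
proof -
  define \<eta> where "\<eta> = grad f q - grad f p"
  let ?F = "\<lambda>s. \<eta> \<bullet> grad f (p + s *\<^sub>R (q - p))"
  have "\<exists>z>0. z < 1 \<and> ?F 1 - ?F 0 = (1 - 0) * (\<eta> \<bullet> (hessian f (p + z *\<^sub>R (q - p)) *v (q - p)))"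
    by (rule MVT2) (auto intro: DERIV_grad_along_line[OF f])
  then obtain z where z: "0 < z" "z < 1" "\<eta> \<bullet> \<eta> = \<eta> \<bullet> (hessian f (p + z *\<^sub>R (q - p)) *v (q - p))"
    by (auto simp: \<eta>_def inner_diff_right)
  note z(3)
  also have "\<dots> \<le> \<beta> * (norm \<eta> * norm (q - p))"
    by (intro symmetric_form_bound hessian_symmetric f lower upper norm_segment_le p q) (use z in auto)
  finally have "norm \<eta> * norm \<eta> \<le> norm \<eta> * (\<beta> * norm (q - p))"
    by (simp add: power2_norm_eq_inner[symmetric] power2_eq_square algebra_simps)
  moreover have "0 \<le> \<beta> * norm (q - p)"
  proof (cases "q = p")
    case False
    have "0 \<le> \<beta> * ((q - p) \<bullet> (q - p))" using order.trans[OF lower[OF p] upper[OF p]] .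
    then show ?thesis using False inner_gt_zero_iff[of "q - p"] by (simp add: zero_le_mult_iff del: inner_gt_zero_iff)
  qed simp
  ultimately show ?thesis unfolding \<eta>_def[symmetric] by (cases "\<eta> = 0") auto
qed

lemma lipschitz_on_ball:
  fixes f :: "real^'n \<Rightarrow> real"
  assumes f: "C1 f" and bound: "\<And>p. norm p \<le> U \<Longrightarrow> norm (grad f p) \<le> L" and p: "norm p \<le> U" and q: "norm q \<le> U"
  shows "\<bar>f q - f p\<bar> \<le> L * norm (q - p)"
proof -
  let ?F = "\<lambda>s. f (p + s *\<^sub>R (q - p))"
  have "\<exists>z>0. z < 1 \<and> ?F 1 - ?F 0 = (1 - 0) * ((q - p) \<bullet> grad f (p + z *\<^sub>R (q - p)))"
    by (rule MVT2) (use f in \<open>auto intro!: DERIV_along_line simp: C1_def\<close>)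
  then obtain z where z: "0 < z" "z < 1" "f q - f p = (q - p) \<bullet> grad f (p + z *\<^sub>R (q - p))"
    by auto
  have "\<bar>f q - f p\<bar> \<le> norm (q - p) * norm (grad f (p + z *\<^sub>R (q - p)))"
    unfolding z(3) by (rule Cauchy_Schwarz_ineq2)
  also have "\<dots> \<le> norm (q - p) * L"
    using z by (intro mult_left_mono bound norm_segment_le p q) auto
  finally show ?thesis by (simp add: mult.commute)
qed

section \<open>From the function space X to pointwise bounds\<close>

lemma DERIV_pos_part_square:
  "((\<lambda>r::real. (max 0 r)\<^sup>2) has_real_derivative 2 * max 0 r) (at r)"
proof -
  consider "r > 0" | "r < 0" | "r = 0" by linarith
  then show ?thesis
  proof cases
    case 1
    have "((\<lambda>r::real. r\<^sup>2) has_real_derivative 2 * r) (at r)" by (auto intro!: derivative_eq_intros)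
    then show ?thesis using 1
      by (subst DERIV_cong_ev[OF refl _ refl, where g="\<lambda>r. r\<^sup>2"])
        (auto intro: eventually_mono[OF eventually_gt_at_top] simp: eventually_nhds intro!: exI[of _ "{0<..}"])
  next
    case 2
    have "((\<lambda>r::real. 0) has_real_derivative 0) (at r)" by simp
    then show ?thesis using 2
      by (subst DERIV_cong_ev[OF refl _ refl, where g="\<lambda>r. 0"])
        (auto simp: eventually_nhds intro!: exI[of _ "{..<0}"])
  next
    case 3
    have "((\<lambda>h::real. max 0 h) \<longlongrightarrow> max 0 0) (at 0)" by (intro tendsto_intros)
    then have "((\<lambda>h::real. max 0 h) \<longlongrightarrow> 0) (at 0)" by simp
    then have "((\<lambda>h::real. (max 0 h)\<^sup>2 / h) \<longlongrightarrow> 0) (at 0)"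
      by (rule Lim_transform_eventually)
         (auto simp: eventually_at_filter max_def power2_eq_square)
    then show ?thesis using 3 by (simp add: has_field_derivative_iff)
  qed
qed

lemma continuous_imp_integrable_torus:
  fixes f :: "real^'n \<Rightarrow> real"
  assumes "continuous_on UNIV f"
  shows "integrable torus f" "integral\<^sup>L torus f = cell_integral f"
proof -
  have "f absolutely_integrable_on cbox 0 1"
    by (rule absolutely_integrable_continuous) (rule continuous_on_subset[OF assms], simp)
  then show 1: "integrable torus f" by (rule absolutely_integrable_imp_integrable) simp
  show "integral\<^sup>L torus f = cell_integral f" by (rule lebesgue_integral_eq_integral[OF 1]) simp
qed

lemma periodic_gap_eq_0_iff:
  fixes x y :: "real^'n"
  assumes x: "x \<in> box 0 1" and y: "y \<in> cbox 0 1"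
  shows "periodic_gap x y = 0 \<longleftrightarrow> y = x"
proof
  assume 0: "periodic_gap x y = 0"
  have "y $ i = x $ i" for i
  proof -
    have "1 - cos (2 * pi * (y $ i - x $ i)) = 0"
      using 0 unfolding periodic_gap_def by (subst (asm) sum_nonneg_eq_0_iff) auto
    then obtain k :: int where "2 * pi * (y $ i - x $ i) = of_int k * (2 * pi)"
      by (auto simp: cos_one_2pi_int)
    then have "(2 * pi) * (y $ i - x $ i) = (2 * pi) * of_int k" by (simp only: mult.commute)
    then have k: "y $ i - x $ i = of_int k" by (subst (asm) mult_cancel_left) simp
    moreover have "0 < x $ i" "x $ i < 1" "0 \<le> y $ i" "y $ i \<le> 1"
      using x y by (auto simp: mem_box_cart)
    ultimately have "\<bar>real_of_int k\<bar> < 1" by linarith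
    then have "k = 0" by linarith
    then show ?thesis using k by simp
  qed
  then show "y = x" by (simp add: vec_eq_iff)
qed (simp add: periodic_gap_def)

text \<open>
  If the classical gradient were too long at an interior point x, its component in the direction e of
  the gradient at x would exceed b near x.  Testing the weak gradient with a bump supported there
  contradicts the bound b for the weak gradient.
\<close>

lemma W1inf_bounds_imp_grad_le:
  fixes f :: "real^'n \<Rightarrow> real"
  assumes f: "C1 f" "periodic f" and W: "W1inf_bounds f a b"
  shows "norm (grad f x) \<le> b"
proof -
  obtain g where g: "g \<in> borel_measurable torus" "weak_gradient f g" "AE x in torus. norm (g x) \<le> b"
    using W by (auto simp: W1inf_bounds_def)
  note cf = C1_continuous[OF f(1)] and cgf = C1_continuous_grad[OF f(1)]
  have interior: "norm (grad f x) \<le> b" if x: "x \<in> box 0 1" for x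
  proof (rule ccontr)
    assume contra: "\<not> norm (grad f x) \<le> b"
    define e where "e = sgn (grad f x)"
    have "0 \<le> b"
    proof (rule ccontr)
      assume "\<not> 0 \<le> b"
      then have "\<And>z. \<not> norm (g z) \<le> b" using norm_ge_zero order.trans by blast
      with g(3) have "AE x in (torus :: (real^'n) measure). False" by simp
      moreover have "(AE x in (torus :: (real^'n) measure). False) \<longleftrightarrow> emeasure (torus :: (real^'n) measure) (space torus) = 0"
        by (rule AE_iff_measurable[OF sets.top]) simp
      ultimately have "emeasure (torus :: (real^'n) measure) (space torus) = 0" by blast
      then have "measure lborel (cbox 0 (1::real^'n)) = 0" by (simp add: emeasure_restrict_space measure_def del: cell_measure)
      then show False by simp
    qed
    then have ne: "grad f x \<noteq> 0" using contra by auto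
    have e: "norm e = 1" "grad f x \<bullet> e = norm (grad f x)"
      using ne by (simp_all add: e_def norm_sgn sgn_div_norm dot_square_norm power2_eq_square)
    define F where "F y = grad f y \<bullet> e - b" for y
    have F: "continuous_on UNIV F" "0 < F x" using contra by (auto simp: F_def e intro!: continuous_intros cgf)
    define K where "K = cbox 0 1 \<inter> {y. F y \<le> 0}"
    have "compact K" unfolding K_def by (intro compact_Int_closed compact_cbox closed_Collect_le F continuous_intros)
    obtain \<delta> where \<delta>: "0 < \<delta>" "\<And>y. y \<in> K \<Longrightarrow> \<delta> \<le> periodic_gap x y"
    proof (cases "K = {}")
      case False
      have "continuous_on K (periodic_gap x)" by (rule periodic_gap_continuous_compose) (rule continuous_on_id)
      then obtain z where z: "z \<in> K" "\<And>y. y \<in> K \<Longrightarrow> periodic_gap x z \<le> periodic_gap x y"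
        using continuous_attains_inf[OF \<open>compact K\<close> False] by blast
      have "z \<noteq> x" using z(1) F(2) by (auto simp: K_def)
      then have "periodic_gap x z \<noteq> 0" using periodic_gap_eq_0_iff[OF x, of z] z(1) by (auto simp: K_def)
      then have "0 < periodic_gap x z" using periodic_gap_nonneg[of x z] by simp
      then show ?thesis using that z(2) by blast
    qed (use that[of 1] in auto)
    \<comment> \<open>A bump around x (and its periods): K is the part of the cell where the component does not exceed b,
      and the gap is at least \<delta> on K.\<close>
    define \<phi> where "\<phi> y = (max 0 (\<delta> - periodic_gap x y))\<^sup>2" for y
    have \<phi>: "C1 \<phi>" "periodic \<phi>"
    proof -
      have d: "((\<lambda>r. (max 0 (\<delta> - r))\<^sup>2) has_real_derivative (2 * max 0 (\<delta> - r)) * (- 1)) (at r)" for r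
        by (rule DERIV_chain2[where f="\<lambda>r. (max 0 r)\<^sup>2", OF DERIV_pos_part_square]) (auto intro!: derivative_eq_intros)
      have c: "continuous_on S (\<lambda>r. (2 * max 0 (\<delta> - r)) * (- 1))" for S :: "real set" by (intro continuous_intros)
      show "C1 \<phi>" unfolding \<phi>_def[abs_def] by (rule C1_compose(1)[OF C1_periodic_gap(1) d c])
      show "periodic \<phi>" using periodic_gap_periodic[of x] by (simp add: periodic_def \<phi>_def)
    qed
    note c\<phi> = C1_continuous[OF \<phi>(1)]
    have \<phi>_bounds: "0 \<le> \<phi> y" "\<phi> y \<le> \<delta>\<^sup>2" for y
      using \<delta>(1) periodic_gap_nonneg[of x y] by (auto simp: \<phi>_def intro!: power_mono)
    have int_f: "integrable torus (\<lambda>y. grad f y $ i * \<phi> y)" for i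
      by (intro continuous_imp_integrable_torus continuous_intros cgf c\<phi>)
    have int_g: "integrable torus (\<lambda>y. g y $ i * \<phi> y)" for i
    proof (rule finite_measure.integrable_const_bound)
      show "finite_measure (torus :: (real^'n) measure)" by (rule finite_measure_lebesgue_on) simp
      show "AE y in torus. norm (g y $ i * \<phi> y) \<le> b * \<delta>\<^sup>2"
        using g(3)
      proof eventually_elim
        case (elim y)
        then have "\<bar>g y $ i\<bar> \<le> b" using component_le_norm_cart[of "g y" i] by linarith
        then show ?case using \<phi>_bounds[of y] \<open>0 \<le> b\<close> by (simp add: abs_mult mult_mono)
      qed
      have "(\<lambda>y. g y \<bullet> axis i 1) \<in> borel_measurable torus" by (intro borel_measurable_inner g(1)) simp
      then have "(\<lambda>y. g y $ i) \<in> borel_measurable torus" by (simp add: inner_axis)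
      moreover have "\<phi> \<in> borel_measurable torus"
        by (rule continuous_imp_measurable_on_sets_lebesgue) (auto intro: continuous_on_subset[OF c\<phi>])
      ultimately show "(\<lambda>y. g y $ i * \<phi> y) \<in> borel_measurable torus" by (rule borel_measurable_times)
    qed
    have eq: "integral\<^sup>L torus (\<lambda>y. grad f y $ i * \<phi> y) = integral\<^sup>L torus (\<lambda>y. g y $ i * \<phi> y)" for i
    proof -
      have "cell_integral (\<lambda>y. grad (\<lambda>y. f y * \<phi> y) y $ i) = 0"
        by (intro cell_integral_grad_nth periodic_mult C1_mult f \<phi>)
      also have "(\<lambda>y. grad (\<lambda>y. f y * \<phi> y) y $ i) = (\<lambda>y. f y * grad \<phi> y $ i + grad f y $ i * \<phi> y)"
        unfolding grad_mult[OF f(1) \<phi>(1)] by (simp add: mult.commute[of "\<phi> _"])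
      finally have "cell_integral (\<lambda>y. f y * grad \<phi> y $ i) + cell_integral (\<lambda>y. grad f y $ i * \<phi> y) = 0"
        by (subst (asm) cell_integral_add) (intro continuous_intros cf cgf c\<phi> C1_continuous_grad[OF \<phi>(1)] | simp)+
      moreover have "cell_integral (\<lambda>y. f y * grad \<phi> y $ i) = integral\<^sup>L torus (\<lambda>y. f y * grad \<phi> y $ i)"
        by (intro continuous_imp_integrable_torus(2)[symmetric] continuous_intros cf C1_continuous_grad[OF \<phi>(1)])
      moreover have "integral\<^sup>L torus (\<lambda>y. f y * grad \<phi> y $ i) = - integral\<^sup>L torus (\<lambda>y. g y $ i * \<phi> y)"
        using g(2) \<phi> unfolding weak_gradient_def by blast
      moreover have "cell_integral (\<lambda>y. grad f y $ i * \<phi> y) = integral\<^sup>L torus (\<lambda>y. grad f y $ i * \<phi> y)"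
        by (intro continuous_imp_integrable_torus(2)[symmetric] continuous_intros cgf c\<phi>)
      ultimately show ?thesis by simp
    qed
    let ?h = "\<lambda>y. \<Sum>i\<in>UNIV. e $ i * (grad f y $ i * \<phi> y - g y $ i * \<phi> y)"
    have h: "?h y = (grad f y \<bullet> e - g y \<bullet> e) * \<phi> y" for y
      by (simp add: inner_vec_def sum_subtractf[symmetric] sum_distrib_left sum_distrib_right algebra_simps)
    have int_h: "integrable torus ?h" by (intro Bochner_Integration.integrable_sum integrable_mult_right Bochner_Integration.integrable_diff int_f int_g)
    have "integral\<^sup>L torus ?h = (\<Sum>i\<in>UNIV. e $ i * (integral\<^sup>L torus (\<lambda>y. grad f y $ i * \<phi> y) - integral\<^sup>L torus (\<lambda>y. g y $ i * \<phi> y)))"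
      by (subst Bochner_Integration.integral_sum) (auto intro!: integrable_mult_right Bochner_Integration.integrable_diff int_f int_g simp: int_f int_g)
    then have int0: "integral\<^sup>L torus ?h = 0" by (simp add: eq)
    have ge: "AE y in torus. g y \<bullet> e \<le> b"
      using g(3)
    proof eventually_elim
      case (elim y)
      then show ?case using norm_cauchy_schwarz[of "g y" e] e(1) by simp
    qed
    have sp: "AE y in torus. y \<in> cbox 0 1" using AE_space[of torus] by simp
    have "AE y in torus. 0 \<le> ?h y"
      using ge sp
    proof eventually_elim
      case (elim y)
      show ?case
      proof (cases "\<phi> y = 0")
        case False
        then have "\<not> \<delta> \<le> periodic_gap x y" by (auto simp: \<phi>_def max_def split: if_splits)
        then have "y \<notin> K" using \<delta>(2) by blast
        then have "b < grad f y \<bullet> e" using elim(2) by (simp add: K_def F_def)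
        then show ?thesis unfolding h using elim(1) \<phi>_bounds[of y] by simp
      qed (simp add: h)
    qed
    then have "AE y in torus. ?h y = 0" using integral_nonneg_eq_0_iff_AE[OF int_h] int0 by simp
    with ge have "AE y in torus. F y * \<phi> y \<le> 0"
    proof eventually_elim
      case (elim y)
      have "F y * \<phi> y \<le> (grad f y \<bullet> e - g y \<bullet> e) * \<phi> y"
        using elim(1) \<phi>_bounds[of y] by (intro mult_right_mono) (auto simp: F_def)
      also have "\<dots> = 0" using elim(2) by (simp only: h)
      finally show ?case .
    qed
    then have "F x * \<phi> x \<le> 0"
      by (intro AE_lebesgue_on_imp_interior_le[of "cbox 0 1" "\<lambda>y. F y * \<phi> y" "\<lambda>_. 0"])
        (use x in \<open>auto intro!: continuous_intros continuous_on_subset[OF F(1)] continuous_on_subset[OF c\<phi>]\<close>)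
    moreover have "0 < \<phi> x" using \<delta>(1) by (simp add: \<phi>_def periodic_gap_def)
    ultimately show False using F(2) by (simp add: mult_le_0_iff)
  qed
  then show ?thesis
    by (rule cell_le_everywhere[where g="\<lambda>_. b"])
      (use periodic_grad[OF f(2)] f(1) in \<open>auto intro!: continuous_intros cgf simp: periodic_def C1_def\<close>)
qed

lemma mfg_X_grad_le:
  fixes u m :: "real \<Rightarrow> real^'n \<Rightarrow> real"
  assumes X: "(u, m) \<in> mfg_X T M U" and u: "classical_regularity T u" and t: "t \<in> {0<..<T}"
  shows "norm (grad (u t) x) \<le> U"
proof -
  have per: "periodic (u s)" "C1 (u s)" if "s \<in> {0<..<T}" for s
    using u that by (auto simp: classical_regularity_def C2_def)
  obtain C where C: "AE s in lebesgue_on {0<..<T}. W1inf_bounds (u s) C U"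
    using X by (auto simp: mfg_X_def)
  have sp: "AE s in lebesgue_on {0<..<T}. s \<in> {0<..<T}" using AE_space[of "lebesgue_on {0<..<T}"] by simp
  have ae: "AE s in lebesgue_on {0<..<T}. norm (grad (u s) x) \<le> U"
    using C sp
  proof eventually_elim
    case (elim s)
    show ?case by (rule W1inf_bounds_imp_grad_le[OF per(2,1)[OF elim(2)] elim(1)])
  qed
  have "continuous_on ({0<..<T} \<times> UNIV) (\<lambda>(t, x). grad (u t) x)"
    using u by (simp add: classical_regularity_def)
  then have "continuous_on {0<..<T} (\<lambda>s. (\<lambda>(t, x). grad (u t) x) (s, x))"
    by (rule continuous_on_compose2) (auto intro!: continuous_intros)
  then have "continuous_on {0<..<T} (\<lambda>s. norm (grad (u s) x))" by (auto intro: continuous_intros)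
  then show ?thesis
    by (intro AE_lebesgue_on_imp_interior_le[OF _ ae]) (use t in \<open>auto intro: continuous_intros\<close>)
qed

text \<open>
  The essential bound passes to the interior by continuity, and from there to the closed time
  interval and to all periods.
\<close>

lemma mfg_X_density_le:
  fixes u m :: "real \<Rightarrow> real^'n \<Rightarrow> real"
  assumes X: "(u, m) \<in> mfg_X T M U" and m: "classical_regularity T m" and t: "t \<in> {0..T}" and T: "0 < T"
  shows "m t x \<le> M"
proof -
  let ?S = "{0<..<T} \<times> cbox (0::real^'n) 1" and ?I = "{0<..<T} \<times> box (0::real^'n) 1"
  have int: "interior ?S = ?I" by (simp add: interior_Times interior_open)
  have cl: "closure ?I = {0..T} \<times> cbox 0 1"
    using T by (simp add: closure_Times closure_cell)
  have cont: "continuous_on ({0..T} \<times> UNIV) (\<lambda>(t, x). m t x)"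
    using m by (simp add: classical_regularity_def)
  have ae: "AE z in lebesgue_on ?S. (case z of (t, x) \<Rightarrow> m t x) \<le> M"
    using X by (auto simp: mfg_X_def split_beta)
  have "(case z of (t, x) \<Rightarrow> m t x) \<le> M" if z: "z \<in> ?I" for z
  proof (rule AE_lebesgue_on_imp_interior_le[OF _ ae])
    show "?S \<in> sets lebesgue" by (intro sets_completionI_sets) (simp add: borel_Times)
    show "continuous_on (interior ?S) (\<lambda>z. case z of (t, x) \<Rightarrow> m t x)"
      unfolding int by (rule continuous_on_subset[OF cont]) auto
  qed (use z int in \<open>auto intro: continuous_intros\<close>)
  then have "(case z of (t, x) \<Rightarrow> m t x) \<le> M" if "z \<in> {0..T} \<times> cbox 0 1" for z
    using continuous_le_on_closure[of ?I "\<lambda>(t, x). m t x" z M] that continuous_on_subset[OF cont, of "{0..T} \<times> cbox 0 1"]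
    unfolding cl by blast
  then have "m t y \<le> M" if "y \<in> box 0 1" for y
    using t that box_subset_cbox by fastforce
  then show ?thesis
    by (rule cell_le_everywhere[where g="\<lambda>_. M"])
      (use m t continuous_on_section[OF cont t] in \<open>auto simp: classical_regularity_def periodic_def\<close>)
qed

section \<open>Absorbing the non-monotone part\<close>

context density_pair
begin

text \<open>
  The functional f + \<theta> S has derivative at most -\<gamma> \<integral>(m1 - m2)^2, up to terms of order \<epsilon>, and it is
  nonnegative at T.  Before time 2 the gain comes from the decrease of the weight \<theta>, afterwards from
  the decay of S.  The smallness of \<gamma> ensures that \<theta> times the source term of S is absorbed by the
  Lasry-Lions term.
\<close>

lemma densities_agree:
  fixes f :: "real \<Rightarrow> real"
  assumes T: "0 < T" and c: "0 < c" "\<And>t x. 2 \<le> t \<Longrightarrow> t < T \<Longrightarrow> c \<le> m1 t x"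
    and init: "\<And>x. m1 0 x = m2 0 x"
    and f: "continuous_on {0..T} f" "f 0 = 0" "- \<gamma> * cell_integral (\<lambda>x. (m1 T x - m2 T x)\<^sup>2) \<le> f T"
    and f': "\<And>t. t \<in> {0<..<T} \<Longrightarrow> \<exists>D. (f has_real_derivative D) (at t) \<and>
        D \<le> \<gamma> * cell_integral (\<lambda>x. (m1 t x - m2 t x)\<^sup>2)
          - \<alpha> / 2 * cell_integral (\<lambda>x. (m1 t x + m2 t x) * (g t x)\<^sup>2)"
    and \<gamma>: "0 < \<gamma>"
    and small: "(2 * M + 1) * \<gamma> * ((2 * M + 1) * real CARD('n) * 2 / (\<kappa> * c) + 1 + 2 * exp 2) * (\<beta>\<^sup>2 / (2 * \<kappa>)) \<le> \<alpha> / 2"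
    and t: "t \<in> {0..T}"
  shows "m1 t x = m2 t x"
proof -
  note k = d1.kappa_pos
  define n where "n = real CARD('n)"
  have n: "0 < n" by (simp add: n_def)
  have M: "0 \<le> M" using d1.M_nonneg T by simp
  define a0 where "a0 = (2 * M + 1) * n * 2 / (\<kappa> * c) + 1"
  define b0 where "b0 = 2 * exp (2::real)"
  define \<gamma>' where "\<gamma>' = (2 * M + 1) * \<gamma>"
  have pos: "1 \<le> a0" "0 < b0" "0 < \<gamma>'" using M n k c \<gamma> by (auto simp: a0_def b0_def \<gamma>'_def intro!: mult_pos_pos)
  \<comment> \<open>On [0, 2] the derivative of the weight is at most -2\<gamma>'.  For all t the weight is at least \<gamma>' a0,
    which makes the decay of S worth 2\<gamma>' S and dominates the terminal term.\<close>
  define \<theta> where "\<theta> t = \<gamma>' * (a0 + b0 * exp (- t))" for t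
  define \<theta>max where "\<theta>max = \<gamma>' * (a0 + b0)"
  have \<theta>: "\<gamma>' * a0 \<le> \<theta> t" "0 < \<theta> t" for t
    using pos by (auto simp: \<theta>_def algebra_simps intro!: add_pos_pos mult_pos_pos)
  have \<theta>_le: "\<theta> t \<le> \<theta>max" if "0 \<le> t" for t
    unfolding \<theta>_def \<theta>max_def using pos that by (intro mult_left_mono add_left_mono) (auto simp: mult_le_cancel_left1)
  have small': "\<theta>max * (\<beta>\<^sup>2 / (2 * \<kappa>)) \<le> \<alpha> / 2"
    using small by (simp add: \<theta>max_def \<gamma>'_def a0_def b0_def n_def)
  let ?q = "\<lambda>t. cell_integral (\<lambda>x. (m1 t x - m2 t x)\<^sup>2)"
  let ?a = "\<lambda>t. cell_integral (\<lambda>x. (m1 t x + m2 t x) * (g t x)\<^sup>2)"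
  have cq: "continuous_on {0..T} ?q"
    by (rule cell_integral_continuous_on, unfold split_beta)
      (intro continuous_intros d1.density_continuous_compose d2.density_continuous_compose; auto)
  have section_cont: "continuous_on UNIV (\<lambda>x. (m1 t x - m2 t x)\<^sup>2)" if "t \<in> {0..T}" for t
    using that by (intro continuous_intros d1.density_continuous_compose d2.density_continuous_compose) auto
  have q0: "0 \<le> ?q t" if "t \<in> {0..T}" for t
    by (intro cell_integral_nonneg section_cont that) simp
  define K where "K = \<theta>max * (2 * L\<^sup>2 / \<kappa>)"
  have main: "\<gamma> * integral {0..T} ?q \<le> K * T * \<epsilon>" if \<epsilon>: "0 < \<epsilon>" "\<epsilon> \<le> 1" for \<epsilon>
  proof -
    let ?S = "discrimination \<epsilon>"
    have S0: "0 \<le> ?S t" if "t \<in> {0..T}" for t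
    proof -
      have "0 \<le> (2 * M + 1) * ?S t" using q0[OF that] difference_le_discrimination[OF that \<epsilon>] by linarith
      then show ?thesis using M by (simp add: zero_le_mult_iff)
    qed
    let ?\<Psi> = "\<lambda>t. f t + \<theta> t * ?S t + \<gamma> * integral {0..t} ?q - K * \<epsilon> * t"
    have "?\<Psi> T \<le> ?\<Psi> 0"
    proof (rule DERIV_nonpos_imp_decreasing_open[where f="?\<Psi>"])
      show "0 \<le> T" using T by simp
      have "continuous_on {0..T} (\<lambda>t. integral {0..t} ?q)"
        by (rule indefinite_integral_continuous_1[OF integrable_continuous_interval[OF cq]])
      then show "continuous_on {0..T} ?\<Psi>"
        unfolding \<theta>_def by (intro continuous_intros f discrimination_continuous \<epsilon>)
      fix t assume "0 < t" "t < T"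
      then have t: "t \<in> {0<..<T}" and tc: "t \<in> {0..T}" by auto
      obtain Df where Df: "(f has_real_derivative Df) (at t)" "Df \<le> \<gamma> * ?q t - \<alpha> / 2 * ?a t"
        using f'[OF t] by blast
      let ?G = "cell_integral (\<lambda>x. \<sigma> \<epsilon> t x * (norm (grad (ratio \<epsilon> t) x))\<^sup>2)"
      obtain DS where DS: "(?S has_real_derivative DS) (at t)"
        "DS \<le> - \<kappa> * ?G + \<beta>\<^sup>2 / (2 * \<kappa>) * ?a t + 2 * \<epsilon> * L\<^sup>2 / \<kappa>"
        using discrimination_has_derivative[OF t \<epsilon>(1)] by blast
      have "((\<lambda>t. integral {0..t} ?q) has_real_derivative ?q t) (at t within {0..T})"
        using integral_has_vector_derivative[OF cq tc] by (simp add: has_real_derivative_iff_has_vector_derivative)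
      then have Dq: "((\<lambda>t. integral {0..t} ?q) has_real_derivative ?q t) (at t)"
        using t by (simp add: at_within_Icc_at)
      have D\<theta>: "(\<theta> has_real_derivative - (\<gamma>' * b0 * exp (- t))) (at t)"
        unfolding \<theta>_def[abs_def] by (auto intro!: derivative_eq_intros)
      have D: "(?\<Psi> has_real_derivative Df + (- (\<gamma>' * b0 * exp (- t)) * ?S t + DS * \<theta> t) + \<gamma> * ?q t - K * \<epsilon> * 1) (at t)"
        by (intro DERIV_add DERIV_diff DERIV_mult DERIV_cmult DERIV_ident Df DS D\<theta> Dq)
      have a0': "0 \<le> ?a t"
        by (intro cell_integral_nonneg mult_nonneg_nonneg add_nonneg_nonneg zero_le_power2 d1.density_nonneg d2.density_nonneg tc
            continuous_intros C1_continuous[OF d1.density_C1[OF t]] C1_continuous[OF d2.density_C1[OF t]] gap_continuous[OF t])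
      have G0: "0 \<le> ?G"
        by (intro cell_integral_nonneg mult_nonneg_nonneg less_imp_le[OF \<sigma>_pos] tc \<epsilon>
            continuous_intros C1_continuous C1_continuous_grad \<sigma>_C1 ratio_C1 t) auto
      have q_le: "\<gamma> * ?q t \<le> \<gamma>' * ?S t"
        using mult_left_mono[OF difference_le_discrimination[OF tc \<epsilon>], of \<gamma>] \<gamma> by (simp add: \<gamma>'_def algebra_simps)
      have 1: "DS * \<theta> t \<le> - \<kappa> * ?G * \<theta> t + \<alpha> / 2 * ?a t + K * \<epsilon>"
      proof -
        have "DS * \<theta> t \<le> (- \<kappa> * ?G + \<beta>\<^sup>2 / (2 * \<kappa>) * ?a t + 2 * \<epsilon> * L\<^sup>2 / \<kappa>) * \<theta> t"
          using DS(2) \<theta>(2)[of t] by (intro mult_right_mono) auto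
        also have "\<dots> = - \<kappa> * ?G * \<theta> t + \<theta> t * (\<beta>\<^sup>2 / (2 * \<kappa>) * ?a t) + \<theta> t * (2 * \<epsilon> * L\<^sup>2 / \<kappa>)"
          by (simp add: algebra_simps)
        also have "\<theta> t * (\<beta>\<^sup>2 / (2 * \<kappa>) * ?a t) \<le> \<theta>max * (\<beta>\<^sup>2 / (2 * \<kappa>) * ?a t)"
          using \<theta>_le[of t] tc k a0' by (intro mult_right_mono mult_nonneg_nonneg) auto
        also have "\<theta>max * (\<beta>\<^sup>2 / (2 * \<kappa>) * ?a t) = (\<theta>max * (\<beta>\<^sup>2 / (2 * \<kappa>))) * ?a t" by simp
        also have "\<dots> \<le> \<alpha> / 2 * ?a t" by (rule mult_right_mono[OF small' a0'])
        also have "\<theta> t * (2 * \<epsilon> * L\<^sup>2 / \<kappa>) \<le> \<theta>max * (2 * \<epsilon> * L\<^sup>2 / \<kappa>)"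
          using \<theta>_le[of t] tc k \<epsilon> by (intro mult_right_mono) auto
        finally show ?thesis by (simp add: K_def algebra_simps)
      qed
      have 2: "2 * \<gamma>' * ?S t \<le> \<gamma>' * b0 * exp (- t) * ?S t + \<kappa> * ?G * \<theta> t"
      proof (cases "t < 2")
        case True
        \<comment> \<open>no lower bound on the densities yet: the decrease of the weight is used\<close>
        have "1 \<le> exp (2 - t)" using True by simp
        then have "2 \<le> b0 * exp (- t)" by (simp add: b0_def exp_diff exp_minus divide_inverse)
        then have "\<gamma>' * ?S t * 2 \<le> \<gamma>' * ?S t * (b0 * exp (- t))" using pos S0[OF tc] by (intro mult_left_mono) auto
        moreover have "0 \<le> \<kappa> * ?G * \<theta> t" using k G0 \<theta>(2)[of t] by simp
        ultimately show ?thesis by (simp add: algebra_simps)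
      next
        case False
        then have "?S t \<le> (2 * M + 1) * n / c * ?G"
          unfolding n_def using t by (intro discrimination_le_dissipation[OF t \<epsilon> c(1)] c(2)) auto
        then have "2 * \<gamma>' * ?S t \<le> 2 * \<gamma>' * ((2 * M + 1) * n / c * ?G)" using pos by (intro mult_left_mono) auto
        also have "\<dots> = \<kappa> * ?G * (\<gamma>' * (a0 - 1))" using k c by (simp add: a0_def field_simps)
        also have "\<dots> \<le> \<kappa> * ?G * \<theta> t"
          using k G0 \<theta>(1)[of t] pos by (intro mult_left_mono) (auto simp: algebra_simps)
        finally show ?thesis using pos S0[OF tc] by (simp add: add_increasing)
      qed
      have "Df + (- (\<gamma>' * b0 * exp (- t)) * ?S t + DS * \<theta> t) + \<gamma> * ?q t - K * \<epsilon> * 1 \<le> 0"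
        using Df(2) 1 2 q_le by (simp add: algebra_simps)
      then show "\<exists>y. (?\<Psi> has_real_derivative y) (at t) \<and> y \<le> 0" using D by blast
    qed
    moreover have "?\<Psi> 0 = 0" using f(2) init by (simp add: discrimination_def ratio_def)
    moreover have "0 \<le> f T + \<theta> T * ?S T"
    proof -
      have "\<gamma> * ?q T \<le> \<gamma>' * ?S T"
        using mult_left_mono[OF difference_le_discrimination[of T, OF _ \<epsilon>], of \<gamma>] \<gamma> T by (simp add: \<gamma>'_def algebra_simps)
      also have "\<dots> \<le> \<theta> T * ?S T"
      proof (rule mult_right_mono)
        have "\<gamma>' * 1 \<le> \<gamma>' * a0" using pos by (intro mult_left_mono) auto
        then show "\<gamma>' \<le> \<theta> T" using \<theta>(1)[of T] by simp
      qed (use S0[of T] T in auto)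
      finally show ?thesis using f(3) by simp
    qed
    ultimately show ?thesis by (simp add: algebra_simps)
  qed
  have "integral {0..T} ?q \<le> 0"
  proof (rule ccontr)
    assume "\<not> integral {0..T} ?q \<le> 0"
    then have I: "0 < \<gamma> * integral {0..T} ?q" using \<gamma> by simp
    define \<epsilon> where "\<epsilon> = min 1 (\<gamma> * integral {0..T} ?q / (2 * (\<bar>K * T\<bar> + 1)))"
    have \<epsilon>: "0 < \<epsilon>" "\<epsilon> \<le> 1" using I by (auto simp: \<epsilon>_def)
    have "\<gamma> * integral {0..T} ?q \<le> K * T * \<epsilon>" by (rule main[OF \<epsilon>])
    also have "\<dots> \<le> (\<bar>K * T\<bar> + 1) * \<epsilon>" using \<epsilon> by (intro mult_right_mono) auto
    also have "\<dots> \<le> (\<bar>K * T\<bar> + 1) * (\<gamma> * integral {0..T} ?q / (2 * (\<bar>K * T\<bar> + 1)))"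
      by (rule mult_left_mono) (auto simp: \<epsilon>_def)
    also have "\<dots> = \<gamma> * integral {0..T} ?q / 2" by (simp add: field_simps)
    finally show False using I by simp
  qed
  moreover have "0 \<le> integral {0..T} ?q"
    by (intro integral_nonneg integrable_continuous_interval cq q0)
  ultimately have "(?q has_integral 0) (cbox 0 T)"
    using integrable_integral[OF integrable_continuous_interval[OF cq]] by simp
  then have "?q t = 0"
    by (intro has_integral_0_cbox_imp_0[of 0 T ?q]) (use cq q0 T t in auto)
  then show ?thesis
    by (intro cell_integral_square_eq_0[of "m1 t" "m2 t"] continuous_on_section[OF d1.density_continuous t]
        continuous_on_section[OF d2.density_continuous t] d1.density_periodic[OF t] d2.density_periodic[OF t]) simp
qed

end

section \<open>The mean field game system\<close>

lemma classical_regularityD: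
  assumes "classical_regularity T v"
  shows "t \<in> {0..T} \<Longrightarrow> periodic (v t)"
    and "continuous_on ({0..T} \<times> UNIV) (\<lambda>(t, x). v t x)"
    and "t \<in> {0<..<T} \<Longrightarrow> ((\<lambda>s. v s x) has_real_derivative deriv (\<lambda>s. v s x) t) (at t)"
    and "t \<in> {0<..<T} \<Longrightarrow> C2 (v t)"
    and "continuous_on ({0<..<T} \<times> UNIV) (\<lambda>(t, x). deriv (\<lambda>s. v s x) t)"
    and "t \<in> {0<..<T} \<Longrightarrow> C1 (v t)"
    and "t \<in> {0<..<T} \<Longrightarrow> periodic (grad (v t))"
proof -
  show p: "t \<in> {0..T} \<Longrightarrow> periodic (v t)" for t using assms by (simp add: classical_regularity_def)
  show "t \<in> {0<..<T} \<Longrightarrow> ((\<lambda>s. v s x) has_real_derivative deriv (\<lambda>s. v s x) t) (at t)"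
    using assms by (simp add: classical_regularity_def DERIV_deriv_iff_real_differentiable)
  show c: "t \<in> {0<..<T} \<Longrightarrow> C2 (v t)" using assms by (simp add: classical_regularity_def)
  then show "t \<in> {0<..<T} \<Longrightarrow> C1 (v t)" by (simp add: C2_def)
  show "t \<in> {0<..<T} \<Longrightarrow> periodic (grad (v t))"
    using p[of t] c by (intro periodic_grad) (auto simp: C2_def C1_def)
qed (use assms in \<open>auto simp: classical_regularity_def\<close>)

abbreviation transport :: "(real^'n \<Rightarrow> real^'n \<Rightarrow> real) \<Rightarrow> (real \<Rightarrow> real^'n \<Rightarrow> real) \<Rightarrow> (real \<Rightarrow> real^'n \<Rightarrow> real)
    \<Rightarrow> real \<Rightarrow> real^'n \<Rightarrow> real^'n" where
  "transport H u m t y \<equiv> m t y *\<^sub>R grad (H y) (grad (u t) y)"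

lemma hamiltonian_periodic: "hamiltonian H L \<alpha> \<beta> \<Longrightarrow> periodic H"
  by (auto simp: hamiltonian_def periodic_def fun_eq_iff)

lemma hamiltonian_AE_ball:
  fixes H :: "real^'n \<Rightarrow> real^'n \<Rightarrow> real"
  assumes "hamiltonian H L \<alpha> \<beta>" "0 < U"
  shows "AE x in torus. C2 (H x) \<and> (\<forall>p. norm p \<le> U \<longrightarrow> norm (grad (H x) p) \<le> L U \<and>
      (\<forall>\<xi>. \<alpha> U * (\<xi> \<bullet> \<xi>) \<le> \<xi> \<bullet> (hessian (H x) p *v \<xi>) \<and> \<xi> \<bullet> (hessian (H x) p *v \<xi>) \<le> \<beta> U * (\<xi> \<bullet> \<xi>)))"
proof -
  have "AE x in torus. \<forall>K>0. \<forall>p. norm p \<le> K \<longrightarrow>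
        norm (grad (H x) p) \<le> L K \<and>
        (\<forall>\<xi>. \<alpha> K * (\<xi> \<bullet> \<xi>) \<le> \<xi> \<bullet> (hessian (H x) p *v \<xi>) \<and>
             \<xi> \<bullet> (hessian (H x) p *v \<xi>) \<le> \<beta> K * (\<xi> \<bullet> \<xi>))"
    using assms(1) by (simp add: hamiltonian_def)
  then show ?thesis
    by eventually_elim (use assms in \<open>auto simp: hamiltonian_def\<close>)
qed

text \<open>
  The equation for m has the flux \<kappa> Dm + m H_p(x, Du), whose drift is bounded by L(U) because
  |Du| \<le> U.
\<close>

lemma mfg_solution_density:
  fixes u m :: "real \<Rightarrow> real^'n \<Rightarrow> real"
  assumes \<kappa>: "0 < \<kappa>" and T: "0 < T" and U: "0 < U" and H: "hamiltonian H L \<alpha> \<beta>"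
    and sol: "mfg_classical_solution \<kappa> T H F G m0 u m" and X: "(u, m) \<in> mfg_X T M U"
  shows "bounded_drift_density \<kappa> T m (transport H u m) M (L U)"
proof -
  have reg: "classical_regularity T u" "classical_regularity T m"
    and prob: "\<And>t. t \<in> {0..T} \<Longrightarrow> prob_density (m t)"
    and C1V: "\<And>t i. t \<in> {0<..<T} \<Longrightarrow> C1 (\<lambda>x. transport H u m t x $ i)"
    using sol by (auto simp: mfg_classical_solution_def)
  note um = classical_regularityD[OF reg(1)] and mm = classical_regularityD[OF reg(2)]
  have perV: "periodic (transport H u m t)" if "t \<in> {0<..<T}" for t
    using um(7)[OF that] mm(1)[of t] hamiltonian_periodic[OF H] that by (simp add: periodic_def)
  have nonneg: "0 \<le> m t x" if "t \<in> {0..T}" for t x using prob[OF that] by (simp add: prob_density_def)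
  show ?thesis
  proof
    show "deriv (\<lambda>s. m s x) t = divergence (\<lambda>y. \<kappa> *\<^sub>R grad (m t) y + transport H u m t y) x" if t: "t \<in> {0<..<T}" for t x
    proof -
      have "deriv (\<lambda>s. m s x) t - \<kappa> * laplacian (m t) x - divergence (transport H u m t) x = 0"
        using sol t by (simp add: mfg_classical_solution_def)
      then show ?thesis
        using divergence_add_scaleR[of "grad (m t)" "transport H u m t" \<kappa> x, OF C2_C1_grad_nth[OF mm(4)[OF t]] C1V[OF t]]
        by (simp add: laplacian_eq_divergence)
    qed
    show "m t x \<le> M" if "t \<in> {0..T}" for t x by (rule mfg_X_density_le[OF X reg(2) that T])
    show "cell_integral (m t) = 1" if "t \<in> {0..T}" for t
      using prob[OF that] lebesgue_integral_eq_integral[of "cbox 0 1" "m t"] by (simp add: prob_density_def)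
    show "norm (transport H u m t x) \<le> L U * m t x" if t: "t \<in> {0<..<T}" for t x
    proof (rule AE_torus_imp_le[where f="\<lambda>x. norm (transport H u m t x)"])
      show "AE x in torus. norm (transport H u m t x) \<le> L U * m t x"
        using hamiltonian_AE_ball[OF H U]
      proof eventually_elim
        case (elim x)
        then have "norm (grad (H x) (grad (u t) x)) \<le> L U" using mfg_X_grad_le[OF X reg(1) t] by blast
        then show ?case
          using mult_right_mono[of "norm (grad (H x) (grad (u t) x))" "L U" "m t x"] nonneg[of t x] t by (simp add: mult.commute)
      qed
      show "periodic (\<lambda>x. norm (transport H u m t x))" "periodic (\<lambda>x. L U * m t x)"
        using um(7)[OF t] mm(1)[of t] hamiltonian_periodic[OF H] t by (simp_all add: periodic_def)
    qed (intro continuous_intros C1_components_continuous C1V C1_continuous mm(6) t)+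
    show "0 \<le> L U" using H U by (auto simp: hamiltonian_def less_imp_le)
  qed (use \<kappa> reg perV C1V nonneg in auto)
qed

lemma mono_coupling_gap:
  fixes F :: "real \<Rightarrow> real"
  assumes mono: "mono_on {0..M} (\<lambda>m. F m + \<gamma> * m)" and m: "0 \<le> a" "a \<le> M" "0 \<le> b" "b \<le> M"
  shows "- \<gamma> * (a - b)\<^sup>2 \<le> (F a - F b) * (a - b)"
proof -
  have "0 \<le> ((F a + \<gamma> * a) - (F b + \<gamma> * b)) * (a - b)"
  proof (cases "a \<le> b")
    case True
    then have "F a + \<gamma> * a \<le> F b + \<gamma> * b" using mono_onD[OF mono, of a b] m by auto
    then show ?thesis using True by (intro mult_nonpos_nonpos) auto
  next
    case False
    then have "F b + \<gamma> * b \<le> F a + \<gamma> * a" using mono_onD[OF mono, of b a] m by auto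
    then show ?thesis using False by (intro mult_nonneg_nonneg) auto
  qed
  then show ?thesis by (simp add: power2_eq_square algebra_simps)
qed

text \<open>
  Two solutions with common data.  Below, heat denotes the backward heat operator applied to w, with
  \<kappa> as diffusivity; by the equations it contains only the differences of the Hamiltonians and of the
  couplings.
\<close>

locale mfg_solutions =
  fixes \<kappa> T M U :: real and H :: "real^'n \<Rightarrow> real^'n \<Rightarrow> real" and L \<alpha> \<beta> :: "real \<Rightarrow> real"
    and F G :: "real^'n \<Rightarrow> real \<Rightarrow> real" and m0 :: "real^'n \<Rightarrow> real"
    and u1 m1 u2 m2 :: "real \<Rightarrow> real^'n \<Rightarrow> real"
  assumes kappa: "0 < \<kappa>" and T: "0 < T" and U: "0 < U" and H: "hamiltonian H L \<alpha> \<beta>"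
    and sol1: "mfg_classical_solution \<kappa> T H F G m0 u1 m1" and X1: "(u1, m1) \<in> mfg_X T M U"
    and sol2: "mfg_classical_solution \<kappa> T H F G m0 u2 m2" and X2: "(u2, m2) \<in> mfg_X T M U"
begin

abbreviation "w t x \<equiv> u1 t x - u2 t x"
abbreviation "\<mu> t x \<equiv> m1 t x - m2 t x"
abbreviation "dw t x \<equiv> grad (u1 t) x - grad (u2 t) x"

abbreviation "heat t x \<equiv>
  deriv (\<lambda>s. u1 s x) t - deriv (\<lambda>s. u2 s x) t + \<kappa> * (laplacian (u1 t) x - laplacian (u2 t) x)"

lemma regular: "classical_regularity T u1" "classical_regularity T u2"
  using sol1 sol2 by (auto simp: mfg_classical_solution_def)

lemmas u1 = classical_regularityD[OF regular(1)]
lemmas u2 = classical_regularityD[OF regular(2)]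
lemmas grad_bounds = mfg_X_grad_le[OF X1 regular(1)] mfg_X_grad_le[OF X2 regular(2)]
lemmas ball = hamiltonian_AE_ball[OF H U]

lemma u_sections:
  assumes "t \<in> {0..T}"
  shows "continuous_on UNIV (u1 t)" "continuous_on UNIV (u2 t)"
  using continuous_on_section[OF u1(2) assms] continuous_on_section[OF u2(2) assms] by auto

lemma w_C1:
  assumes "t \<in> {0<..<T}"
  shows "C1 (w t)" "grad (w t) x = dw t x" "periodic (w t)"
  using u1(1)[of t] u2(1)[of t] assms
  by (auto simp: periodic_def intro!: C1_diff grad_diff u1(6) u2(6))

lemma heat_continuous: "t \<in> {0<..<T} \<Longrightarrow> continuous_on UNIV (heat t)"
  by (intro continuous_intros laplacian_continuous u1(4) u2(4) continuous_on_section[OF u1(5)] continuous_on_section[OF u2(5)])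

lemma heat_eq:
  assumes "t \<in> {0<..<T}"
  shows "heat t x = (H x (grad (u1 t) x) - H x (grad (u2 t) x)) - (F x (m1 t x) - F x (m2 t x))"
proof -
  have "- deriv (\<lambda>s. u1 s x) t - \<kappa> * laplacian (u1 t) x + H x (grad (u1 t) x) = F x (m1 t x)"
    "- deriv (\<lambda>s. u2 s x) t - \<kappa> * laplacian (u2 t) x + H x (grad (u2 t) x) = F x (m2 t x)"
    using sol1 sol2 assms by (auto simp: mfg_classical_solution_def)
  then show ?thesis by (simp add: algebra_simps)
qed

lemma heat_by_parts:
  assumes t: "t \<in> {0<..<T}" and f: "C1 f" "periodic f"
  shows "cell_integral (\<lambda>x. (deriv (\<lambda>s. u1 s x) t - deriv (\<lambda>s. u2 s x) t) * f x)
    = cell_integral (\<lambda>x. heat t x * f x + \<kappa> * (grad f x \<bullet> dw t x))"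
proof -
  note C1g = C2_C1_grad_nth[OF u1(4)[OF t]] C2_C1_grad_nth[OF u2(4)[OF t]]
  note cs = continuous_intros heat_continuous[OF t] C1_continuous[OF f(1)] C1_continuous_grad[OF f(1)]
    C1_continuous_grad[OF u1(6)[OF t]] C1_continuous_grad[OF u2(6)[OF t]]
    laplacian_continuous[OF u1(4)[OF t]] laplacian_continuous[OF u2(4)[OF t]]
  define l1 where "l1 x = f x * laplacian (u1 t) x + grad f x \<bullet> grad (u1 t) x" for x
  define l2 where "l2 x = f x * laplacian (u2 t) x + grad f x \<bullet> grad (u2 t) x" for x
  have cl: "continuous_on UNIV l1" "continuous_on UNIV l2"
    unfolding l1_def[abs_def] l2_def[abs_def] by (intro cs)+
  have "cell_integral l1 = 0" "cell_integral l2 = 0"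
    unfolding l1_def[abs_def] l2_def[abs_def] laplacian_eq_divergence
    by (subst cell_integral_add; (intro cs C1_components_continuous C1g)?;
        simp add: cell_integral_by_parts[OF f(2,1) u1(7)[OF t] C1g(1)] cell_integral_by_parts[OF f(2,1) u2(7)[OF t] C1g(2)])+
  then have "cell_integral (\<lambda>x. - \<kappa> * l1 x + \<kappa> * l2 x + 0) = 0"
    by (subst cell_integral_affine[OF cl]) simp
  then have "cell_integral (\<lambda>x. (heat t x * f x + \<kappa> * (grad f x \<bullet> dw t x)) + (- \<kappa> * l1 x + \<kappa> * l2 x + 0))
    = cell_integral (\<lambda>x. heat t x * f x + \<kappa> * (grad f x \<bullet> dw t x))"
    by (subst cell_integral_add; (intro cs cl)?; simp)
  also have "(\<lambda>x. (heat t x * f x + \<kappa> * (grad f x \<bullet> dw t x)) + (- \<kappa> * l1 x + \<kappa> * l2 x + 0))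
    = (\<lambda>x. (deriv (\<lambda>s. u1 s x) t - deriv (\<lambda>s. u2 s x) t) * f x)"
    by (rule ext) (simp add: l1_def l2_def inner_diff_right algebra_simps)
  finally show ?thesis .
qed

end

text \<open>
  For almost every x, H_p(x, p) is Lipschitz in p with constant \<beta>(U) on the ball of radius U.
  Multiplied by the densities, the two sides of this estimate become continuous, so that it holds at
  every point.
\<close>

sublocale mfg_solutions \<subseteq> density_pair \<kappa> T m1 m2 "transport H u1 m1" "transport H u2 m2" M "L U" "\<beta> U" "\<lambda>t x. norm (dw t x)"
proof -
  interpret d1: bounded_drift_density \<kappa> T m1 "transport H u1 m1" M "L U"
    by (rule mfg_solution_density[OF kappa T U H sol1 X1])
  interpret d2: bounded_drift_density \<kappa> T m2 "transport H u2 m2" M "L U"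
    by (rule mfg_solution_density[OF kappa T U H sol2 X2])
  have \<alpha>\<beta>: "0 < \<alpha> U" "0 < \<beta> U" using H U by (auto simp: hamiltonian_def)
  have gap_cont: "continuous_on UNIV (\<lambda>x. norm (dw t x))" if "t \<in> {0<..<T}" for t
    by (intro continuous_intros C1_continuous_grad u1(6) u2(6) that)
  show "density_pair \<kappa> T m1 m2 (transport H u1 m1) (transport H u2 m2) M (L U) (\<beta> U) (\<lambda>t x. norm (dw t x))"
  proof
    fix t x assume t: "t \<in> {0<..<T}"
    then have tc: "t \<in> {0..T}" by auto
    let ?Z = "\<lambda>x. m2 t x *\<^sub>R transport H u1 m1 t x - m1 t x *\<^sub>R transport H u2 m2 t x"
    let ?R = "\<lambda>x. \<beta> U * (m1 t x * m2 t x) * norm (dw t x)"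
    show "norm (?Z x) \<le> ?R x"
    proof (rule AE_torus_imp_le[where f="\<lambda>x. norm (?Z x)" and g="?R"])
      show "AE x in torus. norm (?Z x) \<le> ?R x"
        using ball
      proof eventually_elim
        case (elim x)
        let ?p1 = "grad (u1 t) x" and ?p2 = "grad (u2 t) x"
        have p: "norm ?p1 \<le> U" "norm ?p2 \<le> U"
          using grad_bounds t by auto
        have low: "0 \<le> \<xi> \<bullet> (hessian (H x) p *v \<xi>)" if "norm p \<le> U" for p \<xi>
        proof -
          have "0 \<le> \<alpha> U * (\<xi> \<bullet> \<xi>)" using \<alpha>\<beta> by simp
          then show ?thesis using elim that by (meson order.trans)
        qed
        have "norm (grad (H x) ?p1 - grad (H x) ?p2) \<le> \<beta> U * norm (?p1 - ?p2)"
          by (rule grad_lipschitz_on_ball[OF _ low _ p(2,1)]) (use elim in auto)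
        moreover have "?Z x = (m1 t x * m2 t x) *\<^sub>R (grad (H x) ?p1 - grad (H x) ?p2)"
          by (simp add: scaleR_diff_right mult.commute)
        then have "norm (?Z x) = m1 t x * m2 t x * norm (grad (H x) ?p1 - grad (H x) ?p2)"
          using d1.density_nonneg[OF tc] d2.density_nonneg[OF tc] by simp
        ultimately show ?case
          using mult_left_mono[of "norm (grad (H x) ?p1 - grad (H x) ?p2)" "\<beta> U * norm (?p1 - ?p2)" "m1 t x * m2 t x"]
            d1.density_nonneg[OF tc, of x] d2.density_nonneg[OF tc, of x] by (simp add: mult_ac)
      qed
      show "continuous_on UNIV (\<lambda>x. norm (?Z x))"
        by (intro continuous_intros C1_continuous[OF d1.density_C1[OF t]] C1_continuous[OF d2.density_C1[OF t]]
            C1_components_continuous d1.V_C1[OF t] d2.V_C1[OF t])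
      show "continuous_on UNIV ?R"
        by (intro continuous_on_mult continuous_on_const C1_continuous[OF d1.density_C1[OF t]] C1_continuous[OF d2.density_C1[OF t]] gap_cont[OF t])
      show "periodic (\<lambda>x. norm (?Z x))" "periodic ?R"
        using d1.density_periodic[OF tc] d2.density_periodic[OF tc] hamiltonian_periodic[OF H] u1(7)[OF t] u2(7)[OF t]
        by (simp_all add: periodic_def)
    qed
  qed (use \<alpha>\<beta> gap_cont in auto)
qed

context mfg_solutions
begin

text \<open>
  After integration by parts the integrand is \<mu> times the heat term minus Dw \<bullet> (V1 - V2).  Collecting
  the terms with m1 and those with m2 gives two Taylor remainders of H between Du1 and Du2, each of
  which is at most -\<alpha>/2 |Dw|^2 by strong convexity.
\<close>

lemma lasry_lions_derivative:
  assumes mono: "\<And>x. mono_on {0..M} (\<lambda>m. F x m + \<gamma> * m)" and t: "t \<in> {0<..<T}"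
  shows "\<exists>D. ((\<lambda>t. cell_integral (\<lambda>x. w t x * \<mu> t x)) has_real_derivative D) (at t) \<and>
    D \<le> \<gamma> * cell_integral (\<lambda>x. (\<mu> t x)\<^sup>2)
      - \<alpha> U / 2 * cell_integral (\<lambda>x. (m1 t x + m2 t x) * (norm (dw t x))\<^sup>2)"
proof -
  have tc: "t \<in> {0..T}" using t by auto
  let ?wt = "\<lambda>t x. deriv (\<lambda>s. u1 s x) t - deriv (\<lambda>s. u2 s x) t"
  let ?\<mu>t = "\<lambda>t x. divergence (d1.flux t) x - divergence (d2.flux t) x"
  define D where "D = cell_integral (\<lambda>x. ?wt t x * \<mu> t x + ?\<mu>t t x * w t x)"
  have deriv: "((\<lambda>t. cell_integral (\<lambda>x. w t x * \<mu> t x)) has_real_derivative D) (at t)"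
    unfolding D_def
  proof (rule cell_integral_has_derivative[OF _ _ _ t])
    fix s x assume s: "s \<in> {0<..<T}"
    show "((\<lambda>s. w s x * \<mu> s x) has_real_derivative ?wt s x * \<mu> s x + ?\<mu>t s x * w s x) (at s)"
      by (intro DERIV_mult DERIV_diff u1(3) u2(3) d1.density_has_derivative d2.density_has_derivative s)
    show "continuous_on UNIV (\<lambda>x. w s x * \<mu> s x)"
      by (intro continuous_intros C1_continuous u1(6) u2(6) d1.density_C1 d2.density_C1 s)
  next
    have sub: "{0<..<T} \<times> (UNIV :: (real^'n) set) \<subseteq> {0..T} \<times> UNIV" by auto
    note c = continuous_on_subset[OF u1(2) sub, unfolded split_beta] continuous_on_subset[OF u2(2) sub, unfolded split_beta]
      continuous_on_subset[OF d1.density_continuous sub, unfolded split_beta] continuous_on_subset[OF d2.density_continuous sub, unfolded split_beta]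
      u1(5)[unfolded split_beta] u2(5)[unfolded split_beta]
      d1.divergence_flux_continuous[unfolded split_beta] d2.divergence_flux_continuous[unfolded split_beta]
    show "continuous_on ({0<..<T} \<times> UNIV) (\<lambda>(t, x). ?wt t x * \<mu> t x + ?\<mu>t t x * w t x)"
      unfolding split_beta by (intro continuous_on_add continuous_on_mult continuous_on_diff c)
  qed
  let ?V = "\<lambda>x. transport H u1 m1 t x - transport H u2 m2 t x"
  have C1\<mu>: "C1 (\<mu> t)" and g\<mu>: "grad (\<mu> t) x = grad (m1 t) x - grad (m2 t) x" for x
    by (intro C1_diff grad_diff d1.density_C1 d2.density_C1 t)+
  have per: "periodic (\<mu> t)" using d1.density_periodic[OF tc] d2.density_periodic[OF tc] by (auto simp: periodic_def)
  note C1V = d1.V_C1[OF t] d2.V_C1[OF t] and C1F = d1.flux_C1[OF t] d2.flux_C1[OF t]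
  have cwt: "continuous_on UNIV (?wt t)"
    using continuous_on_section[OF u1(5) t] continuous_on_section[OF u2(5) t] by (intro continuous_intros)
  note cs = continuous_intros cwt heat_continuous[OF t] C1_continuous_grad[OF u1(6)[OF t]] C1_continuous_grad[OF u2(6)[OF t]]
    C1_continuous_grad[OF d1.density_C1[OF t]] C1_continuous_grad[OF d2.density_C1[OF t]]
    u_sections[OF tc] C1_continuous[OF d1.density_C1[OF t]] C1_continuous[OF d2.density_C1[OF t]]
    C1_components_continuous(1)[OF C1V(1)] C1_components_continuous(1)[OF C1V(2)]
    C1_components_continuous[OF C1F(1)] C1_components_continuous[OF C1F(2)]
  let ?A = "\<lambda>x. \<mu> t x * heat t x - dw t x \<bullet> ?V x"
  have "D = cell_integral ?A"
  proof -
    note parts = cell_integral_by_parts[OF w_C1(3,1)[OF t], unfolded w_C1(2)[OF t]]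
    have "D = cell_integral (\<lambda>x. ?wt t x * \<mu> t x)
        + cell_integral (\<lambda>x. w t x * divergence (d1.flux t) x - w t x * divergence (d2.flux t) x)"
      unfolding D_def by (subst cell_integral_add[symmetric]; (intro cs)?; simp add: algebra_simps)
    also have "cell_integral (\<lambda>x. w t x * divergence (d1.flux t) x - w t x * divergence (d2.flux t) x)
        = - cell_integral (\<lambda>x. dw t x \<bullet> d1.flux t x) - - cell_integral (\<lambda>x. dw t x \<bullet> d2.flux t x)"
      unfolding parts[OF d1.flux_periodic[OF t] C1F(1), symmetric] parts[OF d2.flux_periodic[OF t] C1F(2), symmetric]
      by (rule cell_integral_diff; intro cs)
    also have "\<dots> = cell_integral (\<lambda>x. dw t x \<bullet> d2.flux t x - dw t x \<bullet> d1.flux t x)"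
      by (subst cell_integral_diff; (intro cs)?; simp)
    also have "cell_integral (\<lambda>x. ?wt t x * \<mu> t x) = cell_integral (\<lambda>x. heat t x * \<mu> t x + \<kappa> * (grad (\<mu> t) x \<bullet> dw t x))"
      by (rule heat_by_parts[OF t C1\<mu> per])
    also have "\<dots> + cell_integral (\<lambda>x. dw t x \<bullet> d2.flux t x - dw t x \<bullet> d1.flux t x)
        = cell_integral (\<lambda>x. (heat t x * \<mu> t x + \<kappa> * (grad (\<mu> t) x \<bullet> dw t x)) + (dw t x \<bullet> d2.flux t x - dw t x \<bullet> d1.flux t x))"
      unfolding g\<mu> by (rule cell_integral_add[symmetric]; intro cs)
    also have "\<dots> = cell_integral ?A"
    proof (rule arg_cong[where f="cell_integral"], rule ext)
      fix x
      have "(h * r + \<kappa> * ((a - b) \<bullet> d)) + (d \<bullet> (\<kappa> *\<^sub>R b + v2) - d \<bullet> (\<kappa> *\<^sub>R a + v1)) = r * h - d \<bullet> (v1 - v2)"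
        for h r :: real and a b d v1 v2 :: "real^'n"
        by (simp add: inner_diff_left inner_diff_right inner_add_right inner_commute algebra_simps)
      then show "(heat t x * \<mu> t x + \<kappa> * (grad (\<mu> t) x \<bullet> dw t x)) + (dw t x \<bullet> d2.flux t x - dw t x \<bullet> d1.flux t x) = ?A x"
        unfolding d1.flux_def d2.flux_def g\<mu> .
    qed
    finally show ?thesis .
  qed
  also have "\<dots> \<le> cell_integral (\<lambda>x. \<gamma> * (\<mu> t x)\<^sup>2 + - (\<alpha> U / 2) * ((m1 t x + m2 t x) * (norm (dw t x))\<^sup>2) + 0)"
  proof (rule cell_integral_mono)
    fix x :: "real^'n"
    let ?B = "\<lambda>x. \<gamma> * (\<mu> t x)\<^sup>2 + - (\<alpha> U / 2) * ((m1 t x + m2 t x) * (norm (dw t x))\<^sup>2) + 0"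
    assume x: "x \<in> cbox 0 1"
    show "?A x \<le> ?B x"
    proof (rule AE_torus_imp_le_cell[OF _ _ _ x])
      show "AE x in torus. ?A x \<le> ?B x"
        using ball
      proof eventually_elim
        case (elim x)
        let ?p1 = "grad (u1 t) x" and ?p2 = "grad (u2 t) x"
        let ?H1 = "H x ?p1" and ?H2 = "H x ?p2" and ?b1 = "grad (H x) ?p1" and ?b2 = "grad (H x) ?p2"
        note p = grad_bounds[OF t, of x]
        note m = d1.density_nonneg[OF tc, of x] d1.density_le[OF tc, of x] d2.density_nonneg[OF tc, of x] d2.density_le[OF tc, of x]
        have conv1: "?H1 + (?p2 - ?p1) \<bullet> ?b1 + \<alpha> U / 2 * (norm (?p2 - ?p1))\<^sup>2 \<le> ?H2"
          by (rule strong_convexity_on_ball[OF _ _ p]) (use elim in auto)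
        have conv2: "?H2 + (?p1 - ?p2) \<bullet> ?b2 + \<alpha> U / 2 * (norm (?p1 - ?p2))\<^sup>2 \<le> ?H1"
          by (rule strong_convexity_on_ball[OF _ _ p(2,1)]) (use elim in auto)
        have c1: "m1 t x * (?H1 - ?H2 - dw t x \<bullet> ?b1) \<le> m1 t x * (- (\<alpha> U / 2 * (norm (dw t x))\<^sup>2))"
          using conv1 m by (intro mult_left_mono) (auto simp: inner_diff_left norm_minus_commute)
        have c2: "m2 t x * (?H2 - ?H1 + dw t x \<bullet> ?b2) \<le> m2 t x * (- (\<alpha> U / 2 * (norm (dw t x))\<^sup>2))"
          using conv2 m by (intro mult_left_mono) (auto simp: inner_diff_left)
        have mon: "- \<gamma> * (\<mu> t x)\<^sup>2 \<le> (F x (m1 t x) - F x (m2 t x)) * \<mu> t x"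
          by (rule mono_coupling_gap[OF mono m])
        have "?A x = \<mu> t x * ((?H1 - ?H2) - (F x (m1 t x) - F x (m2 t x))) - (m1 t x * (dw t x \<bullet> ?b1) - m2 t x * (dw t x \<bullet> ?b2))"
          unfolding heat_eq[OF t] by (simp only: inner_diff_right inner_scaleR_right)
        also have "\<dots> = m1 t x * (?H1 - ?H2 - dw t x \<bullet> ?b1) + m2 t x * (?H2 - ?H1 + dw t x \<bullet> ?b2) - (F x (m1 t x) - F x (m2 t x)) * \<mu> t x"
          by (simp only: algebra_simps)
        also have "\<dots> \<le> m1 t x * (- (\<alpha> U / 2 * (norm (dw t x))\<^sup>2)) + m2 t x * (- (\<alpha> U / 2 * (norm (dw t x))\<^sup>2)) + \<gamma> * (\<mu> t x)\<^sup>2"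
          using c1 c2 mon by linarith
        finally show ?case by (simp add: algebra_simps)
      qed
    qed (intro cs)+
  qed (intro cs)+
  also have "\<dots> = \<gamma> * cell_integral (\<lambda>x. (\<mu> t x)\<^sup>2) + - (\<alpha> U / 2) * cell_integral (\<lambda>x. (m1 t x + m2 t x) * (norm (dw t x))\<^sup>2) + 0"
    by (rule cell_integral_affine; intro cs)
  finally show ?thesis using deriv by auto
qed

text \<open>
  When the densities coincide, w solves a backward linear inequality with zero terminal value: the
  difference of the Hamiltonians is at most L|Dw|, and diffusion absorbs it in the energy estimate
  up to a multiple of w^2.
\<close>

lemma value_functions_agree:
  assumes eq: "\<And>t x. t \<in> {0..T} \<Longrightarrow> m1 t x = m2 t x" and t: "t \<in> {0..T}"
  shows "u1 t x = u2 t x"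
proof -
  define A where "A = (L U)\<^sup>2 / (2 * \<kappa>)"
  let ?h = "\<lambda>t. cell_integral (\<lambda>x. (w t x)\<^sup>2)"
  have ch: "continuous_on {0..T} ?h"
    using u1(2) u2(2) by (intro cell_integral_continuous_on) (auto simp: split_beta intro!: continuous_intros)
  have "exp (A * t) * ?h t \<le> exp (A * T) * ?h T"
  proof (rule DERIV_nonneg_imp_increasing_open[where f="\<lambda>t. exp (A * t) * ?h t"])
    show "t \<le> T" using t by simp
    show "continuous_on {t..T} (\<lambda>t. exp (A * t) * ?h t)"
      by (intro continuous_intros continuous_on_subset[OF ch]) (use t in auto)
    fix s assume "t < s" "s < T"
    then have s: "s \<in> {0<..<T}" and sc: "s \<in> {0..T}" using t by auto
    let ?wt = "\<lambda>s x. deriv (\<lambda>r. u1 r x) s - deriv (\<lambda>r. u2 r x) s"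
    define D where "D = cell_integral (\<lambda>x. 2 * w s x * ?wt s x)"
    have Dh: "(?h has_real_derivative D) (at s)"
      unfolding D_def
    proof (rule cell_integral_has_derivative[OF _ _ _ s])
      fix r x assume r: "r \<in> {0<..<T}"
      show "((\<lambda>r. (w r x)\<^sup>2) has_real_derivative 2 * w r x * ?wt r x) (at r)"
        by (rule DERIV_cong[OF DERIV_power[OF DERIV_diff[OF u1(3)[OF r, of x] u2(3)[OF r, of x]], of 2]]) simp
      show "continuous_on UNIV (\<lambda>x. (w r x)\<^sup>2)" by (intro continuous_intros C1_continuous u1(6) u2(6) r)
    next
      have sub: "{0<..<T} \<times> (UNIV :: (real^'n) set) \<subseteq> {0..T} \<times> UNIV" by auto
      note c = continuous_on_subset[OF u1(2) sub, unfolded split_beta] continuous_on_subset[OF u2(2) sub, unfolded split_beta]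
        u1(5)[unfolded split_beta] u2(5)[unfolded split_beta]
      show "continuous_on ({0<..<T} \<times> UNIV) (\<lambda>(r, x). 2 * w r x * ?wt r x)"
        unfolding split_beta by (intro continuous_on_mult continuous_on_const continuous_on_diff c)
    qed
    note cs = continuous_intros heat_continuous[OF s] C1_continuous[OF u1(6)[OF s]] C1_continuous[OF u2(6)[OF s]]
      C1_continuous_grad[OF u1(6)[OF s]] C1_continuous_grad[OF u2(6)[OF s]]
    have "- A * ?h s = cell_integral (\<lambda>x. - A * (w s x)\<^sup>2)" by simp
    also have "\<dots> \<le> cell_integral (\<lambda>x. 2 * (heat s x * w s x + \<kappa> * (dw s x \<bullet> dw s x)))"
    proof (rule cell_integral_mono)
      fix x :: "real^'n" assume x: "x \<in> cbox 0 1"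
      have "\<bar>heat s x\<bar> \<le> L U * norm (dw s x)"
      proof (rule AE_torus_imp_le_cell[where f="\<lambda>x. \<bar>heat s x\<bar>", OF _ _ _ x])
        show "AE x in torus. \<bar>heat s x\<bar> \<le> L U * norm (dw s x)"
          using ball
        proof eventually_elim
          case (elim x)
          have "\<bar>H x (grad (u1 s) x) - H x (grad (u2 s) x)\<bar> \<le> L U * norm (dw s x)"
            by (rule lipschitz_on_ball[OF _ _ grad_bounds(2,1)[OF s]]) (use elim in \<open>auto simp: C2_def\<close>)
          then show ?case unfolding heat_eq[OF s] by (simp add: eq[OF sc])
        qed
      qed (intro cs)+
      then have "\<bar>w s x\<bar> * \<bar>heat s x\<bar> \<le> \<bar>w s x\<bar> * (L U * norm (dw s x))" by (intro mult_left_mono) auto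
      moreover have "- (\<bar>a\<bar> * \<bar>b\<bar>) \<le> b * a" for a b :: real by (simp add: abs_mult[symmetric] mult.commute abs_le_iff)
      ultimately have 1: "- (\<bar>w s x\<bar> * (L U * norm (dw s x))) \<le> heat s x * w s x" by (meson neg_le_iff_le order.trans)
      have "0 \<le> (2 * \<kappa> * norm (dw s x) - L U * \<bar>w s x\<bar>)\<^sup>2 / (2 * \<kappa>)" using kappa by simp
      also have "\<dots> = 2 * \<kappa> * (norm (dw s x))\<^sup>2 - 2 * (\<bar>w s x\<bar> * (L U * norm (dw s x))) + A * \<bar>w s x\<bar>\<^sup>2"
      proof -
        have "(2 * \<kappa> * y - l * z)\<^sup>2 / (2 * \<kappa>) = 2 * \<kappa> * y\<^sup>2 - 2 * (z * (l * y)) + l\<^sup>2 / (2 * \<kappa>) * z\<^sup>2" for y l z :: real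
          using kappa by (simp add: field_simps power2_eq_square)
        then show ?thesis unfolding A_def .
      qed
      finally have "- A * (w s x)\<^sup>2 \<le> 2 * \<kappa> * (norm (dw s x))\<^sup>2 - 2 * (\<bar>w s x\<bar> * (L U * norm (dw s x)))" by simp
      then show "- A * (w s x)\<^sup>2 \<le> 2 * (heat s x * w s x + \<kappa> * (dw s x \<bullet> dw s x))"
        using 1 unfolding power2_norm_eq_inner distrib_left mult.assoc[of 2 \<kappa>] by linarith
    qed (intro cs)+
    also have "\<dots> = 2 * cell_integral (\<lambda>x. heat s x * w s x + \<kappa> * (dw s x \<bullet> dw s x))" by (rule integral_mult_right)
    also have "cell_integral (\<lambda>x. heat s x * w s x + \<kappa> * (dw s x \<bullet> dw s x)) = cell_integral (\<lambda>x. ?wt s x * w s x)"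
      using heat_by_parts[OF s w_C1(1,3)[OF s]] unfolding w_C1(2)[OF s] by simp
    also have "2 * \<dots> = D" unfolding D_def by (subst integral_mult_right[symmetric]) (simp only: mult_ac)
    finally have "0 \<le> exp (A * s) * (A * ?h s + D)" by simp
    moreover have "((\<lambda>t. exp (A * t) * ?h t) has_real_derivative exp (A * s) * (A * ?h s + D)) (at s)"
    proof -
      have "((\<lambda>t. exp (A * t)) has_real_derivative exp (A * s) * A) (at s)" by (auto intro!: derivative_eq_intros)
      from DERIV_mult[OF this Dh] show ?thesis by (rule DERIV_cong) (simp add: algebra_simps)
    qed
    ultimately show "\<exists>y. ((\<lambda>t. exp (A * t) * ?h t) has_real_derivative y) (at s) \<and> 0 \<le> y" by blast
  qed
  also have "?h T = 0"
  proof -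
    have "u1 T y = u2 T y" for y using sol1 sol2 eq[of T y] T by (simp add: mfg_classical_solution_def)
    then show ?thesis by simp
  qed
  finally have "?h t \<le> 0" by (simp add: mult_le_0_iff)
  then show ?thesis by (rule cell_integral_square_eq_0[OF u_sections[OF t] u1(1)[OF t] u2(1)[OF t]])
qed

end

theorem theorem3p1:
  fixes \<kappa> M U L\<^sub>U \<alpha>\<^sub>U \<beta>\<^sub>U :: real
  assumes "0 < \<kappa>" "0 < M" "0 < U" "0 < L\<^sub>U" "0 < \<alpha>\<^sub>U" "0 < \<beta>\<^sub>U"
  shows "\<exists>\<gamma>>0. \<forall>T>0. \<forall>(H :: real^'n \<Rightarrow> real^'n \<Rightarrow> real) L \<alpha> \<beta> F G m0.
    hamiltonian H L \<alpha> \<beta> \<and> L U = L\<^sub>U \<and> \<alpha> U = \<alpha>\<^sub>U \<and> \<beta> U = \<beta>\<^sub>U \<and>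
    coupling F \<and> coupling G \<and> prob_density m0 \<and>
    (\<forall>x. mono_on {0..M} (\<lambda>m. F x m + \<gamma> * m)) \<and>
    (\<forall>x. mono_on {0..M} (\<lambda>m. G x m + \<gamma> * m)) \<longrightarrow>
    (\<forall>u\<^sub>1 m\<^sub>1 u\<^sub>2 m\<^sub>2.
       mfg_classical_solution \<kappa> T H F G m0 u\<^sub>1 m\<^sub>1 \<and> (u\<^sub>1, m\<^sub>1) \<in> mfg_X T M U \<and>
       mfg_classical_solution \<kappa> T H F G m0 u\<^sub>2 m\<^sub>2 \<and> (u\<^sub>2, m\<^sub>2) \<in> mfg_X T M U \<longrightarrow>
       (\<forall>t\<in>{0..T}. \<forall>x. u\<^sub>1 t x = u\<^sub>2 t x \<and> m\<^sub>1 t x = m\<^sub>2 t x))"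
proof -
  obtain c where c: "0 < c" "\<And>T (m :: real \<Rightarrow> real^'n \<Rightarrow> real) V t x.
      bounded_drift_density \<kappa> T m V M L\<^sub>U \<Longrightarrow> 2 \<le> t \<Longrightarrow> t < T \<Longrightarrow> c \<le> m t x"
    using density_lower_bound[of M \<kappa> L\<^sub>U] assms by (metis less_imp_le)
  \<comment> \<open>Times \<gamma>, the first two factors bound the weight of the discrimination, and the last factor is the
    constant of its source term; \<gamma> is chosen so that the whole product is \<alpha>/2.\<close>
  define Q where "Q = (2 * M + 1) * ((2 * M + 1) * real CARD('n) * 2 / (\<kappa> * c) + 1 + 2 * exp 2) * (\<beta>\<^sub>U\<^sup>2 / (2 * \<kappa>))"
  define \<gamma> where "\<gamma> = \<alpha>\<^sub>U / (2 * Q)"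
  have Q: "0 < Q" unfolding Q_def using assms c(1) by (intro mult_pos_pos add_pos_pos) auto
  have \<gamma>: "0 < \<gamma>" using Q assms by (simp add: \<gamma>_def)
  have "\<gamma> * Q = \<alpha>\<^sub>U / 2" using Q by (simp add: \<gamma>_def)
  then have small: "(2 * M + 1) * \<gamma> * ((2 * M + 1) * real CARD('n) * 2 / (\<kappa> * c) + 1 + 2 * exp 2) * (\<beta>\<^sub>U\<^sup>2 / (2 * \<kappa>)) \<le> \<alpha>\<^sub>U / 2"
    unfolding Q_def by (simp only: mult_ac order_refl)
  show ?thesis
  proof (intro exI[of _ \<gamma>] conjI \<gamma> allI impI ballI)
    fix T :: real and H :: "real^'n \<Rightarrow> real^'n \<Rightarrow> real" and L \<alpha> \<beta> :: "real \<Rightarrow> real"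
      and F G :: "real^'n \<Rightarrow> real \<Rightarrow> real" and m0 :: "real^'n \<Rightarrow> real"
      and u1 m1 u2 m2 :: "real \<Rightarrow> real^'n \<Rightarrow> real" and t :: real and x :: "real^'n"
    assume T: "0 < T"
    assume hyp: "hamiltonian H L \<alpha> \<beta> \<and> L U = L\<^sub>U \<and> \<alpha> U = \<alpha>\<^sub>U \<and> \<beta> U = \<beta>\<^sub>U \<and>
      coupling F \<and> coupling G \<and> prob_density m0 \<and>
      (\<forall>x. mono_on {0..M} (\<lambda>m. F x m + \<gamma> * m)) \<and> (\<forall>x. mono_on {0..M} (\<lambda>m. G x m + \<gamma> * m))"
    assume sols: "mfg_classical_solution \<kappa> T H F G m0 u1 m1 \<and> (u1, m1) \<in> mfg_X T M U \<and>
       mfg_classical_solution \<kappa> T H F G m0 u2 m2 \<and> (u2, m2) \<in> mfg_X T M U"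
    assume t: "t \<in> {0..T}"
    have L: "L U = L\<^sub>U" "\<alpha> U = \<alpha>\<^sub>U" "\<beta> U = \<beta>\<^sub>U"
      and monoF: "\<And>x. mono_on {0..M} (\<lambda>m. F x m + \<gamma> * m)" and monoG: "\<And>x. mono_on {0..M} (\<lambda>m. G x m + \<gamma> * m)"
      using hyp by auto
    interpret mfg_solutions \<kappa> T M U H L \<alpha> \<beta> F G m0 u1 m1 u2 m2
      by (rule mfg_solutions.intro) (use assms T hyp sols in auto)
    let ?f = "\<lambda>t. cell_integral (\<lambda>x. (u1 t x - u2 t x) * (m1 t x - m2 t x))"
    have init: "m1 0 x = m2 0 x" for x using sol1 sol2 by (simp add: mfg_classical_solution_def)
    have Tc: "T \<in> {0..T}" using T by simp
    have m_eq: "m1 s y = m2 s y" if s: "s \<in> {0..T}" for s y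
    proof (rule densities_agree[OF T c(1) _ init _ _ _ _ \<gamma> small[folded L] s])
      show "c \<le> m1 s x" if "2 \<le> s" "s < T" for s x
        by (rule c(2)[OF d1.bounded_drift_density_axioms[unfolded L] that])
      show "continuous_on {0..T} ?f"
        using u1(2) u2(2) d1.density_continuous d2.density_continuous
        by (intro cell_integral_continuous_on) (auto simp: split_beta intro!: continuous_intros)
      show "?f 0 = 0" by (simp add: init)
      show "- \<gamma> * cell_integral (\<lambda>x. (m1 T x - m2 T x)\<^sup>2) \<le> ?f T"
      proof -
        have "cell_integral (\<lambda>x. - \<gamma> * (m1 T x - m2 T x)\<^sup>2) \<le> ?f T"
        proof (rule cell_integral_mono)
          fix x
          have "u1 T x = G x (m1 T x)" "u2 T x = G x (m2 T x)"
            using sol1 sol2 by (auto simp: mfg_classical_solution_def)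
          then show "- \<gamma> * (m1 T x - m2 T x)\<^sup>2 \<le> (u1 T x - u2 T x) * (m1 T x - m2 T x)"
            using mono_coupling_gap[OF monoG d1.density_nonneg[OF Tc] d1.density_le[OF Tc] d2.density_nonneg[OF Tc] d2.density_le[OF Tc]]
            by simp
        qed (intro continuous_intros continuous_on_section[OF u1(2) Tc] continuous_on_section[OF u2(2) Tc]
            continuous_on_section[OF d1.density_continuous Tc] continuous_on_section[OF d2.density_continuous Tc])+
        then show ?thesis by simp
      qed
      show "\<exists>D. (?f has_real_derivative D) (at s) \<and>
        D \<le> \<gamma> * cell_integral (\<lambda>x. (m1 s x - m2 s x)\<^sup>2)
          - \<alpha> U / 2 * cell_integral (\<lambda>x. (m1 s x + m2 s x) * (norm (grad (u1 s) x - grad (u2 s) x))\<^sup>2)"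
        if "s \<in> {0<..<T}" for s
        using lasry_lions_derivative[OF monoF that] .
    qed
    show "m1 t x = m2 t x" by (rule m_eq[OF t])
    show "u1 t x = u2 t x"
      by (rule value_functions_agree[OF m_eq t])
  qed
qed

end
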